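(* Let $H$ be a semisimple Hopf algebra over an algebraically closed field $k$ of characteristic $0$, let $\{E_i\}$ be the set of primitive central idempotents of $H$ and let $d_i$ be the dimension of the irreducible $H$-module corresponding to $E_i$. Let $\Lambda^1,\Lambda^2$ be two copies of the idempotent integral of $H$. Then $$z_2:=\sum \Lambda^1_1\Lambda^2_1\,S(\Lambda^1_2)S(\Lambda^2_2)=\sum_i\frac{1}{d_i^2}E_i\in Z(H).$$
   Context: $H$ is finite dimensional with comultiplication $\Delta(h)=\sum h_1\otimes h_2$ (Sweedler notation), counit $\varepsilon$, antipode $S$ and center $Z(H)$. The idempotent integral is the element $\Lambda\in H$ with $h\Lambda=\varepsilon(h)\Lambda=\Lambda h$ for all $h\in H$ and $\varepsilon(\Lambda)=1$; for copies $\Lambda^i$ of it, $\Delta(\Lambda^i)=\sum\Lambda^i_1\otimes\Lambda^i_2$. *)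

theory Defs
  imports "HOL-Library.Poly_Mapping" "HOL-Computational_Algebra.Polynomial"
begin

section \<open>Tensor products\<close>

text \<open>
  The tensor products \<open>A \<otimes> A\<close> and \<open>A \<otimes> A \<otimes> A\<close> of a vector space with itself are the quotients of
  the free vector space on the pairs (triples) of elements of \<open>A\<close> by the subspace spanned by the
  multilinearity relations. An element of such a tensor product is given by a finite formal sum of
  pure tensors, i.e. a list: \<open>[(a\<^sub>1, b\<^sub>1), \<dots>, (a\<^sub>n, b\<^sub>n)]\<close> stands for
  \<open>a\<^sub>1 \<otimes> b\<^sub>1 + \<dots> + a\<^sub>n \<otimes> b\<^sub>n\<close>. Two lists are the same tensor if the formal sums that
  they denote are congruent modulo the relations.
\<close>

definition free_scale :: "'k::field \<Rightarrow> ('x \<Rightarrow>\<^sub>0 'k) \<Rightarrow> ('x \<Rightarrow>\<^sub>0 'k)" where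
  "free_scale c p = Poly_Mapping.map ((*) c) p"

lemma lookup_free_scale: "Poly_Mapping.lookup (free_scale c p) x = c * Poly_Mapping.lookup p x"
  by (simp add: free_scale_def Poly_Mapping.map.rep_eq when_def)

lemma vector_space_free_scale:
  "vector_space (free_scale :: 'k::field \<Rightarrow> ('x \<Rightarrow>\<^sub>0 'k) \<Rightarrow> ('x \<Rightarrow>\<^sub>0 'k))"
  by unfold_locales
    (auto intro!: poly_mapping_eqI simp: lookup_free_scale Poly_Mapping.lookup_add algebra_simps)

definition basis_vec :: "'x \<Rightarrow> ('x \<Rightarrow>\<^sub>0 'k::field)" where
  "basis_vec x = Poly_Mapping.single x 1"

definition formal_sum :: "'x list \<Rightarrow> ('x \<Rightarrow>\<^sub>0 'k::field)" where
  "formal_sum xs = (\<Sum>x\<leftarrow>xs. basis_vec x)"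

definition tensor2_relations ::
    "('k::field \<Rightarrow> 'a::ab_group_add \<Rightarrow> 'a) \<Rightarrow> (('a \<times> 'a) \<Rightarrow>\<^sub>0 'k) set" where
  "tensor2_relations s =
     {basis_vec (a + a', b) - basis_vec (a, b) - basis_vec (a', b) | a a' b. True} \<union>
     {basis_vec (a, b + b') - basis_vec (a, b) - basis_vec (a, b') | a b b'. True} \<union>
     {basis_vec (s c a, b) - free_scale c (basis_vec (a, b)) | c a b. True} \<union>
     {basis_vec (a, s c b) - free_scale c (basis_vec (a, b)) | c a b. True}"

definition tensor3_relations ::
    "('k::field \<Rightarrow> 'a::ab_group_add \<Rightarrow> 'a) \<Rightarrow> (('a \<times> 'a \<times> 'a) \<Rightarrow>\<^sub>0 'k) set" where
  "tensor3_relations s =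
     {basis_vec (a + a', b, d) - basis_vec (a, b, d) - basis_vec (a', b, d) | a a' b d. True} \<union>
     {basis_vec (a, b + b', d) - basis_vec (a, b, d) - basis_vec (a, b', d) | a b b' d. True} \<union>
     {basis_vec (a, b, d + d') - basis_vec (a, b, d) - basis_vec (a, b, d') | a b d d'. True} \<union>
     {basis_vec (s c a, b, d) - free_scale c (basis_vec (a, b, d)) | c a b d. True} \<union>
     {basis_vec (a, s c b, d) - free_scale c (basis_vec (a, b, d)) | c a b d. True} \<union>
     {basis_vec (a, b, s c d) - free_scale c (basis_vec (a, b, d)) | c a b d. True}"

definition tensor2_eq ::
    "('k::field \<Rightarrow> 'a::ab_group_add \<Rightarrow> 'a) \<Rightarrow> ('a \<times> 'a) list \<Rightarrow> ('a \<times> 'a) list \<Rightarrow> bool" where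
  "tensor2_eq s xs ys \<longleftrightarrow>
     formal_sum xs - formal_sum ys \<in> module.span free_scale (tensor2_relations s)"

definition tensor3_eq ::
    "('k::field \<Rightarrow> 'a::ab_group_add \<Rightarrow> 'a) \<Rightarrow>
     ('a \<times> 'a \<times> 'a) list \<Rightarrow> ('a \<times> 'a \<times> 'a) list \<Rightarrow> bool" where
  "tensor3_eq s xs ys \<longleftrightarrow>
     formal_sum xs - formal_sum ys \<in> module.span free_scale (tensor3_relations s)"


section \<open>Algebras and their modules\<close>

locale assoc_algebra = vector_space scale
  for scale :: "'k::field \<Rightarrow> 'h::ring_1 \<Rightarrow> 'h" +
  assumes scale_mult_left: "scale c x * y = scale c (x * y)"
    and scale_mult_right: "x * scale c y = scale c (x * y)"

text \<open>
  A left module whose underlying vector space is a subspace \<open>V\<close> of an ambient vector space; the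
  action is only relevant on \<open>V\<close>.
\<close>

locale algebra_module = assoc_algebra scale + vs: vector_space scaleV
  for scale :: "'k::field \<Rightarrow> 'h::ring_1 \<Rightarrow> 'h"
    and scaleV :: "'k \<Rightarrow> 'v::ab_group_add \<Rightarrow> 'v" +
  fixes act :: "'h \<Rightarrow> 'v \<Rightarrow> 'v"
    and V :: "'v set"
  assumes subspace_carrier: "vs.subspace V"
    and act_closed: "v \<in> V \<Longrightarrow> act h v \<in> V"
    and act_add_right: "v \<in> V \<Longrightarrow> w \<in> V \<Longrightarrow> act h (v + w) = act h v + act h w"
    and act_scale_right: "v \<in> V \<Longrightarrow> act h (scaleV c v) = scaleV c (act h v)"
    and act_add_left: "v \<in> V \<Longrightarrow> act (g + h) v = act g v + act h v"
    and act_scale_left: "v \<in> V \<Longrightarrow> act (scale c h) v = scaleV c (act h v)"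
    and act_mult: "v \<in> V \<Longrightarrow> act (g * h) v = act g (act h v)"
    and act_one: "v \<in> V \<Longrightarrow> act 1 v = v"
begin

definition submodule :: "'v set \<Rightarrow> bool" where
  "submodule U \<longleftrightarrow> vs.subspace U \<and> U \<subseteq> V \<and> (\<forall>h. \<forall>u\<in>U. act h u \<in> U)"

definition irreducible_module :: bool where
  "irreducible_module \<longleftrightarrow> V \<noteq> {0} \<and> (\<forall>U. submodule U \<longrightarrow> U = {0} \<or> U = V)"

definition semisimple_module :: bool where
  "semisimple_module \<longleftrightarrow>
     (\<forall>U. submodule U \<longrightarrow>
        (\<exists>W. submodule W \<and> U \<inter> W = {0} \<and> (\<forall>v\<in>V. \<exists>u\<in>U. \<exists>w\<in>W. v = u + w)))"

end

definition semisimple_algebra :: "('k::field \<Rightarrow> 'h::ring_1 \<Rightarrow> 'h) \<Rightarrow> bool" where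
  "semisimple_algebra scale \<longleftrightarrow> algebra_module.semisimple_module scale (*) UNIV"

definition center :: "'h::ring_1 set" where
  "center = {z. \<forall>x. z * x = x * z}"

definition central_idempotent :: "'h::ring_1 \<Rightarrow> bool" where
  "central_idempotent e \<longleftrightarrow> e \<in> center \<and> e * e = e"

definition primitive_central_idempotents :: "'h::ring_1 set" where
  "primitive_central_idempotents =
     {e. central_idempotent e \<and> e \<noteq> 0 \<and>
         (\<forall>f g. central_idempotent f \<and> central_idempotent g \<and> f * g = 0 \<and> e = f + g \<longrightarrow>
            f = 0 \<or> g = 0)}"


section \<open>Hopf algebras\<close>

text \<open>
  \<open>comult h\<close> is a Sweedler representation of \<open>\<Delta>(h)\<close>: a list of the pairs \<open>(h\<^sub>1, h\<^sub>2)\<close> in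
  \<open>\<Delta>(h) = \<Sum> h\<^sub>1 \<otimes> h\<^sub>2\<close>. The choice of representatives is arbitrary; all conditions on
  \<open>\<Delta>\<close> are equations in the tensor products, where addition is concatenation of lists.
\<close>

locale hopf_algebra = assoc_algebra scale
  for scale :: "'k::field \<Rightarrow> 'h::ring_1 \<Rightarrow> 'h" +
  fixes comult :: "'h \<Rightarrow> ('h \<times> 'h) list"
    and counit :: "'h \<Rightarrow> 'k"
    and antipode :: "'h \<Rightarrow> 'h"
  assumes comult_add: "tensor2_eq scale (comult (x + y)) (comult x @ comult y)"
    and comult_scale: "tensor2_eq scale (comult (scale c x)) [(scale c a, b). (a, b) \<leftarrow> comult x]"
    and comult_mult: "tensor2_eq scale (comult (x * y))
           [(a * c, b * d). (a, b) \<leftarrow> comult x, (c, d) \<leftarrow> comult y]"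
    and comult_one: "tensor2_eq scale (comult 1) [(1, 1)]"
    and coassoc: "tensor3_eq scale
           [(a\<^sub>1, a\<^sub>2, b). (a, b) \<leftarrow> comult x, (a\<^sub>1, a\<^sub>2) \<leftarrow> comult a]
           [(a, b\<^sub>1, b\<^sub>2). (a, b) \<leftarrow> comult x, (b\<^sub>1, b\<^sub>2) \<leftarrow> comult b]"
    and linear_counit: "Vector_Spaces.linear scale (*) counit"
    and counit_mult: "counit (x * y) = counit x * counit y"
    and counit_one: "counit 1 = 1"
    and counit_left: "(\<Sum>(a, b)\<leftarrow>comult x. scale (counit a) b) = x"
    and counit_right: "(\<Sum>(a, b)\<leftarrow>comult x. scale (counit b) a) = x"
    and linear_antipode: "Vector_Spaces.linear scale scale antipode"
    and antipode_left: "(\<Sum>(a, b)\<leftarrow>comult x. antipode a * b) = scale (counit x) 1"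
    and antipode_right: "(\<Sum>(a, b)\<leftarrow>comult x. a * antipode b) = scale (counit x) 1"

locale finite_dim_hopf_algebra = hopf_algebra +
  assumes finite_dim: "\<exists>B. finite B \<and> span B = UNIV"

definition idempotent_integral ::
    "('k::field \<Rightarrow> 'h::ring_1 \<Rightarrow> 'h) \<Rightarrow> ('h \<Rightarrow> 'k) \<Rightarrow> 'h \<Rightarrow> bool" where
  "idempotent_integral scale counit L \<longleftrightarrow>
     (\<forall>h. h * L = scale (counit h) L \<and> L * h = scale (counit h) L) \<and> counit L = 1"

end

theory Submission
  imports Defs Complex_Main
begin

text \<open>
  Write \<open>\<Lambda>\<close> for the integral, \<open>S\<close> for the antipode and \<open>n\<close> for the dimension of \<open>H\<close>.

  The tensor \<open>\<Lambda>\<^sub>1 \<otimes> S \<Lambda>\<^sub>2\<close> is a Casimir element: \<open>x \<Lambda>\<^sub>1 \<otimes> S \<Lambda>\<^sub>2 = \<Lambda>\<^sub>1 \<otimes> S \<Lambda>\<^sub>2 x\<close> (lemma \<open>casimir\<close>). On an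
  irreducible module, averaging an operator \<open>X\<close> over it therefore gives a scalar, by Schur's lemma. This
  scalar is \<open>tr(c X)\<close> for an operator \<open>c\<close> (called \<open>twist\<close>) with \<open>tr(c) = 1\<close>, and a direct computation shows
  that \<open>z\<^sub>2\<close> acts as \<open>c\<^sup>2\<close> (\<open>act_casimir_square\<close>). Moreover \<open>c\<close> intertwines the module with its pullback along
  \<open>S\<^sup>2\<close>. If \<open>S\<^sup>2 = id\<close>, then \<open>c\<close> is a scalar, namely \<open>1/d\<close>; so \<open>z\<^sub>2\<close> acts as \<open>1/d\<^sup>2\<close>. As a semisimple algebra
  acts faithfully on its irreducible modules, the formula follows.

  What carries the weight is thus the theorem of Larson and Radford that a semisimple Hopf algebra in
  characteristic \<open>0\<close> satisfies \<open>S\<^sup>2 = id\<close>. The functional \<open>frob(x) = Tr(h \<mapsto> S\<^sup>2(h x))\<close> is an integral of the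
  dual Hopf algebra and a Frobenius form with dual bases \<open>\<Lambda>\<^sub>1\<close> and \<open>S \<Lambda>\<^sub>2\<close>; its value at \<open>1\<close> is \<open>Tr(S\<^sup>2)\<close>.

  \<^item> A grouplike element \<open>g\<close>, the modular element, measures whether \<open>frob\<close> is two-sided. Radford's formula
    says that \<open>S\<^sup>4\<close> is conjugation by \<open>g\<close> (\<open>antipode_power_4\<close>), and \<open>g\<close> has finite order because distinct
    grouplike elements are independent.
  \<^item> On an irreducible module \<open>c\<^sup>2\<close> is a scalar multiple of \<open>g\<close>, so a multiple \<open>u\<close> of \<open>c\<close> has finite order, and
    the value of \<open>frob\<close> at the corresponding central idempotent is \<open>tr(u) tr(u\<^sup>-\<^sup>1)\<close>. For complex numbers this
    is \<open>\<bar>tr(u)\<bar>\<^sup>2\<close>; for the trivial module it is \<open>1\<close>. Summing over the blocks, \<open>frob(1) \<noteq> 0\<close>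
    (\<open>frob_one_nonzero\<close>), where positivity is transferred from the complex numbers to the given field by
    conjugating roots of unity.
  \<^item> Then \<open>g = 1\<close> and \<open>S\<^sup>4 = id\<close>. The operator \<open>S\<^sup>2 P\<close>, with \<open>P\<close> the convolution by the normalised regular
    character, has trace \<open>Tr(S\<^sup>2) / n\<close>, and this trace is a nonzero integer. But the trace of an involution lies
    between \<open>-n\<close> and \<open>n\<close>, so \<open>Tr(S\<^sup>2)\<close> is one of these two numbers, and as \<open>S\<^sup>2\<close> fixes \<open>1\<close> it is the identity
    (\<open>involutory\<close>).
\<close>

section \<open>Traces and eigenvectors in coordinates\<close>

text \<open>
  The irreducible modules live on subspaces of an ambient space of possibly infinite dimension, and the
  action is unspecified outside of these subspaces. Operators are therefore total functions whose values
  matter only on the span of a finite independent set, and traces are computed from coordinates there.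
\<close>

locale finite_basis = vector_space scale
  for scale :: "'k::field \<Rightarrow> 'v::ab_group_add \<Rightarrow> 'v" (infixr "*s" 75) +
  fixes B :: "'v set"
  assumes finite_basis: "finite B" and independent_basis: "independent B"
begin

abbreviation coord :: "'v \<Rightarrow> 'v \<Rightarrow> 'k" where
  "coord \<equiv> representation B"

definition operator :: "('v \<Rightarrow> 'v) \<Rightarrow> bool" where
  "operator f \<longleftrightarrow> (\<forall>v\<in>span B. f v \<in> span B) \<and>
     (\<forall>v\<in>span B. \<forall>w\<in>span B. f (v + w) = f v + f w) \<and>
     (\<forall>c. \<forall>v\<in>span B. f (c *s v) = c *s f v)"

definition functional :: "('v \<Rightarrow> 'k) \<Rightarrow> bool" where
  "functional p \<longleftrightarrow> (\<forall>v\<in>span B. \<forall>w\<in>span B. p (v + w) = p v + p w) \<and>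
     (\<forall>c. \<forall>v\<in>span B. p (c *s v) = c * p v)"

definition tr :: "('v \<Rightarrow> 'v) \<Rightarrow> 'k" where
  "tr f = (\<Sum>b\<in>B. coord (f b) b)"

lemma operatorI:
  assumes "\<And>v. v \<in> span B \<Longrightarrow> f v \<in> span B"
    and "\<And>v w. v \<in> span B \<Longrightarrow> w \<in> span B \<Longrightarrow> f (v + w) = f v + f w"
    and "\<And>c v. v \<in> span B \<Longrightarrow> f (c *s v) = c *s f v"
  shows "operator f"
  using assms by (auto simp: operator_def)

lemma operatorD:
  assumes "operator f" "v \<in> span B"
  shows "f v \<in> span B" "w \<in> span B \<Longrightarrow> f (v + w) = f v + f w" "f (c *s v) = c *s f v"
  using assms by (auto simp: operator_def)

lemma operator_comp: "operator f \<Longrightarrow> operator g \<Longrightarrow> operator (\<lambda>v. f (g v))"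
  by (rule operatorI) (simp_all add: operatorD)

lemma operator_id: "operator (\<lambda>v. v)"
  by (rule operatorI) simp_all

lemma operator_add: "operator f \<Longrightarrow> operator g \<Longrightarrow> operator (\<lambda>v. f v + g v)"
  by (rule operatorI) (simp_all add: operatorD span_add scale_right_distrib algebra_simps)

lemma operator_scale: "operator f \<Longrightarrow> operator (\<lambda>v. c *s f v)"
  by (rule operatorI) (simp_all add: operatorD span_scale scale_right_distrib mult.commute)

lemma operator_sum:
  assumes "\<And>i. i \<in> I \<Longrightarrow> operator (f i)"
  shows "operator (\<lambda>v. \<Sum>i\<in>I. f i v)"
  by (rule operatorI)
    (simp_all add: operatorD[OF assms] span_sum sum.distrib scale_sum_right cong: sum.cong)

lemma operator_funpow: "operator f \<Longrightarrow> operator (f ^^ j)"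
proof (induction j)
  case (Suc j)
  then show ?case using operator_comp[of f "f ^^ j"] by (simp add: comp_def)
qed (simp add: id_def operator_id)

lemma operator_zero: "operator f \<Longrightarrow> f 0 = 0"
  using operatorD(3)[of f 0 0] by (simp add: span_zero)

lemma operator_sum_arg:
  assumes "operator f" "\<And>i. i \<in> I \<Longrightarrow> g i \<in> span B"
  shows "f (\<Sum>i\<in>I. g i) = (\<Sum>i\<in>I. f (g i))"
  using assms(2)
  by (induction I rule: infinite_finite_induct)
    (simp_all add: operator_zero[OF assms(1)] operatorD[OF assms(1)] span_sum)

lemma functional_coord: "functional (\<lambda>v. coord v b)"
  by (simp add: functional_def representation_add representation_scale independent_basis)

lemma functional_comp: "functional p \<Longrightarrow> operator f \<Longrightarrow> functional (\<lambda>v. p (f v))"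
  by (simp add: functional_def operatorD)

lemma functional_zero: "functional p \<Longrightarrow> p 0 = 0"
  by (metis functional_def mult_zero_left scale_zero_left span_zero)

lemma functional_sum_arg:
  assumes "functional p" "\<And>i. i \<in> I \<Longrightarrow> g i \<in> span B"
  shows "p (\<Sum>i\<in>I. g i) = (\<Sum>i\<in>I. p (g i))"
  using assms(2)
  by (induction I rule: infinite_finite_induct)
    (use assms(1) in \<open>simp_all add: functional_zero[OF assms(1)] functional_def span_sum\<close>)

lemma operator_sum_list:
  assumes "\<And>x. operator (G x)"
  shows "operator (\<lambda>v. \<Sum>x\<leftarrow>xs. G x v)"
proof (induction xs)
  case Nil
  show ?case by (rule operatorI) (simp_all add: span_zero)
next
  case (Cons x xs)
  then show ?case using operator_add[OF assms[of x]] by simp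
qed

lemma sum_list_in_span: "(\<And>x. g x \<in> span B) \<Longrightarrow> (\<Sum>x\<leftarrow>xs. g x) \<in> span B"
  by (induction xs) (simp_all add: span_zero span_add)

lemma operator_sum_list_arg:
  assumes "operator f" "\<And>x. g x \<in> span B"
  shows "f (\<Sum>x\<leftarrow>xs. g x) = (\<Sum>x\<leftarrow>xs. f (g x))"
  by (induction xs) (simp_all add: operator_zero[OF assms(1)] operatorD[OF assms(1)] assms sum_list_in_span)

lemma functional_sum_list_arg:
  assumes "functional p" "\<And>x. g x \<in> span B"
  shows "p (\<Sum>x\<leftarrow>xs. g x) = (\<Sum>x\<leftarrow>xs. p (g x))"
proof (induction xs)
  case Nil
  then show ?case by (simp add: functional_zero[OF assms(1)])
next
  case (Cons x xs)
  have "p (g x + (\<Sum>x\<leftarrow>xs. g x)) = p (g x) + p (\<Sum>x\<leftarrow>xs. g x)"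
    using assms sum_list_in_span[of g xs] by (simp add: functional_def)
  then show ?case using Cons by simp
qed

lemma operator_scale_functional:
  assumes "functional p" "w \<in> span B" shows "operator (\<lambda>v. p v *s w)"
  using assms by (intro operatorI) (simp_all add: functional_def span_scale scale_left_distrib)

lemma coord_expand: "v \<in> span B \<Longrightarrow> (\<Sum>b\<in>B. coord v b *s b) = v"
  by (rule sum_representation_eq[OF independent_basis _ finite_basis subset_refl])

lemma coord_basis: "b \<in> B \<Longrightarrow> coord b b' = (if b' = b then 1 else 0)"
  by (simp add: representation_basis independent_basis)

lemma basis_in_span: "b \<in> B \<Longrightarrow> b \<in> span B"
  by (rule span_base)

lemma coord_eqI:
  assumes "v \<in> span B" "w \<in> span B" "\<And>b. b \<in> B \<Longrightarrow> coord v b = coord w b"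
  shows "v = w"
  using coord_expand[OF assms(1)] coord_expand[OF assms(2)] assms(3) by (metis (no_types, lifting) sum.cong)

lemma operator_expand:
  assumes "operator f" "v \<in> span B"
  shows "f v = (\<Sum>b\<in>B. coord v b *s f b)"
proof -
  have "f v = f (\<Sum>b\<in>B. coord v b *s b)" by (simp add: coord_expand assms)
  also have "\<dots> = (\<Sum>b\<in>B. coord v b *s f b)"
    by (subst operator_sum_arg) (auto simp: assms operatorD span_base span_scale)
  finally show ?thesis .
qed

lemma functional_expand:
  assumes "functional p" "v \<in> span B"
  shows "p v = (\<Sum>b\<in>B. coord v b * p b)"
proof -
  have "p v = p (\<Sum>b\<in>B. coord v b *s b)" by (simp add: coord_expand assms)
  also have "\<dots> = (\<Sum>b\<in>B. coord v b * p b)"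
    by (subst functional_sum_arg) (use assms in \<open>auto simp: functional_def span_base span_scale\<close>)
  finally show ?thesis .
qed

lemma tr_cong: "(\<And>v. v \<in> span B \<Longrightarrow> f v = g v) \<Longrightarrow> tr f = tr g"
  by (simp add: tr_def span_base)

lemma tr_commute:
  assumes "operator f" "operator g"
  shows "tr (\<lambda>v. f (g v)) = tr (\<lambda>v. g (f v))"
proof -
  have *: "coord (f (g b)) b = (\<Sum>b'\<in>B. coord (g b) b' * coord (f b') b)"
    if "operator f" "operator g" "b \<in> B" for f g b
    using functional_expand[OF functional_comp[OF functional_coord that(1)] operatorD(1)[OF that(2)], of b b]
      that(3) by (simp add: span_base)
  show ?thesis
    unfolding tr_def using assms by (simp add: * mult.commute) (rule sum.swap)
qed

lemma tr_add: "operator f \<Longrightarrow> operator g \<Longrightarrow> tr (\<lambda>v. f v + g v) = tr f + tr g"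
  by (simp add: tr_def representation_add independent_basis operatorD span_base sum.distrib)

lemma tr_scale: "operator f \<Longrightarrow> tr (\<lambda>v. c *s f v) = c * tr f"
  by (simp add: tr_def representation_scale independent_basis operatorD span_base sum_distrib_left)

lemma tr_sum:
  assumes "\<And>i. i \<in> I \<Longrightarrow> operator (f i)"
  shows "tr (\<lambda>v. \<Sum>i\<in>I. f i v) = (\<Sum>i\<in>I. tr (f i))"
  unfolding tr_def
  by (subst sum.swap) (simp add: representation_sum independent_basis operatorD[OF assms] span_base
      cong: sum.cong)

lemma tr_id: "tr (\<lambda>v. v) = of_nat (card B)"
  by (simp add: tr_def coord_basis)

text \<open>
  The trace of an idempotent is its rank: factor it through a basis of its range. Integrality of traces
  enters the whole argument only through this lemma.
\<close>

lemma tr_idempotent: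
  assumes "operator P" "\<And>v. v \<in> span B \<Longrightarrow> P (P v) = P v"
  obtains r where "tr P = of_nat r" "r \<le> card B"
    "r = card B \<Longrightarrow> \<forall>v\<in>span B. P v = v" "r = 0 \<Longrightarrow> \<forall>v\<in>span B. P v = 0"
proof -
  define R where "R = P ` span B"
  have RV: "R \<subseteq> span B" using assms(1) by (auto simp: R_def operatorD)
  have PR: "P w = w" if "w \<in> R" for w using that assms(2) by (auto simp: R_def)
  have sub: "subspace R"
  proof (rule subspaceI)
    show "0 \<in> R" unfolding R_def using operator_zero[OF assms(1)] span_zero by (metis imageI)
    show "x + y \<in> R" if "x \<in> R" "y \<in> R" for x y
      using that RV PR operatorD(2)[OF assms(1), of x y] unfolding R_def
      by (metis imageI in_mono span_add)
    show "c *s x \<in> R" if "x \<in> R" for c x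
      using that RV PR operatorD(3)[OF assms(1), of x c] unfolding R_def
      by (metis imageI in_mono span_scale)
  qed
  obtain C where C: "C \<subseteq> R" "independent C" "R \<subseteq> span C" "card C = dim R"
    using basis_exists by blast
  have finC: "finite C" and cardC: "card C \<le> card B"
    using independent_span_bound[OF finite_basis C(2)] C(1) RV by auto
  interpret C: finite_basis scale C
    by unfold_locales (use finC C(2) in auto)
  have spanC: "span C = R" using C sub by (simp add: span_subspace)
  have cP: "P v \<in> span C" if "v \<in> span B" for v using that by (auto simp: spanC R_def)
  \<comment> \<open>Write the diagonal entries of \<open>P\<close> through the smaller basis \<open>C\<close> and contract over \<open>B\<close>.\<close>
  have "tr P = (\<Sum>b\<in>B. \<Sum>c\<in>C. C.coord (P b) c * coord c b)"
  proof (unfold tr_def, rule sum.cong[OF refl])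
    fix b assume b: "b \<in> B"
    have "coord (P b) b = coord (\<Sum>c\<in>C. C.coord (P b) c *s c) b"
      using C.coord_expand[OF cP] b by (simp add: span_base)
    also have "\<dots> = (\<Sum>c\<in>C. C.coord (P b) c * coord c b)"
    proof (subst functional_sum_arg[OF functional_coord])
      fix c assume "c \<in> C"
      then show "C.coord (P b) c *s c \<in> span B" using C(1) RV by (auto intro: span_scale)
    next
      show "(\<Sum>c\<in>C. coord (C.coord (P b) c *s c) b) = (\<Sum>c\<in>C. C.coord (P b) c * coord c b)"
        using C(1) RV by (intro sum.cong refl) (metis functional_coord functional_def in_mono)
    qed
    finally show "coord (P b) b = (\<Sum>c\<in>C. C.coord (P b) c * coord c b)" .
  qed
  also have "\<dots> = (\<Sum>c\<in>C. \<Sum>b\<in>B. coord c b * C.coord (P b) c)"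
    by (subst sum.swap) (simp add: mult.commute)
  also have "\<dots> = (\<Sum>c\<in>C. C.coord (P c) c)"
  proof (rule sum.cong[OF refl])
    fix c assume c: "c \<in> C"
    have "functional (\<lambda>v. C.coord (P v) c)"
      using C.functional_coord[of c] cP operatorD[OF assms(1)]
      by (simp add: functional_def C.functional_def)
    from functional_expand[OF this, of c] c C(1) RV
    show "(\<Sum>b\<in>B. coord c b * C.coord (P b) c) = C.coord (P c) c" by auto
  qed
  also have "\<dots> = of_nat (card C)"
    using C(1) by (simp add: PR in_mono C.coord_basis cong: sum.cong)
  finally have 1: "tr P = of_nat (card C)" .
  have 2: "P v = v" if "card C = card B" "v \<in> span B" for v
  proof -
    have "span B \<subseteq> span C"
    proof (rule ccontr)
      assume "\<not> span B \<subseteq> span C"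
      then obtain w where w: "w \<in> span B" "w \<notin> span C" by auto
      then have "independent (insert w C)" using C(2) independent_insert by auto
      moreover have "insert w C \<subseteq> span B" using w C(1) RV by auto
      ultimately have "card (insert w C) \<le> card B"
        using independent_span_bound[OF finite_basis] by blast
      moreover have "w \<notin> C" using w span_base by blast
      ultimately show False using finC that(1) by simp
    qed
    then show ?thesis using that PR spanC by auto
  qed
  have 3: "P v = 0" if "card C = 0" "v \<in> span B" for v
  proof -
    have "C = {}" using that finC by simp
    then have "R = {0}" using spanC by simp
    then show ?thesis using that by (auto simp: R_def)
  qed
  show ?thesis using that[of "card C"] 1 2 3 cardC by blast
qed

text \<open>
  An operator of finite order is diagonalisable with roots of unity as eigenvalues. The projection to
  the eigenspace of \<open>z ^ l\<close> is the Fourier average of the powers of \<open>f\<close>, and \<open>m l\<close> is its rank; so the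
  traces of \<^emph>\<open>all\<close> powers of \<open>f\<close> are given by the same multiplicities.
\<close>

lemma tr_funpow_torsion:
  fixes z :: 'k
  assumes M: "0 < M" "(of_nat M :: 'k) \<noteq> 0" and z: "z ^ M = 1" "\<And>l. 0 < l \<Longrightarrow> l < M \<Longrightarrow> z ^ l \<noteq> 1"
    and f: "operator f" and fM: "\<And>v. v \<in> span B \<Longrightarrow> (f ^^ M) v = v"
  obtains m :: "nat \<Rightarrow> nat" where "\<And>j. tr (f ^^ j) = (\<Sum>l<M. of_nat (m l) * z ^ (l * j))"
proof -
  \<comment> \<open>\<open>y\<close> is the inverse of \<open>z\<close>.\<close>
  define y where "y = z ^ (M - 1)"
  have yz: "y * z = 1" using M z(1) by (simp add: y_def flip: power_Suc2)
  have yM: "y ^ M = 1" by (metis mult.right_neutral power_mult_distrib power_one yz z(1))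
  define P where "P l v = inverse (of_nat M) *s (\<Sum>j<M. y ^ (l * j) *s (f ^^ j) v)" for l v
  have opP: "operator (P l)" for l
    unfolding P_def by (intro operator_scale operator_sum operator_funpow f)
  have fP: "f (P l v) = z ^ l *s P l v" if v: "v \<in> span B" for l v
  proof -
    define g where "g j = y ^ (l * j) *s (f ^^ j) v" for j
    have gV: "g j \<in> span B" for j
      unfolding g_def using operatorD(1)[OF operator_funpow[OF f] v] by (intro span_scale)
    \<comment> \<open>Applying \<open>f\<close> shifts the Fourier sum cyclically, up to the factor \<open>z ^ l\<close>.\<close>
    have "f (g j) = z ^ l *s g (Suc j)" for j
    proof -
      have "f (g j) = y ^ (l * j) *s (f ^^ Suc j) v"
        unfolding g_def using operatorD(1)[OF operator_funpow[OF f] v] f by (simp add: operatorD)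
      also have "\<dots> = z ^ l *s g (Suc j)"
        unfolding g_def by (simp add: power_add flip: mult.assoc)
          (metis mult.commute mult.left_neutral power_mult_distrib power_one yz)
      finally show ?thesis .
    qed
    then have "f (\<Sum>j<M. g j) = z ^ l *s (\<Sum>j<M. g (Suc j))"
      using gV by (subst operator_sum_arg[OF f]) (simp_all add: scale_sum_right)
    moreover have "(\<Sum>j<M. g (Suc j)) = (\<Sum>j<M. g j)"
    proof -
      have "g M = g 0" using fM[OF v] by (simp add: g_def mult.commute power_mult yM)
      moreover have "(\<Sum>j<M. g (Suc j)) + g 0 = (\<Sum>j<M. g j) + g M"
        by (metis add.commute sum.lessThan_Suc sum.lessThan_Suc_shift)
      ultimately show ?thesis by simp
    qed
    ultimately show ?thesis
      unfolding P_def g_def[symmetric] using gV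
      by (subst operatorD(3)[OF f]) (auto intro: span_sum simp: mult.commute)
  qed
  have fjP: "(f ^^ j) (P l v) = z ^ (l * j) *s P l v" if v: "v \<in> span B" for j l v
  proof (induction j)
    case (Suc j)
    then show ?case using fP[OF v] operatorD(1)[OF opP v]
      by (simp add: operatorD[OF f] power_add mult.commute)
  qed simp
  have PP: "P l (P l v) = P l v" if v: "v \<in> span B" for l v
  proof -
    have "P l (P l v) = inverse (of_nat M) *s (\<Sum>j<M. (y ^ (l * j) * z ^ (l * j)) *s P l v)"
      using fjP[OF v] by (simp add: P_def[of l "P l v"])
    also have "\<dots> = P l v"
      using M by (simp add: yz sum_constant_scale flip: power_mult_distrib)
    finally show ?thesis .
  qed
  have sumP: "(\<Sum>l<M. P l v) = v" if v: "v \<in> span B" for v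
  proof -
    have geo: "(\<Sum>l<M. y ^ (l * j)) = (if j = 0 then of_nat M else 0)" if "j < M" for j
    proof (cases "j = 0")
      case False
      have "y ^ j \<noteq> 1"
      proof
        assume "y ^ j = 1"
        then have "z ^ j = 1" by (metis mult.left_neutral power_mult_distrib power_one yz)
        then show False using z(2)[of j] False that by simp
      qed
      moreover have "(\<Sum>l<M. (y ^ j) ^ l) * (y ^ j - 1) = (y ^ j) ^ M - 1"
        by (metis geometric_sum[OF \<open>y ^ j \<noteq> 1\<close>] \<open>y ^ j \<noteq> 1\<close> eq_iff_diff_eq_0 nonzero_eq_divide_eq)
      moreover have "(y ^ j) ^ M = 1" by (metis mult.commute power_mult power_one yM)
      ultimately show ?thesis using False by (simp add: mult.commute[of _ j] power_mult)
    qed simp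
    have "(\<Sum>l<M. P l v) = inverse (of_nat M) *s (\<Sum>j<M. (\<Sum>l<M. y ^ (l * j)) *s (f ^^ j) v)"
      unfolding P_def scale_sum_right scale_sum_left by (rule sum.swap)
    also have "\<dots> = inverse (of_nat M) *s (\<Sum>j<M. if j = 0 then of_nat M *s v else 0)"
      by (intro arg_cong2[of _ _ _ _ scale] sum.cong refl) (use geo in auto)
    also have "\<dots> = v" using M by simp
    finally show ?thesis .
  qed
  have "\<exists>r::nat. tr (P l) = of_nat r" for l
    using tr_idempotent[OF opP PP] by metis
  then obtain m :: "nat \<Rightarrow> nat" where m: "\<And>l. tr (P l) = of_nat (m l)" by metis
  have "tr (f ^^ j) = (\<Sum>l<M. of_nat (m l) * z ^ (l * j))" for j
  proof -
    have "tr (f ^^ j) = tr (\<lambda>v. \<Sum>l<M. z ^ (l * j) *s P l v)"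
    proof (rule tr_cong)
      fix v assume v: "v \<in> span B"
      have "(f ^^ j) v = (f ^^ j) (\<Sum>l<M. P l v)" by (simp add: sumP v)
      also have "\<dots> = (\<Sum>l<M. z ^ (l * j) *s P l v)"
        using operatorD(1)[OF opP v] fjP[OF v]
        by (subst operator_sum_arg[OF operator_funpow[OF f]]) auto
      finally show "(f ^^ j) v = (\<Sum>l<M. z ^ (l * j) *s P l v)" .
    qed
    also have "\<dots> = (\<Sum>l<M. z ^ (l * j) * tr (P l))"
      by (simp add: tr_sum tr_scale operator_scale opP)
    finally show ?thesis by (simp add: m mult.commute)
  qed
  then show ?thesis using that by blast
qed

end

text \<open>
  A nonzero polynomial of least degree among those that annihilate a fixed vector \<open>u\<close> has a root \<open>c\<close>;
  dividing by the corresponding linear factor gives an eigenvector.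
\<close>

lemma exists_eigenvector:
  fixes scale :: "'k::alg_closed_field \<Rightarrow> 'v::ab_group_add \<Rightarrow> 'v"
  assumes "finite_basis scale B" "B \<noteq> {}" and f: "finite_basis.operator scale B f"
  obtains c v where "v \<in> module.span scale B" "v \<noteq> 0" "f v = scale c v"
proof -
  interpret finite_basis scale B by fact
  obtain u where u: "u \<in> B" using assms(2) by blast
  then have u0: "u \<noteq> 0" using independent_basis dependent_zero by blast
  have uV: "(f ^^ i) u \<in> span B" for i
    using operatorD(1)[OF operator_funpow[OF f] span_base[OF u]] .
  \<comment> \<open>\<open>ev p\<close> is \<open>p(f) u\<close>.\<close>
  define ev where "ev p = (\<Sum>i\<le>degree p. scale (coeff p i) ((f ^^ i) u))" for p
  have ev_ge: "ev p = (\<Sum>i\<le>m. scale (coeff p i) ((f ^^ i) u))" if "m \<ge> degree p" for p m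
    unfolding ev_def by (rule sum.mono_neutral_left) (use that in \<open>auto simp: coeff_eq_0\<close>)
  have evV: "ev p \<in> span B" for p unfolding ev_def by (intro span_sum span_scale uV)
  have "\<exists>p. p \<noteq> 0 \<and> ev p = 0"
  proof (cases "inj_on (\<lambda>i. (f ^^ i) u) {..card B}")
    case True
    have "dependent ((\<lambda>i. (f ^^ i) u) ` {..card B})"
    proof (rule ccontr)
      assume "\<not> ?thesis"
      then have "card ((\<lambda>i. (f ^^ i) u) ` {..card B}) \<le> card B"
        using independent_span_bound[OF finite_basis] uV by blast
      then show False using card_image[OF True] by simp
    qed
    then obtain w i where w: "(\<Sum>v\<in>(\<lambda>i. (f ^^ i) u) ` {..card B}. scale (w v) v) = 0"
      and i: "i \<le> card B" "w ((f ^^ i) u) \<noteq> 0"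
      by (subst (asm) dependent_finite) auto
    define p where "p = (\<Sum>i\<le>card B. monom (w ((f ^^ i) u)) i)"
    have cp: "coeff p j = (if j \<le> card B then w ((f ^^ j) u) else 0)" for j
      by (simp add: p_def coeff_sum)
    have "degree p \<le> card B" by (rule degree_le) (simp add: cp)
    then have "ev p = (\<Sum>i\<le>card B. scale (w ((f ^^ i) u)) ((f ^^ i) u))"
      by (subst ev_ge, assumption) (intro sum.cong, auto simp: cp)
    then have "ev p = 0" using w by (simp add: sum.reindex[OF True])
    moreover have "p \<noteq> 0" using cp[of i] i by auto
    ultimately show ?thesis by blast
  next
    case False
    then obtain i j where ij: "i \<noteq> j" "(f ^^ i) u = (f ^^ j) u" by (auto simp: inj_on_def)
    define p :: "'k poly" where "p = monom 1 i - monom 1 j"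
    have cp: "coeff p l = (if l = i then 1 else 0) - (if l = j then 1 else 0)" for l
      by (simp add: p_def)
    have "degree p \<le> max i j" by (rule degree_le) (auto simp: cp)
    then have "ev p = (\<Sum>l\<le>max i j. (if l = i then (f ^^ l) u else 0) - (if l = j then (f ^^ l) u else 0))"
      by (subst ev_ge, assumption) (intro sum.cong, auto simp: cp)
    also have "\<dots> = 0" using ij(2) by (simp add: sum_subtractf)
    finally have "ev p = 0" .
    moreover have "p \<noteq> 0" using cp[of i] ij(1) by auto
    ultimately show ?thesis by blast
  qed
  then obtain p where p: "p \<noteq> 0" "ev p = 0" and
    min: "\<And>q. degree q < degree p \<Longrightarrow> q \<noteq> 0 \<Longrightarrow> ev q \<noteq> 0"
    using ex_has_least_nat[of "\<lambda>p. p \<noteq> 0 \<and> ev p = 0" _ degree] by (metis leD)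
  have "degree p > 0"
  proof (rule ccontr)
    assume "\<not> ?thesis"
    then obtain a where "p = [:a:]" by (metis degree_eq_zeroE gr0I)
    then show False using p u0 by (auto simp: ev_def)
  qed
  then obtain c where "poly p c = 0" using alg_closed_imp_poly_has_root by blast
  then obtain q where q: "p = [:-c, 1:] * q" by (metis dvdE poly_eq_0_iff_dvd)
  have q0: "q \<noteq> 0" using p q by auto
  have dq: "degree p = Suc (degree q)" unfolding q using q0 by (subst degree_mult_eq) auto
  have "ev p = f (ev q) - scale c (ev q)"
  proof -
    have "ev p = (\<Sum>i\<le>Suc (degree q). scale (coeff (pCons 0 q) i) ((f ^^ i) u)) -
        (\<Sum>i\<le>Suc (degree q). scale c (scale (coeff q i) ((f ^^ i) u)))"
      unfolding ev_def dq
      by (simp only: q mult_pCons_left sum_subtractf[symmetric])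
        (rule sum.cong, auto simp: scale_left_diff_distrib)
    also have "(\<Sum>i\<le>Suc (degree q). scale (coeff (pCons 0 q) i) ((f ^^ i) u)) = f (ev q)"
      unfolding ev_def sum.atMost_Suc_shift
      by (simp, subst operator_sum_arg[OF f])
        (auto simp: uV span_scale operatorD(3)[OF f])
    also have "(\<Sum>i\<le>Suc (degree q). scale c (scale (coeff q i) ((f ^^ i) u))) = scale c (ev q)"
      by (subst scale_sum_right[symmetric], subst ev_ge[symmetric]) auto
    finally show ?thesis .
  qed
  moreover have "ev q \<noteq> 0" using min[of q] q0 dq by simp
  ultimately show ?thesis using that[of "ev q" c] p evV by auto
qed

section \<open>Positivity for sums of roots of unity\<close>

text \<open>
  The base field is abstract, so there is no complex conjugation on it. The following lemmas transfer an
  inequality from the complex numbers: a complex root of unity has a counterpart in the field which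
  satisfies exactly the same polynomial equations over the rational numbers.
\<close>

definition rat_eval :: "'a::field_char_0 \<Rightarrow> rat poly \<Rightarrow> 'a" where
  "rat_eval z p = poly (map_poly of_rat p) z"

lemma rat_eval_pCons [simp]: "rat_eval z (pCons a p) = of_rat a + z * rat_eval z p"
  by (simp add: rat_eval_def map_poly_pCons)

lemma rat_eval_0 [simp]: "rat_eval z 0 = 0"
  by (simp add: rat_eval_def)

lemma rat_eval_1 [simp]: "rat_eval z 1 = 1"
  by (simp add: one_pCons)

lemma rat_eval_add [simp]: "rat_eval z (p + q) = rat_eval z p + rat_eval z q"
  by (induction p q rule: poly_induct2) (simp_all add: of_rat_add algebra_simps)

lemma rat_eval_smult [simp]: "rat_eval z (smult a p) = of_rat a * rat_eval z p"
  by (induction p) (simp_all add: of_rat_mult algebra_simps)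

lemma rat_eval_mult [simp]: "rat_eval z (p * q) = rat_eval z p * rat_eval z q"
  by (induction p) (simp_all add: algebra_simps)

lemma rat_eval_sum [simp]: "rat_eval z (\<Sum>i\<in>A. f i) = (\<Sum>i\<in>A. rat_eval z (f i))"
  by (induction A rule: infinite_finite_induct) simp_all

lemma rat_eval_monom [simp]: "rat_eval z (monom a n) = of_rat a * z ^ n"
  by (simp add: rat_eval_def map_poly_monom poly_monom)

lemma minimal_rat_poly:
  assumes "q \<noteq> 0" "rat_eval z q = 0"
  obtains m where "m \<noteq> 0" "degree m > 0" "rat_eval z m = 0"
    "\<And>p. rat_eval z p = 0 \<Longrightarrow> m dvd p"
proof -
  obtain m where m: "m \<noteq> 0" "rat_eval z m = 0"
    and min: "\<And>p. p \<noteq> 0 \<Longrightarrow> rat_eval z p = 0 \<Longrightarrow> degree m \<le> degree p"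
    using ex_has_least_nat[of "\<lambda>p. p \<noteq> 0 \<and> rat_eval z p = 0" q degree] assms by blast
  have "degree m > 0"
  proof (rule ccontr)
    assume "\<not> ?thesis"
    then obtain a where "m = [:a:]" by (metis degree_eq_zeroE gr0I)
    then show False using m by simp
  qed
  moreover have "m dvd p" if "rat_eval z p = 0" for p
  proof -
    have "rat_eval z p = rat_eval z (p div m * m + p mod m)" by simp
    then have "rat_eval z (p mod m) = 0" using that m(2) by (simp only: rat_eval_add rat_eval_mult) simp
    then have "p mod m = 0" using min[of "p mod m"] degree_mod_less'[OF m(1), of p] by fastforce
    then show ?thesis by auto
  qed
  ultimately show ?thesis using that m by blast
qed

text \<open>
  Take for \<open>z\<close> a root of the minimal polynomial \<open>m\<close> of \<open>w\<close>. The minimal polynomial \<open>m'\<close> of \<open>z\<close> divides \<open>m\<close>;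
  as \<open>m\<close> is minimal for \<open>w\<close>, the factor that vanishes at \<open>w\<close> is \<open>m'\<close>, so the two numbers annihilate the
  same polynomials.
\<close>

lemma conjugate_root:
  fixes w :: "'a::field_char_0"
  assumes "q \<noteq> 0" "rat_eval w q = 0"
  obtains z :: "'k::{alg_closed_field, field_char_0}"
    where "\<And>p. rat_eval z p = 0 \<longleftrightarrow> rat_eval w p = 0"
proof -
  obtain m where m: "m \<noteq> 0" "degree m > 0" "rat_eval w m = 0" "\<And>p. rat_eval w p = 0 \<Longrightarrow> m dvd p"
    using minimal_rat_poly[OF assms] by metis
  have "degree (map_poly of_rat m :: 'k poly) > 0"
    using m(2) by (simp add: degree_map_poly)
  then obtain z :: 'k where z: "rat_eval z m = 0"
    unfolding rat_eval_def using alg_closed_imp_poly_has_root by blast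
  obtain m' where m': "m' \<noteq> 0" "degree m' > 0" "rat_eval z m' = 0" "\<And>p. rat_eval z p = 0 \<Longrightarrow> m' dvd p"
    using minimal_rat_poly[OF m(1) z] by metis
  obtain g where g: "m = m' * g" using m'(4)[OF z] by (elim dvdE)
  have "\<not> m dvd g"
  proof
    assume "m dvd g"
    moreover have "g \<noteq> 0" using g m by auto
    ultimately have "degree m \<le> degree g" by (rule dvd_imp_degree_le)
    moreover have "degree m = degree m' + degree g" using g m by (auto intro: degree_mult_eq)
    ultimately show False using m'(2) by simp
  qed
  then have "rat_eval w g \<noteq> 0" using m(4) by blast
  then have "rat_eval w m' = 0" using m(3) unfolding g by simp
  have "rat_eval z p = 0 \<longleftrightarrow> rat_eval w p = 0" for p
  proof
    assume "rat_eval z p = 0"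
    then have "m' dvd p" by (rule m'(4))
    then obtain c where "p = m' * c" by (elim dvdE)
    then show "rat_eval w p = 0" using \<open>rat_eval w m' = 0\<close> by simp
  next
    assume "rat_eval w p = 0"
    then have "m dvd p" by (rule m(4))
    then obtain c where "p = m * c" by (elim dvdE)
    then show "rat_eval z p = 0" using z by simp
  qed
  then show ?thesis using that by blast
qed

lemma cis_power_eq_1:
  assumes "0 < l" "l < M" shows "cis (2 * pi / real M) ^ l \<noteq> 1"
proof
  assume "cis (2 * pi / real M) ^ l = 1"
  then have "Re (cis (real l * (2 * pi / real M))) = 1" by (simp add: DeMoivre)
  then obtain n :: int where "real l * (2 * pi / real M) = of_int n * 2 * pi"
    by (auto simp: cos_one_2pi_int)
  then have "real l / real M = of_int n" using assms by (simp add: field_simps)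
  then have "real_of_int (int l) = real_of_int (n * int M)" using assms by (simp add: field_simps)
  then have eq: "int l = n * int M" by (simp only: of_int_eq_iff)
  then have "n > 0" using assms by (metis of_nat_0_less_iff zero_less_mult_pos2 order.strict_trans)
  then have "int M \<le> n * int M" using mult_right_mono[of 1 n "int M"] by simp
  then show False using eq assms by linarith
qed

text \<open>
  If \<open>z\<close> were complex, the second factor would be the conjugate of the first, and the expression would be
  \<open>1\<close> plus a sum of squared absolute values. It is a rational polynomial in \<open>z\<close>, so by conjugacy it cannot
  vanish in the abstract field either.
\<close>

lemma root_of_unity_positivity:
  assumes M: "M > 0"
  obtains z :: "'k::{alg_closed_field, field_char_0}"
  where "z ^ M = 1" "\<And>l. 0 < l \<Longrightarrow> l < M \<Longrightarrow> z ^ l \<noteq> 1"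
    "\<And>A (m :: 'b \<Rightarrow> nat \<Rightarrow> nat). 1 + (\<Sum>a\<in>A. (\<Sum>l<M. of_nat (m a l) * z ^ l) *
       (\<Sum>l<M. of_nat (m a l) * z ^ (l * (M - 1)))) \<noteq> 0"
proof -
  define w where "w = cis (2 * pi / real M)"
  have wM: "w ^ M = 1" using M by (simp add: w_def DeMoivre)
  have cnj: "w ^ (M - 1) = cnj w"
  proof -
    have "w ^ (M - 1) * w = 1" using wM M by (simp flip: power_Suc2)
    moreover have "cnj w * w = 1" by (simp add: w_def cis_cnj cis_mult)
    ultimately show ?thesis by (metis mult_right_cancel mult_zero_right zero_neq_one)
  qed
  have unit: "rat_eval x (monom 1 l - 1) = x ^ l - 1" for x :: "'c::field_char_0" and l
  proof -
    have "rat_eval x (monom 1 l - 1) + rat_eval x 1 = x ^ l"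
      by (simp flip: rat_eval_add del: rat_eval_1)
    then show ?thesis by (simp add: algebra_simps)
  qed
  have "monom 1 M - 1 \<noteq> (0 :: rat poly)"
  proof
    assume "monom 1 M - 1 = (0 :: rat poly)"
    then have "coeff (monom 1 M - 1) M = (0 :: rat)" by simp
    then show False using M by simp
  qed
  moreover have "rat_eval w (monom 1 M - 1) = 0" using wM by (simp add: unit)
  ultimately obtain z :: 'k where z: "\<And>p. rat_eval z p = 0 \<longleftrightarrow> rat_eval w p = 0"
    using conjugate_root by metis
  have "z ^ M = 1" using z[of "monom 1 M - 1"] wM by (simp add: unit)
  moreover have "z ^ l \<noteq> 1" if "0 < l" "l < M" for l
    using z[of "monom 1 l - 1"] cis_power_eq_1[OF that] by (simp add: unit w_def)
  moreover have "1 + (\<Sum>a\<in>A. (\<Sum>l<M. of_nat (m a l) * z ^ l) *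
       (\<Sum>l<M. of_nat (m a l) * z ^ (l * (M - 1)))) \<noteq> 0" for A and m :: "'b \<Rightarrow> nat \<Rightarrow> nat"
  proof -
    define p :: "rat poly" where "p = 1 + (\<Sum>a\<in>A. (\<Sum>l<M. monom (of_nat (m a l)) l) *
       (\<Sum>l<M. monom (of_nat (m a l)) (l * (M - 1))))"
    define f where "f a = (\<Sum>l<M. of_nat (m a l) * w ^ l)" for a
    have wl: "w ^ (l * (M - 1)) = cnj w ^ l" for l
      by (metis cnj mult.commute power_mult)
    have "rat_eval w p = 1 + (\<Sum>a\<in>A. f a * (\<Sum>l<M. of_nat (m a l) * w ^ (l * (M - 1))))"
      by (simp add: p_def f_def)
    also have "\<dots> = 1 + (\<Sum>a\<in>A. f a * cnj (f a))"
      by (simp only: f_def wl complex_cnj_mult cnj_sum complex_cnj_power complex_cnj_of_nat)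
    also have "\<dots> = of_real (1 + (\<Sum>a\<in>A. (cmod (f a))\<^sup>2))"
      by (simp add: complex_norm_square del: of_real_power)
    finally have "rat_eval w p = of_real (1 + (\<Sum>a\<in>A. (cmod (f a))\<^sup>2))" .
    moreover have "1 + (\<Sum>a\<in>A. (cmod (f a))\<^sup>2) > 0"
      by (intro add_pos_nonneg sum_nonneg) simp_all
    ultimately have "rat_eval w p \<noteq> 0" by (metis less_irrefl of_real_eq_0_iff)
    then have "rat_eval z p \<noteq> 0" using z by blast
    then show ?thesis by (simp add: p_def)
  qed
  ultimately show ?thesis using that by blast
qed

section \<open>Multilinear maps and Sweedler sums\<close>

definition bilinear ::
    "('k::field \<Rightarrow> 'a::ab_group_add \<Rightarrow> 'a) \<Rightarrow> ('k \<Rightarrow> 'w::ab_group_add \<Rightarrow> 'w) \<Rightarrow> ('a \<Rightarrow> 'a \<Rightarrow> 'w) \<Rightarrow> bool" where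
  "bilinear s t F \<longleftrightarrow> (\<forall>b. Vector_Spaces.linear s t (\<lambda>a. F a b)) \<and>
     (\<forall>a. Vector_Spaces.linear s t (\<lambda>b. F a b))"

definition trilinear ::
    "('k::field \<Rightarrow> 'a::ab_group_add \<Rightarrow> 'a) \<Rightarrow> ('k \<Rightarrow> 'w::ab_group_add \<Rightarrow> 'w) \<Rightarrow>
     ('a \<Rightarrow> 'a \<Rightarrow> 'a \<Rightarrow> 'w) \<Rightarrow> bool" where
  "trilinear s t F \<longleftrightarrow> (\<forall>b d. Vector_Spaces.linear s t (\<lambda>a. F a b d)) \<and>
     (\<forall>a d. Vector_Spaces.linear s t (\<lambda>b. F a b d)) \<and>
     (\<forall>a b. Vector_Spaces.linear s t (\<lambda>d. F a b d))"

text \<open>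
  Equations in a tensor product are used by evaluating multilinear maps on them. A map on pure tensors
  extends linearly to formal sums; multilinearity says exactly that the extension kills the relations.
\<close>

definition linear_extension ::
    "('k::field \<Rightarrow> 'w::ab_group_add \<Rightarrow> 'w) \<Rightarrow> ('x \<Rightarrow> 'w) \<Rightarrow> ('x \<Rightarrow>\<^sub>0 'k) \<Rightarrow> 'w" where
  "linear_extension t F p = (\<Sum>x\<in>Poly_Mapping.keys p. t (Poly_Mapping.lookup p x) (F x))"

lemma linear_linear_extension:
  assumes "vector_space t"
  shows "Vector_Spaces.linear free_scale t (linear_extension t F)"
proof -
  interpret t: vector_space t by fact
  have ge: "linear_extension t F p = (\<Sum>x\<in>A. t (Poly_Mapping.lookup p x) (F x))"
    if "finite A" "Poly_Mapping.keys p \<subseteq> A" for p A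
    unfolding linear_extension_def
    by (rule sum.mono_neutral_left) (use that in \<open>auto simp: in_keys_iff\<close>)
  have "linear_extension t F (p + q) = linear_extension t F p + linear_extension t F q" for p q
    using Poly_Mapping.keys_add[of p q]
    by (subst (1 2 3) ge[of "Poly_Mapping.keys p \<union> Poly_Mapping.keys q"])
      (auto simp: lookup_add t.scale_left_distrib sum.distrib)
  moreover have "linear_extension t F (free_scale c p) = t c (linear_extension t F p)" for c p
    by (subst (1 2) ge[of "Poly_Mapping.keys p"])
      (auto simp: lookup_free_scale in_keys_iff t.scale_sum_right)
  ultimately show ?thesis
    using assms vector_space_free_scale by (simp add: Vector_Spaces.linear_iff)
qed

lemma linear_extension_basis_vec:
  "vector_space t \<Longrightarrow> linear_extension t F (basis_vec x) = F x"
  by (simp add: linear_extension_def basis_vec_def vector_space.vector_space_assms(4))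

lemma linear_extension_formal_sum:
  assumes "vector_space t"
  shows "linear_extension t F (formal_sum xs) = (\<Sum>x\<leftarrow>xs. F x)"
proof -
  interpret Vector_Spaces.linear free_scale t "linear_extension t F" by (rule linear_linear_extension[OF assms])
  show ?thesis
    by (induction xs) (simp_all add: formal_sum_def zero add linear_extension_basis_vec assms)
qed

lemma sum_list_eq_of_congruent:
  fixes t :: "'k::field \<Rightarrow> 'w::ab_group_add \<Rightarrow> 'w"
  assumes t: "vector_space t" and span: "formal_sum xs - formal_sum ys \<in> module.span free_scale R"
    and R: "\<And>r. r \<in> R \<Longrightarrow> linear_extension t F r = 0"
  shows "(\<Sum>x\<leftarrow>xs. F x) = (\<Sum>x\<leftarrow>ys. F x)"
proof -
  interpret Vector_Spaces.linear free_scale t "linear_extension t F" by (rule linear_linear_extension[OF t])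
  have "linear_extension t F (formal_sum xs - formal_sum ys) = 0"
    using eq_0_on_span[OF R span] by simp
  then show ?thesis by (simp add: diff linear_extension_formal_sum[OF t])
qed

lemma tensor2_eq_imp_sum_eq:
  assumes "bilinear s t F" "tensor2_eq s xs ys"
  shows "(\<Sum>(a, b)\<leftarrow>xs. F a b) = (\<Sum>(a, b)\<leftarrow>ys. F a b)"
proof (rule sum_list_eq_of_congruent)
  show t: "vector_space t" using assms(1) by (simp add: bilinear_def Vector_Spaces.linear_def)
  show "formal_sum xs - formal_sum ys \<in> module.span free_scale (tensor2_relations s)"
    using assms(2) by (simp add: tensor2_eq_def)
  interpret l: Vector_Spaces.linear free_scale t "linear_extension t (\<lambda>(a, b). F a b)"
    by (rule linear_linear_extension[OF t])
  show "linear_extension t (\<lambda>(a, b). F a b) r = 0" if "r \<in> tensor2_relations s" for r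
    using that assms(1) unfolding tensor2_relations_def
    by (auto simp: l.diff l.scale linear_extension_basis_vec[OF t] bilinear_def Vector_Spaces.linear_iff)
qed

lemma tensor3_eq_imp_sum_eq:
  assumes "trilinear s t F" "tensor3_eq s xs ys"
  shows "(\<Sum>(a, b, d)\<leftarrow>xs. F a b d) = (\<Sum>(a, b, d)\<leftarrow>ys. F a b d)"
proof (rule sum_list_eq_of_congruent)
  show t: "vector_space t" using assms(1) by (simp add: trilinear_def Vector_Spaces.linear_def)
  show "formal_sum xs - formal_sum ys \<in> module.span free_scale (tensor3_relations s)"
    using assms(2) by (simp add: tensor3_eq_def)
  interpret l: Vector_Spaces.linear free_scale t "linear_extension t (\<lambda>(a, b, d). F a b d)"
    by (rule linear_linear_extension[OF t])
  show "linear_extension t (\<lambda>(a, b, d). F a b d) r = 0" if "r \<in> tensor3_relations s" for r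
    using that assms(1) unfolding tensor3_relations_def
    by (auto simp: l.diff l.scale linear_extension_basis_vec[OF t] trilinear_def Vector_Spaces.linear_iff)
qed

text \<open>
  Most side conditions below assert that an expression is linear in one of its variables; these rules
  decompose such goals along the syntax of the expression.
\<close>

named_theorems linear_intros

lemma linear_add: "Vector_Spaces.linear s t f \<Longrightarrow> f (x + y) = f x + f y"
  and linear_scale_apply: "Vector_Spaces.linear s t f \<Longrightarrow> f (s c x) = t c (f x)"
  and linear_vs2: "Vector_Spaces.linear s t f \<Longrightarrow> vector_space t"
  by (simp_all add: Vector_Spaces.linear_iff)

lemma linear_comp:
  "Vector_Spaces.linear s t f \<Longrightarrow> Vector_Spaces.linear r s g \<Longrightarrow> Vector_Spaces.linear r t (\<lambda>a. f (g a))"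
  by (simp add: Vector_Spaces.linear_iff)

lemma linear_sum_list:
  assumes "vector_space s" "vector_space t" "\<And>x. Vector_Spaces.linear s t (\<lambda>a. G a x)"
  shows "Vector_Spaces.linear s t (\<lambda>a. \<Sum>x\<leftarrow>xs. G a x)"
proof -
  interpret t: vector_space t by fact
  show ?thesis
    by (induction xs) (use assms in \<open>auto simp: Vector_Spaces.linear_iff algebra_simps t.scale_right_distrib\<close>)
qed

lemma linear_sum_set:
  assumes "vector_space s" "vector_space t" "\<And>x. x \<in> X \<Longrightarrow> Vector_Spaces.linear s t (\<lambda>a. G a x)"
  shows "Vector_Spaces.linear s t (\<lambda>a. \<Sum>x\<in>X. G a x)"
proof -
  interpret t: vector_space t by fact
  show ?thesis using assms(3)
    by (induction X rule: infinite_finite_induct)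
      (use assms(1,2) in \<open>auto simp: Vector_Spaces.linear_iff algebra_simps t.scale_right_distrib\<close>)
qed

lemma vector_space_field: "vector_space ((*) :: 'k::field \<Rightarrow> 'k \<Rightarrow> 'k)"
  by unfold_locales (simp_all add: algebra_simps)

lemma linear_times_left [linear_intros]:
  "Vector_Spaces.linear s (*) f \<Longrightarrow> Vector_Spaces.linear s (*) (\<lambda>a. c * f a)"
  and linear_times_right [linear_intros]:
  "Vector_Spaces.linear s (*) f \<Longrightarrow> Vector_Spaces.linear s (*) (\<lambda>a. f a * c)" for c :: "'k::field"
  by (simp_all add: Vector_Spaces.linear_iff algebra_simps)

lemma linear_scale_scalar [linear_intros]:
  assumes "vector_space t" "Vector_Spaces.linear s (*) p"
  shows "Vector_Spaces.linear s t (\<lambda>a. t (p a) x)"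
proof -
  interpret t: vector_space t by fact
  show ?thesis using assms(2) by (simp add: Vector_Spaces.linear_iff t.scale_left_distrib assms(1))
qed

lemma linear_scale_vector [linear_intros]:
  assumes "Vector_Spaces.linear s t f"
  shows "Vector_Spaces.linear s t (\<lambda>a. t c (f a))"
proof -
  interpret t: vector_space t using assms by (rule linear_vs2)
  show ?thesis using assms
    by (simp add: Vector_Spaces.linear_iff t.scale_right_distrib mult.commute)
qed

lemma sum_list_apply:
  assumes "Vector_Spaces.linear s t f"
  shows "f (\<Sum>x\<leftarrow>xs. G x) = (\<Sum>x\<leftarrow>xs. f (G x))"
proof -
  interpret Vector_Spaces.linear s t f by fact
  show ?thesis by (induction xs) (simp_all add: zero add)
qed

lemma linear_sum_apply:
  assumes "Vector_Spaces.linear s t f"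
  shows "f (\<Sum>i\<in>I. g i) = (\<Sum>i\<in>I. f (g i))"
proof -
  interpret Vector_Spaces.linear s t f by fact
  show ?thesis by (rule sum)
qed

lemma sum_list_sum_list_swap:
  "(\<Sum>x\<leftarrow>xs. \<Sum>y\<leftarrow>ys. (f x y :: 'w::comm_monoid_add)) = (\<Sum>y\<leftarrow>ys. \<Sum>x\<leftarrow>xs. f x y)"
  by (induction xs) (simp_all add: sum_list_addf)

lemma bilinearI:
  "(\<And>b. Vector_Spaces.linear s t (\<lambda>a. F a b)) \<Longrightarrow> (\<And>a. Vector_Spaces.linear s t (\<lambda>b. F a b)) \<Longrightarrow>
    bilinear s t F"
  by (simp add: bilinear_def)

lemma trilinearI:
  "(\<And>b d. Vector_Spaces.linear s t (\<lambda>a. F a b d)) \<Longrightarrow> (\<And>a d. Vector_Spaces.linear s t (\<lambda>b. F a b d)) \<Longrightarrow>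
    (\<And>a b. Vector_Spaces.linear s t (\<lambda>d. F a b d)) \<Longrightarrow> trilinear s t F"
  by (simp add: trilinear_def)

context assoc_algebra
begin

lemma vs: "vector_space scale" by unfold_locales

lemma linear_var [linear_intros]: "Vector_Spaces.linear scale scale (\<lambda>a. a)"
  by (simp add: Vector_Spaces.linear_iff vs)

lemma linear_mult_left [linear_intros]:
  "Vector_Spaces.linear s scale f \<Longrightarrow> Vector_Spaces.linear s scale (\<lambda>a. x * f a)"
  and linear_mult_right [linear_intros]:
  "Vector_Spaces.linear s scale f \<Longrightarrow> Vector_Spaces.linear s scale (\<lambda>a. f a * x)"
  by (simp_all add: Vector_Spaces.linear_iff algebra_simps scale_mult_left scale_mult_right)

end

context hopf_algebra
begin

abbreviation lin where "lin \<equiv> Vector_Spaces.linear"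

text \<open>
  \<open>sw F x\<close> is the Sweedler sum of \<open>F x\<^sub>1 x\<^sub>2\<close>. It depends on the chosen representative of the
  comultiplication in general, but not when \<open>F\<close> is bilinear, and only then do the axioms apply.
\<close>

definition sw :: "('h \<Rightarrow> 'h \<Rightarrow> 'w::comm_monoid_add) \<Rightarrow> 'h \<Rightarrow> 'w" where
  "sw F x = (\<Sum>(a, b)\<leftarrow>comult x. F a b)"

lemma sw_add: "bilinear scale t F \<Longrightarrow> sw F (x + y) = sw F x + sw F y"
  unfolding sw_def using tensor2_eq_imp_sum_eq[OF _ comult_add] by force

lemma sw_scale:
  assumes F: "bilinear scale t F"
  shows "sw F (scale c x) = t c (sw F x)"
proof -
  have t: "lin t t (t c)" using F unfolding bilinear_def
    using linear_scale_vector[of t t "\<lambda>x. x"] by (auto simp: Vector_Spaces.linear_iff)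
  have "sw F (scale c x) = (\<Sum>(a, b)\<leftarrow>comult x. F (scale c a) b)"
    unfolding sw_def by (subst tensor2_eq_imp_sum_eq[OF F comult_scale])
      (simp add: case_prod_unfold comp_def)
  also have "\<dots> = t c (sw F x)"
    using F by (simp add: sw_def sum_list_apply[OF t] bilinear_def Vector_Spaces.linear_iff case_prod_unfold)
  finally show ?thesis .
qed

lemma linear_sw_arg [linear_intros]:
  assumes F: "bilinear scale t F" and f: "lin s scale f"
  shows "lin s t (\<lambda>x. sw F (f x))"
  using assms sw_add[OF F] sw_scale[OF F]
  by (simp add: Vector_Spaces.linear_iff bilinear_def)

lemma linear_sw_fun [linear_intros]:
  assumes "\<And>b c. lin s t (\<lambda>a. F a b c)"
  shows "lin s t (\<lambda>a. sw (F a) x)"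
  unfolding sw_def case_prod_unfold
  by (rule linear_sum_list) (use assms in \<open>auto simp: Vector_Spaces.linear_iff\<close>)

lemma sum_list_concat_map:
  "(\<Sum>x\<leftarrow>concat (map f xs). g x) = (\<Sum>y\<leftarrow>xs. \<Sum>x\<leftarrow>f y. (g x :: 'w::comm_monoid_add))"
  by (induction xs) simp_all

lemma sw_mult:
  assumes F: "bilinear scale t F"
  shows "sw F (x * y) = sw (\<lambda>a b. sw (\<lambda>c d. F (a * c) (b * d)) y) x"
  unfolding sw_def tensor2_eq_imp_sum_eq[OF F comult_mult]
  by (simp add: case_prod_unfold sum_list_concat_map comp_def)

lemma sw_one: "bilinear scale t F \<Longrightarrow> sw F 1 = F 1 1"
  unfolding sw_def using tensor2_eq_imp_sum_eq[OF _ comult_one] by force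

lemma sw_coassoc:
  assumes F: "trilinear scale t F"
  shows "sw (\<lambda>a b. sw (\<lambda>a1 a2. F a1 a2 b) a) x = sw (\<lambda>a b. sw (\<lambda>b1 b2. F a b1 b2) b) x"
  using tensor3_eq_imp_sum_eq[OF F coassoc[of x]] unfolding sw_def
  by (simp add: case_prod_unfold sum_list_concat_map comp_def)

lemma sw_swap: "sw (\<lambda>a b. sw (\<lambda>c d. F a b c d) y) x = sw (\<lambda>c d. sw (\<lambda>a b. F a b c d) x) y"
  unfolding sw_def case_prod_unfold by (rule sum_list_sum_list_swap)

lemma sw_apply: "lin s t f \<Longrightarrow> f (sw F x) = sw (\<lambda>a b. f (F a b)) x"
  unfolding sw_def case_prod_unfold by (rule sum_list_apply)

lemma sw_cong: "(\<And>a b. F a b = G a b) \<Longrightarrow> sw F x = sw G x"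
  by (simp add: sw_def)

lemma sw_sum: "sw (\<lambda>a b. \<Sum>i\<in>I. F i a b) x = (\<Sum>i\<in>I. sw (F i) x)"
proof -
  have "(\<Sum>y\<leftarrow>ys. \<Sum>i\<in>I. G i y) = (\<Sum>i\<in>I. \<Sum>y\<leftarrow>ys. G i y)" for ys and G :: "_ \<Rightarrow> _ \<Rightarrow> _::comm_monoid_add"
    by (induction ys) (simp_all add: sum.distrib)
  then show ?thesis by (simp add: sw_def case_prod_unfold)
qed

lemma mult_sw_left: "c * sw F x = sw (\<lambda>a b. c * F a b) x" for c :: "'r::semiring_0"
  by (simp add: sw_def sum_list_const_mult case_prod_unfold)

lemma mult_sw_right: "sw F x * c = sw (\<lambda>a b. F a b * c) x" for c :: "'r::semiring_0"
  by (simp add: sw_def sum_list_mult_const case_prod_unfold)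

lemma scale_sw: "scale c (sw F x) = sw (\<lambda>a b. scale c (F a b)) x"
  by (rule sw_apply[where s=scale and t=scale]) (intro linear_intros)

lemma sw_scalar: "scale (sw F x) y = sw (\<lambda>a b. scale (F a b) y) x"
proof -
  have "lin (*) scale (\<lambda>c. scale c y)" by (simp add: Vector_Spaces.linear_iff vs vector_space_field algebra_simps)
  from sw_apply[OF this, of F x] show ?thesis .
qed

lemma lin_counit: "lin scale (*) counit" by (rule linear_counit)
lemma lin_antipode: "lin scale scale antipode" by (rule linear_antipode)

lemma linear_counit_comp [linear_intros]: "lin s scale f \<Longrightarrow> lin s (*) (\<lambda>a. counit (f a))"
  by (rule linear_comp[OF lin_counit])

lemma linear_antipode_comp [linear_intros]: "lin s scale f \<Longrightarrow> lin s scale (\<lambda>a. antipode (f a))"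
  by (rule linear_comp[OF lin_antipode])

lemma vector_space_scale [linear_intros]: "vector_space scale" by (rule vs)

lemmas [linear_intros] = vector_space_field bilinearI trilinearI

lemma sw_counit_left:
  assumes f: "lin scale t f" shows "sw (\<lambda>a b. t (counit a) (f b)) x = f x"
proof -
  have "f (sw (\<lambda>a b. scale (counit a) b) x) = sw (\<lambda>a b. t (counit a) (f b)) x"
    by (simp add: sw_apply[OF f] linear_scale_apply[OF f])
  then show ?thesis using counit_left[of x] by (simp add: sw_def)
qed

lemma sw_counit_right:
  assumes f: "lin scale t f" shows "sw (\<lambda>a b. t (counit b) (f a)) x = f x"
proof -
  have "f (sw (\<lambda>a b. scale (counit b) a) x) = sw (\<lambda>a b. t (counit b) (f a)) x"
    by (simp add: sw_apply[OF f] linear_scale_apply[OF f])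
  then show ?thesis using counit_right[of x] by (simp add: sw_def)
qed

lemma sw_antipode_left: "sw (\<lambda>a b. antipode a * b) x = scale (counit x) 1"
  using antipode_left[of x] by (simp add: sw_def)

lemma sw_antipode_right: "sw (\<lambda>a b. a * antipode b) x = scale (counit x) 1"
  using antipode_right[of x] by (simp add: sw_def)

lemma antipode_one: "antipode 1 = 1"
proof -
  have "sw (\<lambda>a b. antipode a * b) 1 = antipode 1 * 1"
    by (rule sw_one[where t=scale]) (intro linear_intros)
  then show ?thesis by (simp add: sw_antipode_left counit_one)
qed

lemma antipode_scale: "antipode (scale c x) = scale c (antipode x)"
  by (rule linear_scale_apply[OF lin_antipode])

lemma counit_scale: "counit (scale c x) = c * counit x"
  by (rule linear_scale_apply[OF lin_counit])

text \<open>
  Both sides are the convolution inverse of the multiplication map. Concretely, the sum of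
  \<open>S(x\<^sub>1 y\<^sub>1) x\<^sub>2 y\<^sub>2 S(y\<^sub>3) S(x\<^sub>3)\<close> is evaluated by contracting the last factors or the first ones.
\<close>

lemma antipode_mult: "antipode (x * y) = antipode y * antipode x"
proof -
  let ?S = antipode
  let ?e = counit
  have "antipode (x * y) = sw (\<lambda>a b. scale (?e b) (?S (a * y))) x"
    by (rule sw_counit_right[symmetric]) (intro linear_intros)
  also have "\<dots> = sw (\<lambda>a b. ?S (a * y) * sw (\<lambda>b1 b2. b1 * ?S b2) b) x"
    by (simp add: sw_antipode_right scale_mult_right)
  also have "\<dots> = sw (\<lambda>a b. sw (\<lambda>b1 b2. ?S (a * y) * b1 * ?S b2) b) x"
    by (simp add: mult_sw_left mult.assoc)
  also have "\<dots> = sw (\<lambda>a b. sw (\<lambda>b1 b2. sw (\<lambda>c d. scale (?e d) (?S (a * c) * b1 * ?S b2)) y) b) x"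
    by (intro sw_cong sw_counit_right[symmetric]) (intro linear_intros)
  also have "\<dots> = sw (\<lambda>a b. sw (\<lambda>b1 b2. sw (\<lambda>c d. sw (\<lambda>d1 d2. ?S (a * c) * b1 * (d1 * ?S d2) * ?S b2) d) y) b) x"
    by (simp add: mult_sw_left[symmetric] mult_sw_right[symmetric] sw_antipode_right scale_mult_right scale_mult_left)
  also have "\<dots> = sw (\<lambda>a b. sw (\<lambda>b1 b2. sw (\<lambda>c d. sw (\<lambda>c1 c2. ?S (a * c1) * b1 * (c2 * ?S d) * ?S b2) c) y) b) x"
    by (intro sw_cong sw_coassoc[symmetric, where t=scale]) (intro linear_intros)
  also have "\<dots> = sw (\<lambda>a b. sw (\<lambda>a1 a2. sw (\<lambda>c d. sw (\<lambda>c1 c2. ?S (a1 * c1) * a2 * (c2 * ?S d) * ?S b) c) y) a) x"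
    by (intro sw_coassoc[symmetric, where t=scale]) (intro linear_intros)
  also have "\<dots> = sw (\<lambda>a b. sw (\<lambda>c d. sw (\<lambda>a1 a2. sw (\<lambda>c1 c2. ?S (a1 * c1) * (a2 * c2)) c) a * ?S d * ?S b) y) x"
    by (subst sw_swap) (simp add: mult_sw_right mult.assoc)
  also have "\<dots> = sw (\<lambda>a b. sw (\<lambda>c d. sw (\<lambda>u v. ?S u * v) (a * c) * ?S d * ?S b) y) x"
    by (subst sw_mult[where F="\<lambda>u v. ?S u * v" and t=scale, symmetric]) (intro linear_intros, rule refl)
  also have "\<dots> = sw (\<lambda>a b. sw (\<lambda>c d. scale (?e a) (scale (?e c) (?S d * ?S b))) y) x"
    by (simp add: sw_antipode_left counit_mult scale_mult_left)
  also have "\<dots> = sw (\<lambda>a b. scale (?e a) (?S y * ?S b)) x"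
    by (subst scale_sw[symmetric], subst sw_counit_left) (intro linear_intros, rule refl)
  also have "\<dots> = ?S y * ?S x"
    by (rule sw_counit_left) (intro linear_intros)
  finally show ?thesis .
qed

end

section \<open>The integral, its Casimir element and the Frobenius form\<close>

locale hopf_integral = finite_dim_hopf_algebra scale comult counit antipode
  for scale :: "'k::field \<Rightarrow> 'h::ring_1 \<Rightarrow> 'h"
    and comult :: "'h \<Rightarrow> ('h \<times> 'h) list" and counit :: "'h \<Rightarrow> 'k" and antipode :: "'h \<Rightarrow> 'h" +
  fixes L :: 'h
  assumes integral: "idempotent_integral scale counit L"
begin

abbreviation S where "S \<equiv> antipode"

definition hbasis :: "'h set" where
  "hbasis = (SOME B. finite B \<and> independent B \<and> span B = UNIV)"

lemma hbasis: "finite hbasis" "independent hbasis" "span hbasis = UNIV"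
proof -
  obtain A where A: "finite A" "span A = UNIV" using finite_dim by blast
  obtain B where B: "B \<subseteq> UNIV" "independent B" "UNIV \<subseteq> span B" "card B = dim (UNIV :: 'h set)"
    using basis_exists by blast
  have "finite B" using independent_span_bound[OF A(1) B(2)] A(2) by simp
  with B have "\<exists>B. finite B \<and> independent B \<and> span B = UNIV" by blast
  then show "finite hbasis" "independent hbasis" "span hbasis = UNIV"
    unfolding hbasis_def by (metis (mono_tags, lifting) someI_ex)+
qed

sublocale H: finite_basis scale hbasis
  by unfold_locales (simp_all add: hbasis)

sublocale fd: finite_dimensional_vector_space scale hbasis
  by unfold_locales (simp_all add: hbasis)

lemma H_operator: "H.operator f \<longleftrightarrow> lin scale scale f"
  by (auto simp: H.operator_def hbasis(3) Vector_Spaces.linear_iff vs)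

lemma lin_coord: "lin scale (*) (\<lambda>v. H.coord v e)"
  by (rule linear_representation) (simp_all add: hbasis)

lemma linear_coord_comp [linear_intros]: "lin s scale f \<Longrightarrow> lin s (*) (\<lambda>a. H.coord (f a) e)"
  by (rule linear_comp[OF lin_coord])

lemma H_expand: "(\<Sum>e\<in>hbasis. scale (H.coord x e) e) = x"
  by (rule H.coord_expand) (simp add: hbasis)

lemma coord_eq_imp_eq: "(\<And>e. H.coord x e = H.coord y e) \<Longrightarrow> x = y"
  by (rule H.coord_eqI) (simp_all add: hbasis(3))

lemma coord_sum_hbasis:
  assumes "e \<in> hbasis" shows "H.coord (\<Sum>i\<in>hbasis. scale (g i) i) e = g e"
proof -
  have "H.coord (\<Sum>i\<in>hbasis. scale (g i) i) e = (\<Sum>i\<in>hbasis. g i * H.coord i e)"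
    by (simp add: linear_sum_apply[OF lin_coord] linear_scale_apply[OF lin_coord])
  also have "\<dots> = (\<Sum>i\<in>hbasis. if e = i then g i else 0)"
    by (intro sum.cong refl) (simp add: H.coord_basis)
  finally show ?thesis using assms hbasis(1) by simp
qed

lemma L_left: "h * L = scale (counit h) L" and L_right: "L * h = scale (counit h) L"
  and counit_L: "counit L = 1"
  using integral by (simp_all add: idempotent_integral_def)

text \<open>
  The element \<open>\<Lambda>\<^sub>1 \<otimes> S \<Lambda>\<^sub>2\<close> commutes with \<open>x\<close> across the tensor sign: expand \<open>x = \<epsilon>(x\<^sub>1) x\<^sub>2\<close>, absorb
  the counit by \<open>\<epsilon>(u) \<Lambda> = u \<Lambda>\<close>, and cancel \<open>S(x\<^sub>2) x\<^sub>3\<close>.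
\<close>

lemma casimir:
  assumes F: "bilinear scale t F"
  shows "sw (\<lambda>a b. F (x * a) (S b)) L = sw (\<lambda>a b. F a (S b * x)) L"
proof -
  have F1 [linear_intros]: "lin s t (\<lambda>a. F (f a) y)" and F2 [linear_intros]: "lin s t (\<lambda>a. F y (f a))"
    if "lin s scale f" for s :: "'k \<Rightarrow> 'x::ab_group_add \<Rightarrow> 'x" and f y
    using F that linear_comp unfolding bilinear_def by blast+
  have t [linear_intros]: "vector_space t" using F unfolding bilinear_def using linear_vs2 by blast
  interpret t: vector_space t by fact
  have sF: "F (scale c x) y = t c (F x y)" "F x (scale c y) = t c (F x y)" for c x y
    using F unfolding bilinear_def using linear_scale_apply by blast+
  have "sw (\<lambda>a b. F a (S b * x)) L = sw (\<lambda>u v. t (counit u) (sw (\<lambda>p q. F p (S q * v)) L)) x"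
    by (rule sw_counit_left[symmetric]) (intro linear_intros)
  also have "\<dots> = sw (\<lambda>u v. sw (\<lambda>p q. F p (S q * v)) (u * L)) x"
    by (intro sw_cong, unfold L_left, rule sw_scale[symmetric]) (intro linear_intros)
  also have "\<dots> = sw (\<lambda>u v. sw (\<lambda>u1 u2. sw (\<lambda>a b. F (u1 * a) (S (u2 * b) * v)) L) u) x"
    by (intro sw_cong sw_mult[where t=t]) (intro linear_intros)
  also have "\<dots> = sw (\<lambda>u v. sw (\<lambda>v1 v2. sw (\<lambda>a b. F (u * a) (S b * (S v1 * v2))) L) v) x"
    unfolding antipode_mult mult.assoc
    by (intro sw_coassoc[where t=t] linear_intros)
  also have "\<dots> = sw (\<lambda>u v. sw (\<lambda>a b. F (u * a) (S b * sw (\<lambda>v1 v2. S v1 * v2) v)) L) x"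
    by (subst sw_swap, subst sw_apply[where f="\<lambda>z. F _ (S _ * z)" and s=scale and t=t]) (intro linear_intros, rule refl)
  also have "\<dots> = sw (\<lambda>u v. t (counit v) (sw (\<lambda>a b. F (u * a) (S b)) L)) x"
  proof (rule sw_cong)
    fix u v
    have c: "lin t t (t (counit v))" using linear_scale_vector[of t t "\<lambda>x. x"] t
      by (simp add: Vector_Spaces.linear_iff)
    show "sw (\<lambda>a b. F (u * a) (S b * sw (\<lambda>v1 v2. S v1 * v2) v)) L = t (counit v) (sw (\<lambda>a b. F (u * a) (S b)) L)"
      by (simp add: sw_antipode_left scale_mult_right sF sw_apply[OF c])
  qed
  also have "\<dots> = sw (\<lambda>a b. F (x * a) (S b)) L"
    by (rule sw_counit_right) (intro linear_intros)
  finally show ?thesis by simp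
qed

text \<open>
  The analogue for multiplication on the inner side, from \<open>\<epsilon>(u) \<Lambda> = \<Lambda> u\<close>. Here the cancelling product is
  \<open>S(S(x\<^sub>3)) S(x\<^sub>2) = S(x\<^sub>2 S(x\<^sub>3))\<close>, which is where the square of the antipode appears.
\<close>

lemma casimir_twisted:
  assumes F: "bilinear scale t F"
  shows "sw (\<lambda>a b. F (a * x) (S b)) L = sw (\<lambda>a b. F a (S (S x) * S b)) L"
proof -
  have F1 [linear_intros]: "lin s t (\<lambda>a. F (f a) y)" and F2 [linear_intros]: "lin s t (\<lambda>a. F y (f a))"
    if "lin s scale f" for s :: "'k \<Rightarrow> 'x::ab_group_add \<Rightarrow> 'x" and f y
    using F that linear_comp unfolding bilinear_def by blast+
  have t [linear_intros]: "vector_space t" using F unfolding bilinear_def using linear_vs2 by blast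
  interpret t: vector_space t by fact
  have sF: "F (scale c x) y = t c (F x y)" "F x (scale c y) = t c (F x y)" for c x y
    using F unfolding bilinear_def using linear_scale_apply by blast+
  have "sw (\<lambda>a b. F a (S (S x) * S b)) L = sw (\<lambda>u v. t (counit u) (sw (\<lambda>p q. F p (S (S v) * S q)) L)) x"
    by (rule sw_counit_left[symmetric]) (intro linear_intros)
  also have "\<dots> = sw (\<lambda>u v. sw (\<lambda>p q. F p (S (S v) * S q)) (L * u)) x"
    by (intro sw_cong, unfold L_right, rule sw_scale[symmetric]) (intro linear_intros)
  also have "\<dots> = sw (\<lambda>u v. sw (\<lambda>a b. sw (\<lambda>u1 u2. F (a * u1) (S (S v) * S (b * u2))) u) L) x"
    by (intro sw_cong sw_mult[where t=t]) (intro linear_intros)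
  also have "\<dots> = sw (\<lambda>u v. sw (\<lambda>u1 u2. sw (\<lambda>a b. F (a * u1) (S (u2 * S v) * S b)) L) u) x"
    by (intro sw_cong, subst sw_swap) (simp add: antipode_mult mult.assoc)
  also have "\<dots> = sw (\<lambda>u v. sw (\<lambda>v1 v2. sw (\<lambda>a b. F (a * u) (S (v1 * S v2) * S b)) L) v) x"
    by (intro sw_coassoc[where t=t] linear_intros)
  also have "\<dots> = sw (\<lambda>u v. sw (\<lambda>a b. F (a * u) (S (sw (\<lambda>v1 v2. v1 * S v2) v) * S b)) L) x"
    by (subst sw_swap, subst sw_apply[where f="\<lambda>z. F _ (S z * _)" and s=scale and t=t]) (intro linear_intros, rule refl)
  also have "\<dots> = sw (\<lambda>u v. t (counit v) (sw (\<lambda>a b. F (a * u) (S b)) L)) x"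
  proof (rule sw_cong)
    fix u v
    have c: "lin t t (t (counit v))" using linear_scale_vector[of t t "\<lambda>x. x"] t
      by (simp add: Vector_Spaces.linear_iff)
    show "sw (\<lambda>a b. F (a * u) (S (sw (\<lambda>v1 v2. v1 * S v2) v) * S b)) L = t (counit v) (sw (\<lambda>a b. F (a * u) (S b)) L)"
      by (simp add: sw_antipode_right antipode_scale antipode_one scale_mult_left sF sw_apply[OF c])
  qed
  also have "\<dots> = sw (\<lambda>a b. F (a * x) (S b)) L"
    by (rule sw_counit_right) (intro linear_intros)
  finally show ?thesis by simp
qed

text \<open>
  A functional on \<open>H\<close> which turns out to be an integral of the dual Hopf algebra, normalised so that its
  value at \<open>\<Lambda>\<close> is \<open>1\<close>. Being given by a trace, it makes \<open>frob 1\<close> the trace of the square of the antipode.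
\<close>

definition frob :: "'h \<Rightarrow> 'k" where
  "frob x = H.tr (\<lambda>h. S (S (h * x)))"

lemma linear_frob [linear_intros]: "lin s scale f \<Longrightarrow> lin s (*) (\<lambda>a. frob (f a))"
  unfolding frob_def H.tr_def
  by (intro linear_sum_set linear_intros vector_space_field) (auto simp: Vector_Spaces.linear_iff)

lemma lin_frob: "lin scale (*) frob"
  using linear_frob[OF linear_var] .

lemma frob_scale: "frob (scale c x) = c * frob x" by (rule linear_scale_apply[OF lin_frob])

text \<open>
  The legs of the Casimir element are dual bases for \<open>frob\<close>, so that \<open>frob\<close> is a Frobenius form. Start from
  \<open>1 = S(S \<Lambda>\<^sub>1 \<cdot> \<Lambda>\<^sub>2) = S \<Lambda>\<^sub>2 \<cdot> S\<^sup>2 \<Lambda>\<^sub>1\<close>, expand \<open>S\<^sup>2 \<Lambda>\<^sub>1\<close> in a basis and move the basis vectors and \<open>x\<close> to the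
  other leg; the resulting coefficient is the trace that defines \<open>frob\<close>.
\<close>

lemma frob_dual: "sw (\<lambda>a b. scale (frob (x * a)) (S b)) L = x"
proof -
  have "x = S (sw (\<lambda>a b. S a * b) L) * x"
    by (simp add: sw_antipode_left counit_L antipode_one)
  also have "\<dots> = sw (\<lambda>a b. S b * (S (S a) * x)) L"
    by (simp add: sw_apply[OF lin_antipode] mult_sw_right antipode_mult mult.assoc)
  also have "\<dots> = sw (\<lambda>a b. S b * ((\<Sum>e\<in>hbasis. scale (H.coord (S (S a)) e) e) * x)) L"
    by (simp add: H_expand)
  also have "\<dots> = (\<Sum>e\<in>hbasis. sw (\<lambda>a b. scale (H.coord (S (S a)) e) (S b * (e * x))) L)"
    by (simp add: sum_distrib_left sum_distrib_right scale_mult_right scale_mult_left sw_sum)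
  also have "\<dots> = (\<Sum>e\<in>hbasis. sw (\<lambda>a b. scale (H.coord (S (S (e * x * a))) e) (S b)) L)"
    by (intro sum.cong refl, rule casimir[where t=scale, symmetric]) (intro linear_intros)
  also have "\<dots> = sw (\<lambda>a b. scale (frob (x * a)) (S b)) L"
    by (simp add: frob_def H.tr_def scale_sum_left sw_sum mult.assoc)
  finally show ?thesis by simp
qed

text \<open>
  Cyclicity of the trace, together with the fact that the square of the antipode is an algebra
  homomorphism: it is the Nakayama automorphism of the Frobenius form, up to inversion.
\<close>

lemma frob_twist: "frob (S (S x) * y) = frob (y * x)"
proof -
  have op: "H.operator (\<lambda>h. S (S (h * x)))" "H.operator (\<lambda>h. h * y)"
    "H.operator (\<lambda>h. S (S h))" "H.operator (\<lambda>h. h * (S (S x) * y))"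
    unfolding H_operator by (intro linear_intros)+
  have "frob (y * x) = H.tr (\<lambda>h. S (S ((h * y) * x)))" by (simp add: frob_def mult.assoc)
  also have "\<dots> = H.tr (\<lambda>h. S (S (h * x)) * y)" using H.tr_commute[OF op(1,2)] .
  also have "\<dots> = H.tr (\<lambda>h. S (S h) * (S (S x) * y))" by (simp add: antipode_mult mult.assoc)
  also have "\<dots> = frob (S (S x) * y)" unfolding frob_def using H.tr_commute[OF op(4,3)] .
  finally show ?thesis by simp
qed

lemma frob_nondegenerate: "(\<And>y. frob (x * y) = 0) \<Longrightarrow> x = 0"
  using frob_dual[of x] by (simp add: sw_def case_prod_unfold)

lemma functional_frob:
  assumes p: "lin scale (*) p"
  obtains x where "\<And>y. p y = frob (x * y)"
proof -
  define f where "f x = (\<Sum>e\<in>hbasis. scale (frob (x * e)) e)" for x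
  have lf: "lin scale scale f" unfolding f_def by (intro linear_sum_set linear_intros)
  have cf: "H.coord (f x) e = frob (x * e)" if "e \<in> hbasis" for x e
    using coord_sum_hbasis[OF that, of "\<lambda>e. frob (x * e)"] by (simp only: f_def)
  have frob_expand: "frob (x * y) = (\<Sum>e\<in>hbasis. H.coord y e * frob (x * e))" for x y
    using H.functional_expand[of "\<lambda>y. frob (x * y)" y]
    by (simp add: H.functional_def hbasis distrib_left linear_add[OF lin_frob] scale_mult_right frob_scale)
  have "inj f"
  proof (rule injI)
    fix x x' assume eq: "f x = f x'"
    have "frob ((x - x') * y) = 0" for y
    proof -
      have "frob (x * y) = frob (x' * y)"
        unfolding frob_expand[of x y] frob_expand[of x' y]
      proof (intro sum.cong refl)
        fix e assume "e \<in> hbasis"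
        from cf[OF this, of x] cf[OF this, of x'] eq
        show "H.coord y e * frob (x * e) = H.coord y e * frob (x' * e)" by simp
      qed
      moreover have "frob ((x - x') * y) + frob (x' * y) = frob (x * y)"
        by (simp flip: linear_add[OF lin_frob] add: algebra_simps)
      ultimately show ?thesis by simp
    qed
    then show "x = x'" using frob_nondegenerate[of "x - x'"] by simp
  qed
  then have "surj f" by (rule fd.linear_inj_imp_surj[OF lf])
  then obtain x where x: "f x = (\<Sum>e\<in>hbasis. scale (p e) e)" by (metis surj_def)
  have "p y = frob (x * y)" for y
  proof -
    have "p y = (\<Sum>e\<in>hbasis. H.coord y e * p e)"
      using H.functional_expand[of p y] p by (simp add: H.functional_def hbasis Vector_Spaces.linear_iff)
    also have "\<dots> = (\<Sum>e\<in>hbasis. H.coord y e * frob (x * e))"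
    proof (intro sum.cong refl)
      fix e assume e: "e \<in> hbasis"
      have "frob (x * e) = H.coord (\<Sum>e\<in>hbasis. scale (p e) e) e" using cf[OF e, of x] x by simp
      also have "\<dots> = p e"
        using coord_sum_hbasis[OF e, of p] by simp
      finally show "H.coord y e * p e = H.coord y e * frob (x * e)" by simp
    qed
    finally show ?thesis by (simp only: frob_expand[of x y])
  qed
  then show ?thesis using that by blast
qed

lemma frob_nondegenerate_right:
  assumes "\<And>x. frob (x * z) = 0" shows "z = 0"
proof (rule coord_eq_imp_eq)
  fix e
  obtain x where "\<And>y. H.coord y e = frob (x * y)" using functional_frob[OF lin_coord] by metis
  then show "H.coord z e = H.coord 0 e" using assms by (simp add: representation_zero)
qed

text \<open>
  A functional is determined by its contraction with the first leg of the Casimir element; this is how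
  identities between functionals are proved below.
\<close>

lemma casimir_zero:
  assumes p: "lin scale (*) p" and 0: "sw (\<lambda>a b. scale (p a) (S b)) L = 0"
  shows "p y = 0"
proof -
  obtain x where x: "\<And>y. p y = frob (x * y)" using functional_frob[OF p] by metis
  have "x = 0" using frob_dual[of x] 0 by (simp add: x)
  then show ?thesis using linear_scale_apply[OF lin_frob, of 0 0] by (simp add: x)
qed

lemma sw_diff_scale: "sw (\<lambda>a b. scale (p a - q a) (G b)) x = sw (\<lambda>a b. scale (p a) (G b)) x - sw (\<lambda>a b. scale (q a) (G b)) x"
  by (simp add: sw_def case_prod_unfold scale_left_diff_distrib sum_list_subtractf)

lemma linear_diff_functional: "lin s (*) p \<Longrightarrow> lin s (*) q \<Longrightarrow> lin s (*) (\<lambda>x. p x - q x)"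
  by (simp add: Vector_Spaces.linear_iff algebra_simps)

lemma casimir_unique:
  assumes p: "lin scale (*) p" and q: "lin scale (*) q"
    and eq: "sw (\<lambda>a b. scale (p a) (S b)) L = sw (\<lambda>a b. scale (q a) (S b)) L"
  shows "p y = q y"
  using casimir_zero[OF linear_diff_functional[OF p q]] eq by (simp add: sw_diff_scale)

lemma surj_antipode: "surj S"
proof (rule surjI)
  show "S (sw (\<lambda>a b. scale (frob (x * a)) b) L) = x" for x
    by (simp add: sw_apply[OF lin_antipode] antipode_scale frob_dual)
qed

lemma inj_antipode: "inj S"
  using fd.linear_surj_imp_inj[OF lin_antipode surj_antipode] .

lemma frob_L_one: "sw (\<lambda>a b. scale (frob a) b) L = 1"
proof -
  have "S (sw (\<lambda>a b. scale (frob a) b) L) = S 1"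
    using frob_dual[of 1] by (simp add: sw_apply[OF lin_antipode] antipode_scale antipode_one)
  then show ?thesis using inj_antipode by (simp add: inj_eq)
qed

text \<open>
  For every functional \<open>p\<close>, the functionals \<open>x \<mapsto> frob(x\<^sub>1) p(x\<^sub>2)\<close> and \<open>p(1) frob\<close> have the same contraction
  with the Casimir element, because \<open>frob(\<Lambda>\<^sub>1) \<Lambda>\<^sub>2 = 1\<close>. Coordinate functionals suffice for \<open>p\<close>.
\<close>

lemma frob_left_integral: "sw (\<lambda>a b. scale (frob a) b) x = scale (frob x) 1"
proof (rule coord_eq_imp_eq)
  fix e
  define p where "p x = H.coord x e" for x
  have lp [linear_intros]: "lin s (*) (\<lambda>a. p (f a))" if "lin s scale f" for s :: "'k \<Rightarrow> 'x::ab_group_add \<Rightarrow> 'x" and f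
    using that unfolding p_def by (rule linear_intros)
  have lp': "lin scale (*) p" using lp[OF linear_var] .
  have pp: "p (scale c x) = c * p x" for c x by (rule linear_scale_apply[OF lp'])
  have "sw (\<lambda>a b. frob a * p b) x = p 1 * frob x"
  proof (rule casimir_unique)
    have "sw (\<lambda>a b. scale (sw (\<lambda>a b. frob a * p b) a) (S b)) L =
      sw (\<lambda>a b. sw (\<lambda>b1 b2. scale (frob a * p b1) (S b2)) b) L"
      unfolding sw_scalar by (intro sw_coassoc[where t=scale] linear_intros)
    also have "\<dots> = sw (\<lambda>a b. scale (frob a) (sw (\<lambda>b1 b2. scale (p b1) (S b2)) b)) L"
      by (simp add: scale_sw)
    also have "\<dots> = sw (\<lambda>b1 b2. scale (p b1) (S b2)) (sw (\<lambda>a b. scale (frob a) b) L)"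
    proof -
      have "lin scale scale (sw (\<lambda>b1 b2. scale (p b1) (S b2)))"
        using linear_sw_arg[where f="\<lambda>x. x" and F="\<lambda>b1 b2. scale (p b1) (S b2)" and t=scale and s=scale]
        by (simp add: linear_intros)
      then show ?thesis by (simp add: sw_apply linear_scale_apply)
    qed
    also have "\<dots> = scale (p 1) (S 1)"
      unfolding frob_L_one by (rule sw_one[where t=scale]) (intro linear_intros)
    also have "\<dots> = sw (\<lambda>a b. scale (p 1 * frob a) (S b)) L"
      using frob_dual[of 1] by (simp add: antipode_one scale_sw[symmetric] flip: scale_scale)
    finally show "sw (\<lambda>a b. scale (sw (\<lambda>a b. frob a * p b) a) (S b)) L = sw (\<lambda>a b. scale (p 1 * frob a) (S b)) L" .
  qed (intro linear_intros)+
  then show "H.coord (sw (\<lambda>a b. scale (frob a) b) x) e = H.coord (scale (frob x) 1) e"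
    by (simp add: sw_apply[OF lp'] pp mult.commute flip: p_def)
qed

lemma frob_L: "frob L = 1"
  using frob_left_integral[of L] frob_L_one scale_cancel_right[of "frob L" 1 1] by simp

lemma left_integral_unique:
  assumes p: "lin scale (*) p" and left: "\<And>x. sw (\<lambda>a b. scale (p a) b) x = scale (p x) 1"
  shows "p x = p L * frob x"
proof (rule casimir_unique[OF p])
  have "sw (\<lambda>a b. scale (p a) (S b)) L = S (sw (\<lambda>a b. scale (p a) b) L)"
    by (simp add: sw_apply[OF lin_antipode] antipode_scale)
  also have "\<dots> = scale (p L) (sw (\<lambda>a b. scale (frob a) (S b)) L)"
    using frob_dual[of 1] by (simp add: left antipode_scale antipode_one)
  finally show "sw (\<lambda>a b. scale (p a) (S b)) L = sw (\<lambda>a b. scale (p L * frob a) (S b)) L"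
    by (simp add: scale_sw)
qed (intro linear_intros)

section \<open>The modular element and the fourth power of the antipode\<close>

text \<open>
  The form \<open>frob\<close> is a left integral of the dual. The modular element measures by how much it fails to be a
  right integral.
\<close>

definition modulus :: 'h where
  "modulus = sw (\<lambda>a b. scale (frob b) a) L"

text \<open>
  Convolving \<open>frob\<close> with any functional on the other side gives a left integral again, hence a multiple of
  \<open>frob\<close>; the multiple is the value of the functional at the modular element.
\<close>

lemma frob_right: "sw (\<lambda>a b. scale (frob b) a) x = scale (frob x) modulus"
proof (rule coord_eq_imp_eq)
  fix e
  define p where "p x = H.coord x e" for x
  have lp [linear_intros]: "lin s (*) (\<lambda>a. p (f a))" if "lin s scale f" for s :: "'k \<Rightarrow> 'x::ab_group_add \<Rightarrow> 'x" and f
    using that unfolding p_def by (rule linear_intros)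
  have lp': "lin scale (*) p" using lp[OF linear_var] .
  have pp: "p (scale c x) = c * p x" for c x by (rule linear_scale_apply[OF lp'])
  have "sw (\<lambda>a b. p a * frob b) x = sw (\<lambda>a b. p a * frob b) L * frob x"
  proof (rule left_integral_unique)
    fix x
    have "sw (\<lambda>a b. scale (sw (\<lambda>a b. p a * frob b) a) b) x = sw (\<lambda>a b. sw (\<lambda>b1 b2. scale (p a * frob b1) b2) b) x"
      unfolding sw_scalar by (intro sw_coassoc[where t=scale] linear_intros)
    also have "\<dots> = sw (\<lambda>a b. scale (p a) (sw (\<lambda>b1 b2. scale (frob b1) b2) b)) x"
      by (simp add: scale_sw)
    also have "\<dots> = scale (sw (\<lambda>a b. p a * frob b) x) 1"
      by (simp add: frob_left_integral sw_scalar)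
    finally show "sw (\<lambda>a b. scale (sw (\<lambda>a b. p a * frob b) a) b) x = scale (sw (\<lambda>a b. p a * frob b) x) 1" .
  qed (intro linear_intros)
  moreover have "p modulus = sw (\<lambda>a b. p a * frob b) L"
    by (simp add: modulus_def sw_apply[OF lp'] pp mult.commute)
  ultimately show "H.coord (sw (\<lambda>a b. scale (frob b) a) x) e = H.coord (scale (frob x) modulus) e"
    by (simp add: sw_apply[OF lp'] pp mult.commute flip: p_def)
qed

text \<open>
  The modular element is grouplike: evaluate \<open>x\<^sub>1 \<otimes> x\<^sub>2 frob(x\<^sub>3)\<close> at \<open>x = \<Lambda>\<close> by contracting the last two
  factors, or all of them.
\<close>

lemma sw_modulus:
  assumes F: "bilinear scale t F"
  shows "sw F modulus = F modulus modulus"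
proof -
  have F1 [linear_intros]: "lin s t (\<lambda>a. F (f a) y)" and F2 [linear_intros]: "lin s t (\<lambda>a. F y (f a))"
    if "lin s scale f" for s :: "'k \<Rightarrow> 'x::ab_group_add \<Rightarrow> 'x" and f y
    using F that linear_comp unfolding bilinear_def by blast+
  have t [linear_intros]: "vector_space t" using F unfolding bilinear_def using linear_vs2 by blast
  interpret t: vector_space t by fact
  have tt: "lin t t (t c)" for c using linear_scale_vector[of t t "\<lambda>x. x"] t
      by (simp add: Vector_Spaces.linear_iff)
  have sF: "F (scale c x) y = t c (F x y)" "F x (scale c y) = t c (F x y)" for c x y
    using F unfolding bilinear_def using linear_scale_apply by blast+
  have aF: "lin scale t (F x)" "lin scale t (\<lambda>x. F x y)" for x y using F unfolding bilinear_def by blast+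
  have lF: "lin scale t (sw F)"
    using linear_sw_arg[where f="\<lambda>x. x", OF F] by (simp add: linear_intros)
  have "sw F modulus = sw (\<lambda>a b. sw (\<lambda>a1 a2. t (frob b) (F a1 a2)) a) L"
    unfolding modulus_def by (simp add: sw_apply[OF lF] linear_scale_apply[OF lF] sw_apply[OF tt])
  also have "\<dots> = sw (\<lambda>a b. sw (\<lambda>b1 b2. t (frob b2) (F a b1)) b) L"
    by (rule sw_coassoc[where t=t]) (intro linear_intros)
  also have "\<dots> = sw (\<lambda>a b. F a (scale (frob b) modulus)) L"
    unfolding frob_right[symmetric] by (simp add: sw_apply[OF aF(1)] sF)
  also have "\<dots> = F modulus modulus"
    by (subst (2) modulus_def) (simp add: sw_apply[OF aF(2)] sF)
  finally show ?thesis .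
qed

lemma counit_modulus: "counit modulus = 1"
proof -
  have "counit modulus = sw (\<lambda>a b. counit a * frob b) L"
    by (simp add: modulus_def sw_apply[OF lin_counit] counit_scale mult.commute)
  also have "\<dots> = frob L" by (rule sw_counit_left) (rule lin_frob)
  finally show ?thesis by (simp add: frob_L)
qed

lemma antipode_modulus: "S modulus * modulus = 1" "modulus * S modulus = 1"
proof -
  have "sw (\<lambda>a b. S a * b) modulus = S modulus * modulus"  "sw (\<lambda>a b. a * S b) modulus = modulus * S modulus"
    by (rule sw_modulus[where t=scale]; intro linear_intros)+
  then show "S modulus * modulus = 1" "modulus * S modulus = 1"
    by (simp_all add: sw_antipode_left sw_antipode_right counit_modulus)
qed

lemma antipode_antipode_modulus: "S (S modulus) = modulus"
proof -
  have "S (S modulus) * S modulus = 1" using antipode_modulus(2) antipode_mult antipode_one by metis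
  then have "S (S modulus) * (S modulus * modulus) = modulus" by (simp flip: mult.assoc)
  then show ?thesis by (simp add: antipode_modulus)
qed

text \<open>
  The right integral property in Casimir form, obtained by inserting \<open>S(y\<^sub>1) y\<^sub>2\<close>.
\<close>

lemma frob_right_mult:
  "sw (\<lambda>a b. scale (frob (y * b)) a) x = sw (\<lambda>u v. scale (frob (v * x)) (S u * modulus)) y"
proof -
  have "sw (\<lambda>u v. scale (frob (v * x)) (S u * modulus)) y = sw (\<lambda>u v. S u * scale (frob (v * x)) modulus) y"
    by (simp add: scale_mult_right)
  also have "\<dots> = sw (\<lambda>u v. S u * sw (\<lambda>a b. scale (frob b) a) (v * x)) y"
    by (simp add: frob_right)
  also have "\<dots> = sw (\<lambda>u v. S u * sw (\<lambda>v1 v2. sw (\<lambda>a b. scale (frob (v2 * b)) (v1 * a)) x) v) y"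
    by (subst sw_mult[where t=scale]) (intro linear_intros, rule refl)
  also have "\<dots> = sw (\<lambda>u v. sw (\<lambda>v1 v2. sw (\<lambda>a b. scale (frob (v2 * b)) (S u * v1 * a)) x) v) y"
    by (simp add: mult_sw_left scale_mult_right mult.assoc)
  also have "\<dots> = sw (\<lambda>u v. sw (\<lambda>u1 u2. sw (\<lambda>a b. scale (frob (v * b)) (S u1 * u2 * a)) x) u) y"
    by (rule sw_coassoc[where t=scale, symmetric]) (intro linear_intros)
  also have "\<dots> = sw (\<lambda>u v. sw (\<lambda>u1 u2. S u1 * u2 * sw (\<lambda>a b. scale (frob (v * b)) a) x) u) y"
    by (simp add: mult_sw_left scale_mult_right)
  also have "\<dots> = sw (\<lambda>u v. scale (counit u) (sw (\<lambda>a b. scale (frob (v * b)) a) x)) y"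
    by (simp add: mult_sw_right[symmetric] sw_antipode_left scale_mult_left)
  also have "\<dots> = sw (\<lambda>a b. scale (frob (y * b)) a) x"
    by (rule sw_counit_left) (intro linear_intros)
  finally show ?thesis by simp
qed

text \<open>
  At \<open>x = \<Lambda>\<close> the preceding identity reads \<open>frob(y \<Lambda>\<^sub>2) \<Lambda>\<^sub>1 = S(y) g\<close> for the modular element \<open>g\<close>; apply
  \<open>frob\<close> and use \<open>frob(\<Lambda>\<^sub>1) \<Lambda>\<^sub>2 = 1\<close>.
\<close>

lemma frob_antipode: "frob (S y * modulus) = frob y"
proof -
  have "sw (\<lambda>a b. scale (frob (y * b)) a) L = sw (\<lambda>u v. scale (counit v) (S u * modulus)) y"
    by (simp add: frob_right_mult L_left frob_scale frob_L)
  also have "\<dots> = S y * modulus" by (rule sw_counit_right) (intro linear_intros)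
  finally have eq: "sw (\<lambda>a b. scale (frob (y * b)) a) L = S y * modulus" .
  have "frob (S y * modulus) = sw (\<lambda>a b. frob (y * scale (frob a) b)) L"
    unfolding eq[symmetric]
    by (simp add: sw_apply[OF lin_frob] frob_scale scale_mult_right mult.commute)
  also have "\<dots> = frob (y * sw (\<lambda>a b. scale (frob a) b) L)"
    by (simp add: sw_apply[OF lin_frob] mult_sw_left)
  finally show ?thesis by (simp add: frob_L_one)
qed

text \<open>
  Radford's formula for a unimodular Hopf algebra. Evaluate \<open>frob(y x')\<close> twice, once by applying
  \<open>frob(y) = frob(g S(y))\<close> directly and once after exchanging the factors with \<open>frob_twist\<close>; nondegeneracy
  of the form removes \<open>frob\<close>.
\<close>

lemma antipode_power_4: "S (S (S (S x))) * modulus = modulus * x"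
proof -
  have *: "frob (modulus * S y) = frob y" for y
    using frob_twist[of modulus "S y"] frob_antipode[of y] by (simp add: antipode_antipode_modulus)
  obtain x' where x: "x = S x'" using surj_antipode by (metis surj_def)
  have "frob ((S (S (S (S x))) * modulus - modulus * x) * z) = 0" for z
  proof -
    obtain y where z: "z = S y" using surj_antipode by (metis surj_def)
    have "frob (modulus * x * z) = frob (y * x')"
      using *[of "y * x'"] by (simp add: antipode_mult x z mult.assoc)
    also have "\<dots> = frob (S (S x') * y)" by (simp add: frob_twist)
    also have "\<dots> = frob (modulus * S y * S (S (S x')))"
      using *[of "S (S x') * y"] by (simp add: antipode_mult mult.assoc)
    also have "\<dots> = frob (S (S (S (S x))) * modulus * z)"
      using frob_twist[of "S (S x)" "modulus * z"] by (simp add: x z mult.assoc)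
    moreover have "frob ((S (S (S (S x))) * modulus - modulus * x) * z) + frob (modulus * x * z) = frob (S (S (S (S x))) * modulus * z)"
      by (simp flip: linear_add[OF lin_frob] add: algebra_simps)
    ultimately show ?thesis by simp
  qed
  then show ?thesis using frob_nondegenerate by (metis eq_iff_diff_eq_0)
qed

lemma sw_modulus_power:
  assumes F: "bilinear scale t F"
  shows "sw F (modulus ^ i) = F (modulus ^ i) (modulus ^ i)"
  using F
proof (induction i arbitrary: F)
  case 0
  then show ?case by (simp add: sw_one)
next
  case (Suc i)
  have F1 [linear_intros]: "lin s t (\<lambda>a. F (f a) y)" and F2 [linear_intros]: "lin s t (\<lambda>a. F y (f a))"
    if "lin s scale f" for s :: "'k \<Rightarrow> 'x::ab_group_add \<Rightarrow> 'x" and f y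
    using Suc.prems that linear_comp unfolding bilinear_def by blast+
  have "sw F (modulus ^ Suc i) = sw (\<lambda>a b. sw (\<lambda>c d. F (a * c) (b * d)) (modulus ^ i)) modulus"
    by (simp add: sw_mult[OF Suc.prems])
  also have "\<dots> = sw (\<lambda>a b. F (a * modulus ^ i) (b * modulus ^ i)) modulus"
    by (intro sw_cong Suc.IH linear_intros)
  also have "\<dots> = F (modulus * modulus ^ i) (modulus * modulus ^ i)"
    by (rule sw_modulus[where t=t]) (intro linear_intros)
  finally show ?case by simp
qed

lemma counit_power: "counit (x ^ i) = counit x ^ i"
  by (induction i) (simp_all add: counit_one counit_mult)

text \<open>
  Distinct grouplike elements are independent. If \<open>g\<close> is a combination of independent grouplike
  \<open>h\<close> with coefficients \<open>c h\<close>, applying a functional \<open>p\<close> to the first leg of the comultiplication gives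
  \<open>p(g) c h = c h p(h)\<close>, so \<open>c h \<noteq> 0\<close> forces \<open>g = h\<close>.
\<close>

lemma modulus_powers_independent:
  assumes "finite A" "A \<subseteq> range (\<lambda>i. modulus ^ i)"
  shows "independent A"
  using assms
proof (induction A)
  case (insert g A)
  have "g \<notin> span A"
  proof
    assume g: "g \<in> span A"
    have gl: "sw F h = F h h" if "h \<in> insert g A" "bilinear scale scale F" for F h
      using insert.prems that sw_modulus_power[OF that(2)] by auto
    interpret A: finite_basis scale A by unfold_locales (use insert in auto)
    define c where "c = A.coord g"
    have gc: "g = (\<Sum>h\<in>A. scale (c h) h)" unfolding c_def using A.coord_expand[OF g] by simp
    have "c h = 0" if h: "h \<in> A" for h
    proof (rule ccontr)
      assume ch: "c h \<noteq> 0"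
      have "H.coord g e = H.coord h e" for e
      proof -
        have bil: "bilinear scale scale (\<lambda>a b. scale (H.coord a e) b)" by (intro linear_intros)
        have ls: "lin scale scale (sw (\<lambda>a b. scale (H.coord a e) b))"
          using linear_sw_arg[where f="\<lambda>x. x", OF bil] by (simp add: linear_intros)
        have "scale (H.coord g e) g = sw (\<lambda>a b. scale (H.coord a e) b) (\<Sum>h\<in>A. scale (c h) h)"
          using gl[OF _ bil, of g] gc by simp
        also have "\<dots> = (\<Sum>h\<in>A. scale (c h) (sw (\<lambda>a b. scale (H.coord a e) b) h))"
          by (simp add: linear_sum_apply[OF ls] linear_scale_apply[OF ls])
        also have "\<dots> = (\<Sum>h\<in>A. scale (c h * H.coord h e) h)"
          using gl[OF _ bil] by (intro sum.cong refl) simp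
        also have "scale (H.coord g e) g = (\<Sum>h\<in>A. scale (c h * H.coord g e) h)"
          by (subst (2) gc) (simp add: scale_sum_right mult.commute)
        finally have "(\<Sum>h\<in>A. scale (c h * (H.coord g e - H.coord h e)) h) = 0"
          by (simp add: right_diff_distrib scale_left_diff_distrib sum_subtractf)
        then show ?thesis
          using independentD[OF A.independent_basis A.finite_basis subset_refl _ h] ch by fastforce
      qed
      then have "g = h" by (rule coord_eq_imp_eq)
      then show False using h insert by simp
    qed
    then have "g = 0" using gc by simp
    moreover have "counit g = 1" using insert.prems by (auto simp: counit_power counit_modulus)
    ultimately show False using counit_scale[of 0 0] by simp
  qed
  then show ?case using insert by (simp add: independent_insert)
qed (simp add: independent_empty)

lemma modulus_finite_order: obtains N where "N > 0" "modulus ^ N = 1"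
proof -
  have "\<not> inj (\<lambda>i. modulus ^ i)"
  proof
    assume inj: "inj (\<lambda>i::nat. modulus ^ i)"
    then have c: "card ((\<lambda>i. modulus ^ i) ` {..card hbasis}) = Suc (card hbasis)"
      by (subst card_image) (auto intro: inj_on_subset)
    have "independent ((\<lambda>i. modulus ^ i) ` {..card hbasis})"
      by (rule modulus_powers_independent) auto
    then show False using independent_span_bound[OF hbasis(1)] hbasis(3) c by fastforce
  qed
  then obtain i j where ij: "i < j" "modulus ^ i = modulus ^ j"
    unfolding inj_def by (metis linorder_neqE_nat)
  have "modulus ^ (j - i) = (S modulus ^ i * modulus ^ i) * modulus ^ (j - i)"
    by (simp add: left_right_inverse_power[OF antipode_modulus(1)])
  also have "\<dots> = S modulus ^ i * modulus ^ j" using ij(1) by (simp add: mult.assoc flip: power_add)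
  also have "\<dots> = 1" by (simp add: left_right_inverse_power[OF antipode_modulus(1)] flip: ij(2))
  finally show ?thesis using that[of "j - i"] ij(1) by simp
qed

end

section \<open>When the antipode is an involution\<close>

context hopf_integral
begin

definition reg_char :: "'h \<Rightarrow> 'k" where
  "reg_char x = H.tr (\<lambda>h. h * x)"

lemma linear_reg_char [linear_intros]: "lin s scale f \<Longrightarrow> lin s (*) (\<lambda>a. reg_char (f a))"
  unfolding reg_char_def H.tr_def
  by (intro linear_sum_set linear_intros vector_space_field) (auto simp: Vector_Spaces.linear_iff)

lemma lin_reg_char: "lin scale (*) reg_char"
  using linear_reg_char[OF linear_var] .

lemma reg_char_commute: "reg_char (x * y) = reg_char (y * x)"
proof -
  have op: "H.operator (\<lambda>h. h * x)" for x unfolding H_operator by (intro linear_intros)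
  show ?thesis unfolding reg_char_def using H.tr_commute[OF op op, of y x] by (simp add: mult.assoc)
qed

lemma reg_char_one: "reg_char 1 = of_nat (card hbasis)"
  by (simp add: reg_char_def H.tr_id)

lemma reg_char_L: "reg_char L = 1"
proof -
  have "reg_char L = (\<Sum>e\<in>hbasis. counit e * H.coord L e)"
    by (simp add: reg_char_def H.tr_def L_left linear_scale_apply[OF lin_coord])
  also have "\<dots> = counit (\<Sum>e\<in>hbasis. scale (H.coord L e) e)"
    by (simp add: linear_sum_apply[OF lin_counit] counit_scale mult.commute)
  finally show ?thesis by (simp only: H_expand counit_L)
qed

lemma tr_sw_scale:
  assumes "\<And>b. lin scale scale (\<lambda>k. G k b)"
  shows "H.tr (\<lambda>k. sw (\<lambda>a b. scale (p a) (G k b)) x) = sw (\<lambda>a b. p a * H.tr (\<lambda>k. G k b)) x"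
  by (simp add: H.tr_def sw_apply[OF lin_coord] linear_scale_apply[OF lin_coord] sum_distrib_left sw_sum)

text \<open>
  The tensor product of any module with the regular one is a multiple of the regular one. On the level
  of traces: right multiplication by \<open>x\<^sub>1 \<otimes> x\<^sub>2\<close> is conjugate to right multiplication by \<open>x\<close> on the second
  factor, since \<open>x\<^sub>1 \<otimes> k x\<^sub>2 = S(k\<^sub>1) (k\<^sub>2 x)\<^sub>1 \<otimes> (k\<^sub>2 x)\<^sub>2\<close>. After cyclic permutations under \<open>p\<close> and under the
  trace over \<open>k\<close> the factors involving \<open>S\<close> cancel.
\<close>

lemma trace_reg_char_convolution:
  assumes p: "lin scale (*) p" and p_comm: "\<And>x y. p (x * y) = p (y * x)"
  shows "sw (\<lambda>a b. p a * reg_char b) x = p 1 * reg_char x"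
proof -
  have lp [linear_intros]: "lin s (*) (\<lambda>a. p (f a))" if "lin s scale f" for s :: "'k \<Rightarrow> 'x::ab_group_add \<Rightarrow> 'x" and f
    using linear_comp[OF p that] .
  have pp: "p (scale c x) = c * p x" for c x by (rule linear_scale_apply[OF p])
  \<comment> \<open>For fixed \<open>c\<close> and \<open>e\<close> these are operators; the trace is cyclic for their composition.\<close>
  define F where "F c y = sw (\<lambda>u v. scale (p (u * S c)) v) y" for c y
  define D where "D e k = sw (\<lambda>a b. scale (H.coord a e) b) k" for e k
  have F_lin [linear_intros]: "lin s scale (\<lambda>a. F c (f a))" and F_lin' [linear_intros]: "lin s scale (\<lambda>a. F (f a) y)"
    if "lin s scale f" for s :: "'k \<Rightarrow> 'x::ab_group_add \<Rightarrow> 'x" and f c y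
    unfolding F_def by (intro linear_intros that)+
  have D_lin [linear_intros]: "lin s scale (\<lambda>a. D e (f a))"
    if "lin s scale f" for s :: "'k \<Rightarrow> 'x::ab_group_add \<Rightarrow> 'x" and f e
    unfolding D_def by (intro linear_intros that)
  have p_rot: "p (u * v * S w) = p (S w * u * v)" for u v w
    using p_comm[of "u * v" "S w"] by (simp add: mult.assoc)
  have step: "sw (\<lambda>a b. scale (p a) (k * b)) x = sw (\<lambda>a b. F a (b * x)) k" for k
  proof -
    have "sw (\<lambda>a b. F a (b * x)) k =
      sw (\<lambda>a b. sw (\<lambda>b1 b2. sw (\<lambda>u v. scale (p (b1 * u * S a)) (b2 * v)) x) b) k"
      unfolding F_def by (intro sw_cong sw_mult[where t=scale]) (intro linear_intros)
    also have "\<dots> = sw (\<lambda>a b. sw (\<lambda>b1 b2. sw (\<lambda>u v. scale (p (S a * b1 * u)) (b2 * v)) x) b) k"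
      unfolding p_rot ..
    also have "\<dots> = sw (\<lambda>a b. sw (\<lambda>a1 a2. sw (\<lambda>u v. scale (p (S a1 * a2 * u)) (b * v)) x) a) k"
      by (rule sw_coassoc[where t=scale, symmetric]) (intro linear_intros)
    also have "\<dots> = sw (\<lambda>a b. sw (\<lambda>u v. scale (p (sw (\<lambda>a1 a2. S a1 * a2) a * u)) (b * v)) x) k"
      by (subst sw_swap) (simp add: mult_sw_right sw_apply[OF p] sw_scalar)
    also have "\<dots> = sw (\<lambda>a b. scale (counit a) (sw (\<lambda>u v. scale (p u) (b * v)) x)) k"
      by (simp add: sw_antipode_left scale_mult_left pp scale_sw)
    also have "\<dots> = sw (\<lambda>a b. scale (p a) (k * b)) x"
      by (rule sw_counit_left) (intro linear_intros)
    finally show ?thesis by simp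
  qed
  have expand: "sw (\<lambda>a b. F a (b * x)) k = (\<Sum>e\<in>hbasis. F e (D e k * x))" for k
  proof -
    have "F a (b * x) = (\<Sum>e\<in>hbasis. scale (H.coord a e) (F e (b * x)))" for a b
    proof -
      have "F a (b * x) = F (\<Sum>e\<in>hbasis. scale (H.coord a e) e) (b * x)" by (simp only: H_expand)
      also have "\<dots> = (\<Sum>e\<in>hbasis. scale (H.coord a e) (F e (b * x)))"
        by (simp add: linear_sum_apply[OF F_lin'[OF linear_var]] linear_scale_apply[OF F_lin'[OF linear_var]])
      finally show ?thesis .
    qed
    then have "sw (\<lambda>a b. F a (b * x)) k = sw (\<lambda>a b. \<Sum>e\<in>hbasis. scale (H.coord a e) (F e (b * x))) k"
      by (rule sw_cong)
    also have "\<dots> = (\<Sum>e\<in>hbasis. sw (\<lambda>a b. scale (H.coord a e) (F e (b * x))) k)"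
      by (rule sw_sum)
    also have "\<dots> = (\<Sum>e\<in>hbasis. F e (D e k * x))"
    proof (intro sum.cong refl)
      fix e
      have l: "lin scale scale (\<lambda>z. F e (z * x))" by (intro linear_intros)
      show "sw (\<lambda>a b. scale (H.coord a e) (F e (b * x))) k = F e (D e k * x)"
        unfolding D_def by (simp add: sw_apply[OF l] linear_scale_apply[OF l])
    qed
    finally show ?thesis .
  qed
  have DF: "(\<Sum>e\<in>hbasis. D e (F e y)) = scale (p 1) y" for y
  proof -
    have "D e (F e y) = sw (\<lambda>u v. sw (\<lambda>v1 v2. scale (p (u * S e) * H.coord v1 e) v2) v) y" for e
    proof -
      have l: "lin scale scale (D e)" using D_lin[OF linear_var] .
      show ?thesis unfolding F_def
        by (simp add: sw_apply[OF l] linear_scale_apply[OF l]) (simp add: D_def scale_sw)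
    qed
    then have "(\<Sum>e\<in>hbasis. D e (F e y)) =
      sw (\<lambda>u v. sw (\<lambda>v1 v2. \<Sum>e\<in>hbasis. scale (p (u * S e) * H.coord v1 e) v2) v) y"
      by (simp add: sw_sum)
    also have "\<dots> = sw (\<lambda>u v. sw (\<lambda>v1 v2. scale (p (u * S v1)) v2) v) y"
    proof (intro sw_cong)
      fix u v v1 v2
      have l: "lin scale (*) (\<lambda>z. p (u * S z))" by (intro linear_intros)
      have "p (u * S v1) = p (u * S (\<Sum>e\<in>hbasis. scale (H.coord v1 e) e))" by (simp only: H_expand)
      also have "\<dots> = (\<Sum>e\<in>hbasis. H.coord v1 e * p (u * S e))"
        by (simp only: linear_sum_apply[OF l] linear_scale_apply[OF l])
      finally show "(\<Sum>e\<in>hbasis. scale (p (u * S e) * H.coord v1 e) v2) = scale (p (u * S v1)) v2"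
        by (simp add: mult.commute flip: scale_sum_left)
    qed
    also have "\<dots> = sw (\<lambda>u v. sw (\<lambda>u1 u2. scale (p (u1 * S u2)) v) u) y"
      by (rule sw_coassoc[where t=scale, symmetric]) (intro linear_intros)
    also have "\<dots> = sw (\<lambda>u v. scale (p (sw (\<lambda>u1 u2. u1 * S u2) u)) v) y"
      by (simp add: sw_apply[OF p] sw_scalar)
    also have "\<dots> = sw (\<lambda>u v. scale (counit u) (scale (p 1) v)) y"
      by (simp add: sw_antipode_right pp)
    also have "\<dots> = scale (p 1) y" by (rule sw_counit_left) (intro linear_intros)
    finally show ?thesis .
  qed
  have opF: "H.operator (\<lambda>y. F e y)" and opD: "H.operator (\<lambda>k. D e k * x)"
    and opFD: "H.operator (\<lambda>k. F e (D e k * x))" and opDF: "H.operator (\<lambda>y. D e (F e y) * x)"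
    and opx: "H.operator (\<lambda>y. y * x)" for e
    unfolding H_operator by (intro linear_intros)+
  have "sw (\<lambda>a b. p a * reg_char b) x = H.tr (\<lambda>k. sw (\<lambda>a b. scale (p a) (k * b)) x)"
    unfolding reg_char_def by (rule tr_sw_scale[symmetric]) (intro linear_intros)
  also have "\<dots> = H.tr (\<lambda>k. \<Sum>e\<in>hbasis. F e (D e k * x))"
    by (simp add: step expand)
  also have "\<dots> = (\<Sum>e\<in>hbasis. H.tr (\<lambda>k. F e (D e k * x)))"
    by (rule H.tr_sum) (rule opFD)
  also have "\<dots> = (\<Sum>e\<in>hbasis. H.tr (\<lambda>y. D e (F e y) * x))"
    by (intro sum.cong refl H.tr_commute opF opD)
  also have "\<dots> = H.tr (\<lambda>y. \<Sum>e\<in>hbasis. D e (F e y) * x)"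
    by (rule H.tr_sum[symmetric]) (rule opDF)
  also have "\<dots> = H.tr (\<lambda>y. scale (p 1) (y * x))"
    by (simp add: scale_mult_left DF flip: sum_distrib_right)
  also have "\<dots> = p 1 * reg_char x" unfolding reg_char_def by (rule H.tr_scale[OF opx])
  finally show ?thesis .
qed

text \<open>
  The left integral property in Casimir form, obtained by inserting \<open>y\<^sub>2 S(y\<^sub>3)\<close>.
\<close>

lemma frob_left_mult:
  "sw (\<lambda>a b. scale (frob (a * y)) b) x = sw (\<lambda>a b. scale (frob (x * a)) (S b)) y"
proof -
  have "sw (\<lambda>a b. scale (frob (x * a)) (S b)) y = sw (\<lambda>a b. scale (frob (x * a)) 1 * S b) y"
    by (simp add: scale_mult_left)
  also have "\<dots> = sw (\<lambda>a b. sw (\<lambda>u v. scale (frob u) v) (x * a) * S b) y"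
    by (simp add: frob_left_integral)
  also have "\<dots> = sw (\<lambda>a b. sw (\<lambda>u v. sw (\<lambda>a1 a2. scale (frob (u * a1)) (v * a2)) a) x * S b) y"
    by (subst sw_mult[where t=scale]) (intro linear_intros, rule refl)
  also have "\<dots> = sw (\<lambda>a b. sw (\<lambda>a1 a2. sw (\<lambda>u v. scale (frob (u * a1)) (v * (a2 * S b))) x) a) y"
    by (subst sw_swap) (simp add: mult_sw_right scale_mult_left mult.assoc)
  also have "\<dots> = sw (\<lambda>a b. sw (\<lambda>b1 b2. sw (\<lambda>u v. scale (frob (u * a)) (v * (b1 * S b2))) x) b) y"
    by (rule sw_coassoc[where t=scale]) (intro linear_intros)
  also have "\<dots> = sw (\<lambda>a b. sw (\<lambda>u v. scale (frob (u * a)) (v * sw (\<lambda>b1 b2. b1 * S b2) b)) x) y"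
    by (subst sw_swap) (simp add: mult_sw_left scale_sw)
  also have "\<dots> = sw (\<lambda>a b. scale (counit b) (sw (\<lambda>u v. scale (frob (u * a)) v) x)) y"
    by (simp add: sw_antipode_right scale_mult_right scale_sw mult.commute)
  also have "\<dots> = sw (\<lambda>a b. scale (frob (a * y)) b) x"
    by (rule sw_counit_right) (intro linear_intros)
  finally show ?thesis by simp
qed

text \<open>
  The square of the antipode is a coalgebra homomorphism. For the functionals \<open>frob(_ \<cdot> x)\<close> this follows by using
  \<open>frob_left_mult\<close> twice, and every functional has this form.
\<close>

lemma sw_antipode_antipode:
  assumes p: "lin scale (*) p"
  shows "sw (\<lambda>a b. scale (p a) b) (S (S y)) = sw (\<lambda>a b. scale (p (S (S a))) (S (S b))) y"
proof -
  obtain x' where x': "\<And>z. p z = frob (x' * z)" using functional_frob[OF p] by metis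
  obtain x'' where "x' = S x''" using surj_antipode by (metis surj_def)
  moreover obtain x where "x'' = S x" using surj_antipode by (metis surj_def)
  ultimately have px: "p z = frob (z * x)" for z by (simp add: x' frob_twist)
  have "sw (\<lambda>a b. scale (frob (a * x)) b) (S (S y)) = sw (\<lambda>a b. scale (frob (S (S y) * a)) (S b)) x"
    by (rule frob_left_mult)
  also have "\<dots> = S (sw (\<lambda>a b. scale (frob (a * y)) b) x)"
    by (simp add: frob_twist sw_apply[OF lin_antipode] antipode_scale)
  also have "\<dots> = sw (\<lambda>a b. scale (frob (x * a)) (S (S b))) y"
    by (simp add: frob_left_mult sw_apply[OF lin_antipode] antipode_scale)
  also have "\<dots> = sw (\<lambda>a b. scale (frob (S (S a) * x)) (S (S b))) y"
    by (simp add: frob_twist)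
  finally show ?thesis by (simp add: px)
qed

lemma frob_diff: "frob (u - v) = frob u - frob v"
  using linear_add[OF lin_frob, of "u - v" v] by (simp add: algebra_simps)

text \<open>
  The dual basis formula with the two legs exchanged, a consequence of nondegeneracy.
\<close>

lemma frob_dual': "sw (\<lambda>a b. scale (frob (S b * y)) a) L = y"
proof -
  have "frob (x * (sw (\<lambda>a b. scale (frob (S b * y)) a) L - y)) = 0" for x
  proof -
    have "frob (x * sw (\<lambda>a b. scale (frob (S b * y)) a) L) = sw (\<lambda>a b. frob (x * a) * frob (S b * y)) L"
      by (simp add: mult_sw_left scale_mult_right sw_apply[OF lin_frob] frob_scale mult.commute)
    also have "\<dots> = frob (sw (\<lambda>a b. scale (frob (x * a)) (S b)) L * y)"
      by (simp add: mult_sw_right scale_mult_left sw_apply[OF lin_frob] frob_scale)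
    also have "\<dots> = frob (x * y)" by (simp add: frob_dual)
    finally have "frob (x * sw (\<lambda>a b. scale (frob (S b * y)) a) L) = frob (x * y)" .
    then show ?thesis by (simp add: right_diff_distrib frob_diff)
  qed
  then show ?thesis using frob_nondegenerate_right eq_iff_diff_eq_0 by blast
qed

lemma tr_frob:
  assumes f: "lin scale scale f"
  shows "H.tr f = sw (\<lambda>a b. frob (S b * f a)) L"
proof -
  have "H.tr f = (\<Sum>e\<in>hbasis. H.coord (f (sw (\<lambda>a b. scale (frob (S b * e)) a) L)) e)"
    by (simp add: H.tr_def frob_dual')
  also have "\<dots> = sw (\<lambda>a b. \<Sum>e\<in>hbasis. frob (S b * e) * H.coord (f a) e) L"
    by (simp add: sw_apply[OF f] linear_scale_apply[OF f] sw_apply[OF lin_coord] linear_scale_apply[OF lin_coord] sw_sum)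
  also have "\<dots> = sw (\<lambda>a b. frob (S b * f a)) L"
  proof (rule sw_cong)
    fix a b
    have l: "lin scale (*) (\<lambda>z. frob (S b * z))" by (intro linear_intros)
    have "frob (S b * f a) = frob (S b * (\<Sum>e\<in>hbasis. scale (H.coord (f a) e) e))" by (simp only: H_expand)
    also have "\<dots> = (\<Sum>e\<in>hbasis. frob (S b * e) * H.coord (f a) e)"
      by (simp only: linear_sum_apply[OF l] linear_scale_apply[OF l] mult.commute)
    finally show "(\<Sum>e\<in>hbasis. frob (S b * e) * H.coord (f a) e) = frob (S b * f a)" by simp
  qed
  finally show ?thesis .
qed

text \<open>
  Evaluating the right integral property at \<open>1\<close> shows that the modular element is trivial.
\<close>

lemma antipode_power_4_trivial:
  assumes "frob 1 \<noteq> 0" shows "S (S (S (S x))) = x"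
proof -
  have "scale (frob 1) modulus = sw (\<lambda>a b. scale (frob b) a) 1" by (simp add: frob_right)
  also have "\<dots> = scale (frob 1) 1" by (rule sw_one[where t=scale]) (intro linear_intros)
  finally have "modulus = 1" using assms by (simp only: scale_cancel_left) simp
  then show ?thesis using antipode_power_4[of x] by simp
qed

end

locale hopf_integral_char_0 = hopf_integral scale comult counit antipode L
  for scale :: "'k::field_char_0 \<Rightarrow> 'h::ring_1 \<Rightarrow> 'h"
    and comult :: "'h \<Rightarrow> ('h \<times> 'h) list" and counit :: "'h \<Rightarrow> 'k" and antipode :: "'h \<Rightarrow> 'h"
    and L :: 'h
begin

lemma hbasis_nonempty: "card hbasis > 0"
proof -
  have "hbasis \<noteq> {}"
  proof
    assume "hbasis = {}"
    moreover have "(1 :: 'h) \<in> span hbasis" by (simp only: hbasis(3) UNIV_I)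
    ultimately show False by simp
  qed
  then show ?thesis using hbasis(1) by (simp add: card_gt_0_iff)
qed

lemma frob_one_eq_tr: "frob 1 = H.tr (\<lambda>h. S (S h))"
  by (simp add: frob_def)

text \<open>
  Let \<open>e\<close> be the regular character divided by \<open>n = dim H\<close>. It is an idempotent for convolution, so
  \<open>P x = e(x\<^sub>1) x\<^sub>2\<close> is an idempotent operator, and it commutes with the square of the antipode. Hence
  \<open>T = S\<^sup>2 P\<close> satisfies \<open>T\<^sup>3 = T\<close> and its trace is an integer. The trace formula \<open>tr_frob\<close> gives the value
  \<open>e(\<Lambda>) frob(1) = frob(1) / n\<close> for this integer.
\<close>

lemma frob_one_divisible:
  assumes nz: "frob 1 \<noteq> 0"
  obtains t :: int where "frob 1 = of_nat (card hbasis) * of_int t"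
proof -
  let ?n = "of_nat (card hbasis) :: 'k"
  have n0: "?n \<noteq> 0" using hbasis_nonempty by simp
  note S4 = antipode_power_4_trivial[OF nz]
  define e where "e x = reg_char x / ?n" for x
  have e_lin [linear_intros]: "lin s (*) (\<lambda>a. e (f a))" if "lin s scale f" for s :: "'k \<Rightarrow> 'x::ab_group_add \<Rightarrow> 'x" and f
    unfolding e_def divide_inverse by (intro linear_intros that)
  have le: "lin scale (*) e" using e_lin[OF linear_var] .
  have e_idem: "sw (\<lambda>a b. e a * e b) x = e x" for x
  proof -
    have l: "lin (*) (*) (\<lambda>c. c / (?n * ?n))" by (simp add: Vector_Spaces.linear_iff vector_space_field add_divide_distrib)
    have "sw (\<lambda>a b. e a * e b) x = sw (\<lambda>a b. reg_char a * reg_char b) x / (?n * ?n)"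
      by (simp add: e_def sw_apply[OF l])
    also have "\<dots> = e x"
      using n0 by (simp add: trace_reg_char_convolution[OF lin_reg_char reg_char_commute] reg_char_one e_def)
    finally show ?thesis .
  qed
  have reg_char_S2: "reg_char (S (S x)) = reg_char x" for x
  proof -
    have op: "H.operator (\<lambda>h. S (S h))" "H.operator (\<lambda>h. S (S h) * x)" unfolding H_operator by (intro linear_intros)+
    have "reg_char (S (S x)) = H.tr (\<lambda>h. S (S (S (S h) * x)))"
      by (simp add: reg_char_def antipode_mult S4)
    also have "\<dots> = H.tr (\<lambda>h. S (S (S (S h))) * x)" by (rule H.tr_commute[OF op])
    finally show ?thesis by (simp add: S4 reg_char_def)
  qed
  define P where "P x = sw (\<lambda>a b. scale (e a) b) x" for x
  have P_lin [linear_intros]: "lin s scale (\<lambda>a. P (f a))" if "lin s scale f" for s :: "'k \<Rightarrow> 'x::ab_group_add \<Rightarrow> 'x" and f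
    unfolding P_def by (intro linear_intros that)
  have lP: "lin scale scale P" using P_lin[OF linear_var] .
  have PP: "P (P x) = P x" for x
  proof -
    have "P (P x) = sw (\<lambda>a b. sw (\<lambda>b1 b2. scale (e a * e b1) b2) b) x"
      by (subst (2) P_def) (simp add: sw_apply[OF lP] linear_scale_apply[OF lP], simp add: P_def scale_sw)
    also have "\<dots> = sw (\<lambda>a b. sw (\<lambda>a1 a2. scale (e a1 * e a2) b) a) x"
      by (rule sw_coassoc[where t=scale, symmetric]) (intro linear_intros)
    also have "\<dots> = P x" by (simp add: P_def e_idem flip: sw_scalar)
    finally show ?thesis .
  qed
  have PS: "P (S (S x)) = S (S (P x))" for x
    unfolding P_def sw_antipode_antipode[OF le]
    by (simp add: sw_apply[OF lin_antipode] antipode_scale e_def reg_char_S2)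
  define T where "T x = S (S (P x))" for x
  have lT: "lin scale scale T" unfolding T_def by (intro linear_intros)
  have TT: "T (T x) = P x" for x by (simp add: T_def PS PP S4)
  have TP: "T (P x) = T x" and PT: "P (T x) = T x" for x by (simp_all add: T_def PP PS)
  have addT: "T (x + y) = T x + T y" "P (x + y) = P x + P y" "T (x - y) = T x - T y" "P (x - y) = P x - P y"
    "T (scale c x) = scale c (T x)" "P (scale c x) = scale c (P x)" for x y c
  proof -
    have "T (x - y) + T y = T x" "P (x - y) + P y = P x"
      by (simp_all flip: linear_add[OF lT] linear_add[OF lP])
    then show "T (x - y) = T x - T y" "P (x - y) = P x - P y" by (simp_all add: eq_diff_eq)
  qed (simp_all add: linear_add[OF lT] linear_add[OF lP] linear_scale_apply[OF lT] linear_scale_apply[OF lP])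
  have opT: "H.operator T" and opP: "H.operator P" unfolding H_operator by (rule lT lP)+
  have half: "scale (1/2) x + scale (1/2) x = x" for x
    by (simp flip: scale_left_distrib)
  \<comment> \<open>\<open>T\<close> is the difference of the idempotents \<open>Q 1\<close> and \<open>Q (-1)\<close>, the projections to its eigenspaces.\<close>
  define Q where "Q s x = scale (1/2) (P x + scale s (T x))" for s x
  have opQ: "H.operator (Q s)" for s
    unfolding Q_def by (intro H.operator_scale H.operator_add opT opP)
  have QQ: "Q s (Q s x) = Q s x" if "s * s = 1" for s x
  proof -
    have "Q s (Q s x) = scale (1/2) (scale (1/2) (P x + scale s (T x)) + scale (1/2) (P x + scale s (T x)))"
      using that by (simp add: Q_def addT PP TP PT TT scale_right_distrib mult.left_commute)
    then show ?thesis by (simp only: half Q_def)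
  qed
  have nat_tr: "\<exists>r::nat. H.tr (Q s) = of_nat r" if "s * s = 1" for s
    by (rule H.tr_idempotent[OF opQ[of s] QQ[OF that]]) blast
  obtain r1 r2 :: nat where r1: "H.tr (Q 1) = of_nat r1" and r2: "H.tr (Q (-1)) = of_nat r2"
    using nat_tr[of 1] nat_tr[of "-1"] by auto
  have trQ: "H.tr (Q s) = (H.tr P + s * H.tr T) / 2" for s
    unfolding Q_def by (simp add: H.tr_scale H.tr_add H.operator_add H.operator_scale opP opT)
  have "2 * of_nat r1 = H.tr P + H.tr T" "2 * of_nat r2 = H.tr P - H.tr T"
    using r1 r2 trQ[of 1] trQ[of "-1"] by (simp_all add: mult.commute)
  then have "2 * H.tr T = 2 * (of_nat r1 - of_nat r2)" by (simp add: algebra_simps)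
  then have "H.tr T = of_nat r1 - of_nat r2" by (subst (asm) mult_left_cancel) simp_all
  then have trT: "H.tr T = of_int (int r1 - int r2)" by simp
  have "H.tr T = sw (\<lambda>a b. frob (S b * S (S (P a)))) L"
    by (simp add: tr_frob[OF lT] T_def)
  also have "\<dots> = sw (\<lambda>a b. sw (\<lambda>a1 a2. e a1 * frob (S b * S (S a2))) a) L"
    by (simp add: P_def sw_apply[OF lin_antipode] antipode_scale mult_sw_left scale_mult_right
        sw_apply[OF lin_frob] frob_scale)
  also have "\<dots> = sw (\<lambda>a b. sw (\<lambda>b1 b2. e a * frob (S b2 * S (S b1))) b) L"
    by (rule sw_coassoc[where t="(*)"]) (intro linear_intros)
  also have "\<dots> = sw (\<lambda>a b. e a * frob (S (sw (\<lambda>b1 b2. S b1 * b2) b))) L"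
    by (simp add: sw_apply[OF lin_antipode] antipode_mult sw_apply[OF lin_frob] mult_sw_left)
  also have "\<dots> = sw (\<lambda>a b. counit b * (e a * frob 1)) L"
    by (simp add: sw_antipode_left antipode_scale antipode_one frob_scale mult_ac)
  also have "\<dots> = e L * frob 1"
    by (rule sw_counit_right) (intro linear_intros)
  finally have "frob 1 = ?n * of_int (int r1 - int r2)"
    using n0 by (simp add: trT e_def reg_char_L field_simps)
  then show ?thesis using that by blast
qed

text \<open>
  The square of the antipode has eigenvalues \<open>1\<close> and \<open>-1\<close> only, so its trace \<open>frob 1\<close> is \<open>2 r - n\<close> with
  \<open>0 \<le> r \<le> n\<close>. A nonzero multiple of \<open>n\<close> of this form is \<open>n\<close> or \<open>-n\<close>, and \<open>-n\<close> is impossible because \<open>1\<close> is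
  a fixed point.
\<close>

theorem involutory:
  assumes nz: "frob 1 \<noteq> 0"
  shows "S (S x) = x"
proof -
  let ?n = "card hbasis"
  note S4 = antipode_power_4_trivial[OF nz]
  obtain t where t: "frob 1 = of_nat ?n * of_int t" using frob_one_divisible[OF nz] .
  define Q where "Q x = scale (1/2) (x + S (S x))" for x
  have op: "H.operator (\<lambda>x. x)" "H.operator (\<lambda>x. S (S x))" unfolding H_operator by (intro linear_intros)+
  have opQ: "H.operator Q" unfolding Q_def by (intro H.operator_scale H.operator_add op)
  have half: "scale (1/2) x + scale (1/2) x = x" for x
    by (simp flip: scale_left_distrib)
  have QQ: "Q (Q x) = Q x" for x
  proof -
    have "Q (Q x) = scale (1/2) (Q x + Q x)"
      unfolding Q_def by (simp add: antipode_scale linear_add[OF lin_antipode] S4 add.commute)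
    then show ?thesis by (simp add: scale_right_distrib half)
  qed
  obtain r where r: "H.tr Q = of_nat r" "r \<le> ?n"
    and rn: "r = ?n \<Longrightarrow> \<forall>v\<in>span hbasis. Q v = v" and r0: "r = 0 \<Longrightarrow> \<forall>v\<in>span hbasis. Q v = 0"
    using H.tr_idempotent[OF opQ QQ] by blast
  have "H.tr Q = (of_nat ?n + frob 1) / 2"
    unfolding Q_def frob_one_eq_tr using H.tr_id by (simp add: H.tr_scale H.tr_add H.operator_add op)
  then have "frob 1 = of_int (2 * int r - int ?n)" using r(1) by (simp add: field_simps)
  then have eq: "2 * int r - int ?n = int ?n * t" and "2 * int r - int ?n \<noteq> 0"
  proof -
    assume a: "frob 1 = of_int (2 * int r - int ?n)"
    then have "(of_int (2 * int r - int ?n) :: 'k) = of_int (int ?n * t)" using t by simp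
    then show "2 * int r - int ?n = int ?n * t" by (simp only: of_int_eq_iff)
    show "2 * int r - int ?n \<noteq> 0" using a nz by (metis of_int_0)
  qed
  then have "t \<noteq> 0" by auto
  then consider "t \<ge> 1" | "t \<le> -1" by linarith
  then show ?thesis
  proof cases
    case 1
    then have "int ?n * 1 \<le> int ?n * t" by (intro mult_left_mono) auto
    then have "r = ?n" using eq r(2) by linarith
    then have "scale (1/2) (x + S (S x)) = x" using rn hbasis(3) by (simp add: Q_def)
    then have "scale 2 (scale (1/2) (x + S (S x))) = scale 2 x" by simp
    moreover have "scale 2 x = x + x" using scale_left_distrib[of 1 1 x] by simp
    ultimately show ?thesis by simp
  next
    case 2
    then have "int ?n * t \<le> int ?n * (-1)" by (intro mult_left_mono) auto
    then have "r = 0" using eq by linarith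
    then have "Q 1 = 0" using r0 hbasis(3) by simp
    then have "scale (1/2) (1 + 1) = (0 :: 'h)" by (simp add: Q_def antipode_one)
    then have "(1 :: 'h) = 0" by (simp only: scale_right_distrib half)
    then show ?thesis by simp
  qed
qed

end

section \<open>Irreducible modules\<close>

locale hopf_irreducible =
  hopf_integral scale comult counit antipode L + algebra_module scale scaleV act V
  for scale :: "'k::{alg_closed_field, field_char_0} \<Rightarrow> 'h::ring_1 \<Rightarrow> 'h"
    and comult :: "'h \<Rightarrow> ('h \<times> 'h) list" and counit :: "'h \<Rightarrow> 'k" and antipode :: "'h \<Rightarrow> 'h"
    and L :: 'h
    and scaleV :: "'k \<Rightarrow> 'v::ab_group_add \<Rightarrow> 'v" and act :: "'h \<Rightarrow> 'v \<Rightarrow> 'v" and V :: "'v set" +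
  fixes BV :: "'v set"
  assumes finite_BV: "finite BV" and independent_BV: "vs.independent BV" and span_BV: "vs.span BV = V"
    and irreducible: "irreducible_module"
begin

sublocale V: finite_basis scaleV BV
  by unfold_locales (simp_all add: finite_BV independent_BV)

lemma V_operatorI:
  assumes "\<And>v. v \<in> V \<Longrightarrow> f v \<in> V"
    and "\<And>v w. v \<in> V \<Longrightarrow> w \<in> V \<Longrightarrow> f (v + w) = f v + f w"
    and "\<And>c v. v \<in> V \<Longrightarrow> f (scaleV c v) = scaleV c (f v)"
  shows "V.operator f"
  using assms by (auto simp: V.operator_def span_BV)

lemma V_operatorD:
  assumes "V.operator f" "v \<in> V"
  shows "f v \<in> V" "w \<in> V \<Longrightarrow> f (v + w) = f v + f w" "f (scaleV c v) = scaleV c (f v)"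
  using assms by (auto simp: V.operator_def span_BV)

lemma operator_act: "V.operator (act h)"
  by (rule V_operatorI) (simp_all add: act_closed act_add_right act_scale_right)

lemma V_closed: "v \<in> V \<Longrightarrow> w \<in> V \<Longrightarrow> v + w \<in> V" "v \<in> V \<Longrightarrow> scaleV c v \<in> V" "0 \<in> V"
  using subspace_carrier by (simp_all add: vs.subspace_add vs.subspace_scale vs.subspace_0)

lemma BV_in: "b \<in> BV \<Longrightarrow> b \<in> V"
  using V.basis_in_span by (simp add: span_BV)

lemma BV_nonempty: "BV \<noteq> {}"
  using irreducible span_BV unfolding irreducible_module_def by auto

definition b0 :: 'v where "b0 = (SOME b. b \<in> BV)"

lemma b0: "b0 \<in> BV" "b0 \<in> V" "b0 \<noteq> 0"
proof -
  show b: "b0 \<in> BV" using BV_nonempty unfolding b0_def by (simp add: some_in_eq)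
  show "b0 \<in> V" by (rule BV_in[OF b])
  show "b0 \<noteq> 0" using b independent_BV vs.dependent_zero[of BV] by auto
qed

lemma schur:
  assumes f: "V.operator f" and comm: "\<And>h v. v \<in> V \<Longrightarrow> f (act h v) = act h (f v)"
  obtains s where "\<And>v. v \<in> V \<Longrightarrow> f v = scaleV s v"
proof -
  obtain c v where cv: "v \<in> V" "v \<noteq> 0" "f v = scaleV c v"
    using exists_eigenvector[OF V.finite_basis_axioms BV_nonempty f] by (metis span_BV)
  define U where "U = {u \<in> V. f u = scaleV c u}"
  have "submodule U"
    unfolding submodule_def
  proof (intro conjI allI ballI)
    show "vs.subspace U"
      unfolding U_def
      by (rule vs.subspaceI)
        (auto simp: V_closed V_operatorD[OF f] vs.scale_right_distrib V.operator_zero[OF f] mult.commute)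
    show "act h u \<in> U" if "u \<in> U" for h u
      using that by (auto simp: U_def act_closed comm act_scale_right)
  qed (auto simp: U_def)
  moreover have "U \<noteq> {0}" using cv by (auto simp: U_def)
  ultimately have "U = V" using irreducible unfolding irreducible_module_def by blast
  then show ?thesis using that unfolding U_def by blast
qed

lemma linear_act [linear_intros]: "w \<in> V \<Longrightarrow> lin s scale g \<Longrightarrow> lin s scaleV (\<lambda>a. act (g a) w)"
  using vs.vector_space_axioms by (simp add: Vector_Spaces.linear_iff act_add_left act_scale_left)

lemma linear_functional_act [linear_intros]:
  assumes "V.functional f" "w \<in> V" "lin s scale g"
  shows "lin s (*) (\<lambda>a. f (act (g a) w))"
  using assms vector_space_field
  by (auto simp: Vector_Spaces.linear_iff act_add_left act_scale_left V.functional_def span_BV act_closed)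

lemma vector_space_V [linear_intros]: "vector_space scaleV" by (rule vs.vector_space_axioms)

lemma operator_sw: "V.operator f \<Longrightarrow> (\<And>a b. F a b \<in> V) \<Longrightarrow> f (sw F x) = sw (\<lambda>a b. f (F a b)) x"
  using V.operator_sum_list_arg[of f "\<lambda>(a, b). F a b" "comult x"]
  by (auto simp: sw_def span_BV case_prod_unfold)

lemma functional_sw: "V.functional f \<Longrightarrow> (\<And>a b. F a b \<in> V) \<Longrightarrow> f (sw F x) = sw (\<lambda>a b. f (F a b)) x"
  using V.functional_sum_list_arg[of f "\<lambda>(a, b). F a b" "comult x"]
  by (auto simp: sw_def span_BV case_prod_unfold)

lemma operator_sw_fun:
  assumes "\<And>a b. V.operator (G a b)" shows "V.operator (\<lambda>v. sw (\<lambda>a b. G a b v) x)"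
  unfolding sw_def case_prod_unfold by (rule V.operator_sum_list) (rule assms)

lemma act_sw: "w \<in> V \<Longrightarrow> act (sw F x) w = sw (\<lambda>a b. act (F a b) w) x"
  by (rule sw_apply[OF linear_act[OF _ linear_var]])

text \<open>
  The operator \<open>c\<close> such that averaging an operator \<open>X\<close> over the Casimir element gives the scalar
  \<open>tr(c X)\<close>. Its definition reads off the matrix entries of \<open>c\<close> from the averages of rank one operators.
\<close>

definition twist :: "'v \<Rightarrow> 'v" where
  "twist v = sw (\<lambda>a b. scaleV (V.coord (act a v) b0) (act (S b) b0)) L"

lemma operator_twist: "V.operator twist"
  unfolding twist_def
  by (intro operator_sw_fun V.operator_scale_functional[where p="\<lambda>v. V.coord (act _ v) b0"]
      V.functional_comp[OF V.functional_coord] operator_act)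
    (simp add: span_BV act_closed b0)

lemma functional_scale: "V.functional f \<Longrightarrow> w \<in> V \<Longrightarrow> f (scaleV c w) = c * f w"
  by (simp add: V.functional_def span_BV)

text \<open>
  The left hand side is the average over the Casimir element of the operator \<open>u \<mapsto> f(u) v\<close>, applied to \<open>w\<close>.
  By \<open>casimir\<close> it is an endomorphism of the module, hence a scalar, and the coordinate at \<open>b0\<close> of its value
  at \<open>b0\<close> identifies the scalar.
\<close>

lemma schur_orthogonality:
  assumes f: "V.functional f" and v: "v \<in> V" and w: "w \<in> V"
  shows "sw (\<lambda>a b. scaleV (f (act (S b) w)) (act a v)) L = scaleV (f (twist v)) w"
proof -
  define \<Phi> where "\<Phi> w = sw (\<lambda>a b. scaleV (f (act (S b) w)) (act a v)) L" for w
  have op: "V.operator \<Phi>"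
    unfolding \<Phi>_def
    by (intro operator_sw_fun V.operator_scale_functional[where p="\<lambda>w. f (act _ w)"]
      V.functional_comp[OF f] operator_act) (simp add: span_BV act_closed v)
  have "\<Phi> (act h w) = act h (\<Phi> w)" if w: "w \<in> V" for h w
  proof -
    have "\<Phi> (act h w) = sw (\<lambda>a b. scaleV (f (act (S b * h) w)) (act a v)) L"
      by (simp add: \<Phi>_def act_mult w)
    also have "\<dots> = sw (\<lambda>a b. scaleV (f (act (S b) w)) (act (h * a) v)) L"
      by (rule casimir[where t=scaleV, symmetric]) (intro linear_intros f v w)
    also have "\<dots> = act h (\<Phi> w)"
      unfolding \<Phi>_def by (subst operator_sw[OF operator_act])
        (simp_all add: act_mult v act_scale_right act_closed V_closed)
    finally show ?thesis .
  qed
  from schur[OF op this] obtain s where s: "\<And>v. v \<in> V \<Longrightarrow> \<Phi> v = scaleV s v" by blast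
  have "s = V.coord (\<Phi> b0) b0"
    using s[OF b0(2)] functional_scale[OF V.functional_coord b0(2)] V.coord_basis[OF b0(1)] by simp
  also have "\<dots> = sw (\<lambda>a b. f (act (S b) b0) * V.coord (act a v) b0) L"
    unfolding \<Phi>_def
    by (subst functional_sw[OF V.functional_coord])
      (simp_all add: act_closed V_closed b0 v functional_scale[OF V.functional_coord])
  also have "\<dots> = f (twist v)"
    unfolding twist_def
    by (subst functional_sw[OF f])
      (simp_all add: act_closed V_closed b0 v functional_scale[OF f] mult.commute)
  finally show ?thesis using s[OF w] unfolding \<Phi>_def by simp
qed

lemma V_expand: "v \<in> V \<Longrightarrow> (\<Sum>b\<in>BV. scaleV (V.coord v b) b) = v"
  using V.coord_expand by (simp add: span_BV)

lemma operator_V_expand: "V.operator f \<Longrightarrow> v \<in> V \<Longrightarrow> (\<Sum>b\<in>BV. scaleV (V.coord v b) (f b)) = f v"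
  using V.operator_expand by (simp add: span_BV)

lemma average_operator:
  assumes X: "V.operator X" and w: "w \<in> V"
  shows "sw (\<lambda>a b. act a (X (act (S b) w))) L = scaleV (V.tr (\<lambda>v. twist (X v))) w"
proof -
  have "sw (\<lambda>a b. act a (X (act (S b) w))) L =
    sw (\<lambda>a b. \<Sum>e\<in>BV. scaleV (V.coord (act (S b) w) e) (act a (X e))) L"
    by (intro sw_cong operator_V_expand[OF V.operator_comp[OF operator_act X], symmetric])
      (simp add: act_closed w)
  also have "\<dots> = (\<Sum>e\<in>BV. scaleV (V.coord (twist (X e)) e) w)"
    unfolding sw_sum
    by (intro sum.cong refl schur_orthogonality V.functional_coord w V_operatorD(1)[OF X] BV_in)
  also have "\<dots> = scaleV (V.tr (\<lambda>v. twist (X v))) w"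
    by (simp add: V.tr_def vs.scale_sum_left)
  finally show ?thesis .
qed

text \<open>
  Average the identity operator and use \<open>\<Lambda>\<^sub>1 S(\<Lambda>\<^sub>2) = 1\<close>.
\<close>

lemma tr_twist: "V.tr twist = 1"
proof -
  have "scaleV (V.tr twist) b0 = sw (\<lambda>a b. act a (act (S b) b0)) L"
    using average_operator[OF V.operator_id b0(2)] by simp
  also have "\<dots> = act (sw (\<lambda>a b. a * S b) L) b0"
    by (simp add: act_sw b0 act_mult)
  also have "\<dots> = scaleV 1 b0"
    by (simp add: sw_antipode_right counit_L act_one b0)
  finally show ?thesis using b0(3) vs.scale_cancel_right by blast
qed

lemma V_eqI: "v \<in> V \<Longrightarrow> w \<in> V \<Longrightarrow> (\<And>b. V.coord v b = V.coord w b) \<Longrightarrow> v = w"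
  using V.coord_eqI by (simp add: span_BV)

text \<open>
  The operator \<open>twist\<close> intertwines the module with its pullback along the square of the antipode.
\<close>

lemma twist_act:
  assumes v: "v \<in> V"
  shows "twist (act h v) = act (S (S h)) (twist v)"
proof (rule V_eqI)
  show "twist (act h v) \<in> V" "act (S (S h)) (twist v) \<in> V"
    by (simp_all add: v V_operatorD[OF operator_twist] act_closed)
  fix e
  let ?f = "\<lambda>v. V.coord v e"
  have f: "V.functional ?f" by (rule V.functional_coord)
  have f': "V.functional (\<lambda>v. ?f (act (S (S h)) v))" by (rule V.functional_comp[OF f operator_act])
  have "scaleV (?f (twist (act h v))) b0 = sw (\<lambda>a b. scaleV (?f (act (S b) b0)) (act (a * h) v)) L"
    using schur_orthogonality[OF f act_closed[OF v] b0(2)] by (simp add: act_mult v)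
  also have "\<dots> = sw (\<lambda>a b. scaleV (?f (act (S (S h) * S b) b0)) (act a v)) L"
    by (rule casimir_twisted[where t=scaleV]) (intro linear_intros f v b0)
  also have "\<dots> = scaleV (?f (act (S (S h)) (twist v))) b0"
    using schur_orthogonality[OF f' v b0(2)] by (simp add: act_mult b0)
  finally show "?f (twist (act h v)) = ?f (act (S (S h)) (twist v))"
    using b0(3) vs.scale_cancel_right by blast
qed

text \<open>
  Averaging over the inner copy of \<open>\<Lambda>\<close> produces the scalar \<open>tr(c S(\<Lambda>\<^sub>2))\<close>, and orthogonality for the outer
  copy turns the sum of \<open>tr(c S(\<Lambda>\<^sub>2)) \<Lambda>\<^sub>1\<close> into \<open>c\<^sup>2\<close>.
\<close>

lemma act_casimir_square:
  assumes w: "w \<in> V"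
  shows "act (sw (\<lambda>a1 a2. sw (\<lambda>b1 b2. a1 * b1 * S a2 * S b2) L) L) w = twist (twist w)"
proof -
  have "act (sw (\<lambda>a1 a2. sw (\<lambda>b1 b2. a1 * b1 * S a2 * S b2) L) L) w =
    sw (\<lambda>a1 a2. act a1 (sw (\<lambda>b1 b2. act b1 (act (S a2) (act (S b2) w))) L)) L"
    by (simp add: act_sw w act_mult act_closed operator_sw[OF operator_act])
  also have "\<dots> = sw (\<lambda>a1 a2. act a1 (scaleV (V.tr (\<lambda>v. twist (act (S a2) v))) w)) L"
    by (simp add: average_operator[OF operator_act w])
  also have "\<dots> = sw (\<lambda>a1 a2. \<Sum>e\<in>BV. scaleV (V.coord (twist (act (S a2) e)) e) (act a1 w)) L"
    by (simp add: V.tr_def act_scale_right w flip: vs.scale_sum_left)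
  also have "\<dots> = (\<Sum>e\<in>BV. scaleV (V.coord (twist (twist w)) e) e)"
    unfolding sw_sum
    by (intro sum.cong refl schur_orthogonality[where f="\<lambda>v. V.coord (twist v) _"] w BV_in
        V.functional_comp[OF V.functional_coord operator_twist])
  also have "\<dots> = twist (twist w)"
    by (rule V_expand) (intro V_operatorD(1)[OF operator_twist] w)
  finally show ?thesis .
qed

lemma twist_inj:
  assumes "v \<in> V" "twist v = 0" shows "v = 0"
proof -
  define U where "U = {v \<in> V. twist v = 0}"
  have "submodule U"
    unfolding submodule_def
  proof (intro conjI allI ballI)
    show "vs.subspace U"
      unfolding U_def
      by (rule vs.subspaceI)
        (auto simp: V_closed V_operatorD[OF operator_twist] V.operator_zero[OF operator_twist])
    show "act h u \<in> U" if "u \<in> U" for h u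
      using that V.operator_zero[OF operator_act] by (auto simp: U_def act_closed twist_act)
  qed (auto simp: U_def)
  moreover have "U \<noteq> V"
  proof
    assume "U = V"
    then have "V.tr twist = V.tr (\<lambda>v. scaleV 0 v)" by (intro V.tr_cong) (auto simp: U_def span_BV)
    then show False using V.tr_scale[OF V.operator_id, of 0] by (simp add: tr_twist)
  qed
  ultimately have "U = {0}" using irreducible unfolding irreducible_module_def by blast
  then show ?thesis using assms unfolding U_def by blast
qed

text \<open>
  By Radford's formula, \<open>twist\<close> applied twice and the modular element implement the same automorphism, so
  that they differ by an endomorphism of the module.
\<close>

lemma twist_square:
  obtains s where "s \<noteq> 0" "\<And>v. v \<in> V \<Longrightarrow> twist (twist v) = scaleV s (act modulus v)"
proof -
  have op: "V.operator (\<lambda>v. act (S modulus) (twist (twist v)))"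
    by (intro V.operator_comp[OF operator_act] V.operator_comp[OF operator_twist] operator_twist)
  have tV: "twist v \<in> V" if "v \<in> V" for v using V_operatorD(1)[OF operator_twist that] .
  have g: "S modulus * S (S (S (S h))) = h * S modulus" for h
  proof -
    have "S modulus * S (S (S (S h))) = S modulus * (S (S (S (S h))) * modulus) * S modulus"
      by (simp add: mult.assoc antipode_modulus)
    also have "\<dots> = (S modulus * modulus) * h * S modulus" by (simp add: antipode_power_4 mult.assoc)
    finally show ?thesis by (simp add: antipode_modulus)
  qed
  have "act (S modulus) (twist (twist (act h v))) = act h (act (S modulus) (twist (twist v)))" if "v \<in> V" for h v
    using that by (simp add: twist_act tV g flip: act_mult)
  from schur[OF op this] obtain s where s: "\<And>v. v \<in> V \<Longrightarrow> act (S modulus) (twist (twist v)) = scaleV s v"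
    by blast
  have *: "twist (twist v) = scaleV s (act modulus v)" if v: "v \<in> V" for v
  proof -
    have "twist (twist v) = act modulus (act (S modulus) (twist (twist v)))"
      using v by (simp add: tV antipode_modulus act_one flip: act_mult)
    then show ?thesis using v by (simp add: s act_scale_right)
  qed
  have "s \<noteq> 0"
  proof
    assume "s = 0"
    then have "twist (twist b0) = 0" using *[OF b0(2)] by simp
    then show False using twist_inj tV b0 by metis
  qed
  then show ?thesis using that * by blast
qed

text \<open>
  Dividing \<open>twist\<close> by a square root of the scalar in \<open>twist_square\<close> gives an operator \<open>u\<close> whose square is the
  modular element; hence \<open>u\<close> has finite order. The functional \<open>\<mu>(h) = tr(h c\<^sup>-\<^sup>1)\<close> will turn out to be the block
  \<open>frob(E h)\<close> of the Frobenius form, because it contracts the Casimir element to the identity of the module.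
  Its value at \<open>1\<close> is \<open>tr(c\<^sup>-\<^sup>1) = tr(c) tr(c\<^sup>-\<^sup>1) = tr(u) tr(u\<^sup>-\<^sup>1)\<close> since \<open>tr(c) = 1\<close>.
\<close>

lemma trace_of_twist_inverse:
  assumes N: "N > 0" "modulus ^ N = 1"
  obtains u \<mu> where "V.operator u" "\<And>v. v \<in> V \<Longrightarrow> (u ^^ (2 * N)) v = v"
    "lin scale (*) \<mu>" "\<mu> 1 = V.tr u * V.tr (u ^^ (2 * N - 1))"
    "\<And>h. (\<And>v. v \<in> V \<Longrightarrow> act h v = 0) \<Longrightarrow> \<mu> h = 0"
    "\<And>w. w \<in> V \<Longrightarrow> act (sw (\<lambda>a b. scale (\<mu> a) (S b)) L) w = w"
proof -
  obtain s where s: "s \<noteq> 0" "\<And>v. v \<in> V \<Longrightarrow> twist (twist v) = scaleV s (act modulus v)"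
    using twist_square by blast
  obtain r where r: "r ^ 2 = s" using nth_root_exists[of 2 s] by auto
  with s have r0: "r \<noteq> 0" by auto
  define u where "u v = scaleV (inverse r) (twist v)" for v
  have opu: "V.operator u" unfolding u_def by (rule V.operator_scale[OF operator_twist])
  have tV: "twist v \<in> V" if "v \<in> V" for v using V_operatorD(1)[OF operator_twist that] .
  have twist_u: "twist v = scaleV r (u v)" for v using r0 by (simp add: u_def)
  have rs: "inverse r * inverse r * s = 1"
    using r0 by (simp add: power2_eq_square field_simps flip: r)
  have uu: "u (u v) = act modulus v" if v: "v \<in> V" for v
  proof -
    have "u (u v) = scaleV (inverse r * inverse r) (scaleV s (act modulus v))"
      using v by (simp add: u_def V_operatorD[OF operator_twist] tV s(2))
    also have "\<dots> = act modulus v" using rs by simp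
    finally show ?thesis .
  qed
  have upow: "(u ^^ (2 * i)) v = act (modulus ^ i) v" if v: "v \<in> V" for i v
  proof (induction i)
    case (Suc i)
    have "(u ^^ (2 * Suc i)) v = u (u ((u ^^ (2 * i)) v))" by simp
    also have "\<dots> = act (modulus ^ Suc i) v" using v Suc by (simp add: uu act_closed act_mult)
    finally show ?case .
  qed (simp add: act_one v)
  have uM: "(u ^^ (2 * N)) v = v" if "v \<in> V" for v using upow[OF that] by (simp add: N act_one that)
  \<comment> \<open>\<open>k\<close> is the inverse of \<open>twist\<close>.\<close>
  define k where "k v = scaleV (inverse r) ((u ^^ (2 * N - 1)) v)" for v
  have opk: "V.operator k" unfolding k_def by (intro V.operator_scale V.operator_funpow opu)
  have ck: "twist (k v) = v" if v: "v \<in> V" for v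
  proof -
    have "(u ^^ (2 * N - 1)) v \<in> V" using V_operatorD(1)[OF V.operator_funpow[OF opu] v] .
    then have "twist (k v) = u ((u ^^ (2 * N - 1)) v)"
      unfolding k_def u_def by (simp add: V_operatorD[OF operator_twist])
    also have "\<dots> = (u ^^ Suc (2 * N - 1)) v" by simp
    also have "Suc (2 * N - 1) = 2 * N" using N by simp
    finally show ?thesis using uM[OF v] by simp
  qed
  have tru: "V.tr u = inverse r" unfolding u_def by (simp add: V.tr_scale operator_twist tr_twist)
  have trk: "V.tr k = V.tr u * V.tr (u ^^ (2 * N - 1))"
    unfolding k_def by (simp add: V.tr_scale V.operator_funpow opu tru)
  define \<mu> where "\<mu> h = V.tr (\<lambda>v. act h (k v))" for h
  have kV: "k v \<in> V" if "v \<in> V" for v using V_operatorD(1)[OF opk that] .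
  have l\<mu>: "lin scale (*) \<mu>"
    unfolding \<mu>_def V.tr_def
    by (intro linear_sum_set linear_intros linear_functional_act[OF V.functional_coord]) (auto intro: kV BV_in linear_var)
  have \<mu>0: "\<mu> h = 0" if "\<And>v. v \<in> V \<Longrightarrow> act h v = 0" for h
    unfolding \<mu>_def V.tr_def using that kV BV_in V.functional_zero[OF V.functional_coord] by simp
  have "\<mu> 1 = V.tr k"
    unfolding \<mu>_def by (rule V.tr_cong) (simp add: span_BV act_one kV)
  then have \<mu>1: "\<mu> 1 = V.tr u * V.tr (u ^^ (2 * N - 1))" by (simp add: trk)
  have id: "act (sw (\<lambda>a b. scale (\<mu> a) (S b)) L) w = w" if w: "w \<in> V" for w
  proof (rule V_eqI)
    show "act (sw (\<lambda>a b. scale (\<mu> a) (S b)) L) w \<in> V" "w \<in> V" by (simp_all add: w act_closed)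
    fix e
    let ?f = "\<lambda>v. V.coord v e"
    have f: "V.functional ?f" by (rule V.functional_coord)
    have "?f (act (sw (\<lambda>a b. scale (\<mu> a) (S b)) L) w) = sw (\<lambda>a b. \<mu> a * ?f (act (S b) w)) L"
      by (simp add: act_sw w functional_sw[OF f] act_closed act_scale_left V_closed functional_scale[OF f])
    also have "\<dots> = (\<Sum>x\<in>BV. sw (\<lambda>a b. ?f (act (S b) w) * V.coord (act a (k x)) x) L)"
      unfolding \<mu>_def V.tr_def sum_distrib_right sw_sum by (simp add: mult.commute)
    also have "\<dots> = (\<Sum>x\<in>BV. V.coord w x * ?f x)"
    proof (intro sum.cong refl)
      fix x assume x: "x \<in> BV"
      have kx: "k x \<in> V" using kV BV_in x by blast
      have "sw (\<lambda>a b. ?f (act (S b) w) * V.coord (act a (k x)) x) L =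
        V.coord (sw (\<lambda>a b. scaleV (?f (act (S b) w)) (act a (k x))) L) x"
        by (simp add: functional_sw[OF V.functional_coord] act_closed kx V_closed functional_scale[OF V.functional_coord])
      also have "\<dots> = V.coord w x * ?f x"
        by (simp add: schur_orthogonality[OF f kx w] functional_scale[OF V.functional_coord w] ck BV_in x)
      finally show "sw (\<lambda>a b. ?f (act (S b) w) * V.coord (act a (k x)) x) L = V.coord w x * ?f x" .
    qed
    also have "\<dots> = ?f w"
      using V.functional_expand[OF f, of w] w by (simp add: span_BV)
    finally show "?f (act (sw (\<lambda>a b. scale (\<mu> a) (S b)) L) w) = ?f w" .
  qed
  show ?thesis using that[OF opu uM l\<mu> \<mu>1 \<mu>0 id] by blast
qed

lemma twist_involutory:
  assumes "\<And>x. S (S x) = x" "v \<in> V"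
  shows "twist v = scaleV (1 / of_nat (card BV)) v"
proof -
  have "\<And>h v. v \<in> V \<Longrightarrow> twist (act h v) = act h (twist v)" using twist_act assms(1) by simp
  from schur[OF operator_twist this] obtain s where s: "\<And>v. v \<in> V \<Longrightarrow> twist v = scaleV s v" by blast
  have "V.tr twist = V.tr (\<lambda>v. scaleV s v)" by (rule V.tr_cong) (simp add: s span_BV)
  then have "s * of_nat (card BV) = 1"
    using V.tr_scale[OF V.operator_id, of s] V.tr_id by (simp add: tr_twist)
  moreover have "(of_nat (card BV) :: 'k) \<noteq> 0" using BV_nonempty finite_BV by simp
  ultimately have "s = 1 / of_nat (card BV)" by (simp add: field_simps)
  then show ?thesis using s assms(2) by simp
qed

end

section \<open>Central idempotents of semisimple algebras\<close>

context assoc_algebra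
begin

lemma regular_module: "algebra_module scale scale (*) UNIV"
  by unfold_locales (simp_all add: algebra_simps scale_mult_left scale_mult_right)

definition left_ideal :: "'h set \<Rightarrow> bool" where
  "left_ideal I \<longleftrightarrow> 0 \<in> I \<and> (\<forall>x\<in>I. \<forall>y\<in>I. x + y \<in> I) \<and> (\<forall>h. \<forall>x\<in>I. h * x \<in> I)"

text \<open>
  The component of \<open>1\<close> in the ideal, with respect to a complementary left ideal, is a right identity.
\<close>

lemma left_ideal_right_identity:
  assumes ss: "semisimple_algebra scale" and I: "left_ideal I"
  obtains f where "f \<in> I" "\<And>x. x \<in> I \<Longrightarrow> x * f = x"
proof -
  interpret R: algebra_module scale scale "(*)" UNIV by (rule regular_module)
  have "subspace I"
  proof (rule subspaceI)
    show "scale c x \<in> I" if "x \<in> I" for c x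
    proof -
      have "scale c 1 * x \<in> I" using I that by (simp add: left_ideal_def)
      then show ?thesis by (simp add: scale_mult_left)
    qed
  qed (use I in \<open>simp_all add: left_ideal_def\<close>)
  then have "R.submodule I" using I by (auto simp: R.submodule_def left_ideal_def)
  then have "\<exists>W. R.submodule W \<and> I \<inter> W = {0} \<and> (\<forall>v. \<exists>u\<in>I. \<exists>w\<in>W. v = u + w)"
    using ss unfolding semisimple_algebra_def R.semisimple_module_def by simp
  then obtain W where W: "R.submodule W" "I \<inter> W = {0}" and split: "\<forall>v. \<exists>u\<in>I. \<exists>w\<in>W. v = u + w"
    by (elim exE conjE)
  from split[THEN spec, of 1] obtain f w where f: "f \<in> I" "w \<in> W" "1 = f + w" by (elim bexE)
  have "x * f = x" if x: "x \<in> I" for x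
  proof -
    have "x * 1 = x * f + x * w" unfolding f(3) by (rule distrib_left)
    then have "x * w = x - x * f" by (simp add: algebra_simps)
    moreover have "x * f \<in> I" using f(1) I by (simp add: left_ideal_def)
    ultimately have "x * w \<in> I" using x subspace_diff[OF \<open>subspace I\<close>] by simp
    moreover have "x * w \<in> W" using W(1) f(2) by (simp add: R.submodule_def)
    ultimately have "x * w = 0" using W(2) by blast
    then show ?thesis using \<open>x * w = x - x * f\<close> by simp
  qed
  then show ?thesis using that f(1) by blast
qed

text \<open>
  A right identity \<open>f\<close> of a two-sided ideal \<open>I\<close> is central. The point is that no nonzero \<open>t\<close> in \<open>I\<close> has
  \<open>f t = 0\<close>: such a \<open>t\<close> is annihilated by all of \<open>I\<close>, so the left ideal generated by \<open>t\<close> has square zero,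
  whereas it has a right identity.
\<close>

lemma ideal_central_idempotent:
  assumes ss: "semisimple_algebra scale" and I: "left_ideal I" and right: "\<And>x h. x \<in> I \<Longrightarrow> x * h \<in> I"
  obtains f where "central_idempotent f" "f \<in> I" "\<And>x. x \<in> I \<Longrightarrow> x * f = x"
proof -
  obtain f where f: "f \<in> I" "\<And>x. x \<in> I \<Longrightarrow> x * f = x"
    using left_ideal_right_identity[OF ss I] by blast
  have ff: "f * f = f" using f by blast
  have IM: "h * x \<in> I" if "x \<in> I" for h x using I that by (simp add: left_ideal_def)
  have annih: "t = 0" if t: "t \<in> I" "f * t = 0" for t
  proof -
    have It: "x * t = 0" if "x \<in> I" for x
      using f(2)[OF that] t(2) by (metis mult.assoc mult_zero_right)
    have "left_ideal (range (\<lambda>h. h * t))"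
      unfolding left_ideal_def
    proof (intro conjI ballI allI)
      show "0 \<in> range (\<lambda>h. h * t)" using mult_zero_left[of t] by (metis rangeI)
      show "x + y \<in> range (\<lambda>h. h * t)" if "x \<in> range (\<lambda>h. h * t)" "y \<in> range (\<lambda>h. h * t)" for x y
        using that by (auto simp flip: distrib_right)
      show "h * x \<in> range (\<lambda>h. h * t)" if "x \<in> range (\<lambda>h. h * t)" for h x
        using that by (auto simp flip: mult.assoc)
    qed
    then obtain j where j: "j \<in> range (\<lambda>h. h * t)" "\<And>x. x \<in> range (\<lambda>h. h * t) \<Longrightarrow> x * j = x"
      using left_ideal_right_identity[OF ss] by blast
    have "t \<in> range (\<lambda>h. h * t)" by (metis mult.left_neutral rangeI)
    then have "t = t * j" using j(2) by simp
    also have "\<dots> = 0" using j(1) It right[OF t(1)] by (auto simp flip: mult.assoc)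
    finally show ?thesis .
  qed
  have "f * y = y * f" for y
  proof -
    have 1: "f * y * f = f * y" using f right by blast
    have "y * f - f * y * f \<in> I"
      using IM[OF f(1), of "y - f * y"] by (simp add: algebra_simps)
    moreover have "f * (y * f - f * y * f) = 0"
      by (simp add: right_diff_distrib ff flip: mult.assoc)
    ultimately have "y * f - f * y * f = 0" by (rule annih)
    then show ?thesis using 1 by simp
  qed
  then have "central_idempotent f" using ff unfolding central_idempotent_def center_def by blast
  then show ?thesis using that f by blast
qed

end

lemma central_idempotentD:
  "central_idempotent e \<Longrightarrow> e * x = x * e" "central_idempotent e \<Longrightarrow> e * e = e"
  unfolding central_idempotent_def center_def by blast+

lemma central_idempotentI: "(\<And>x. e * x = x * e) \<Longrightarrow> e * e = e \<Longrightarrow> central_idempotent e"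
  unfolding central_idempotent_def center_def by blast

lemma central_idempotent_mult:
  assumes e: "central_idempotent e" and f: "central_idempotent f" shows "central_idempotent (e * f)"
proof -
  have "e * f * x = x * (e * f)" for x
  proof -
    have "e * f * x = e * (x * f)" by (simp only: mult.assoc central_idempotentD(1)[OF f, of x])
    also have "\<dots> = x * e * f" by (simp only: central_idempotentD(1)[OF e, of x] flip: mult.assoc)
    finally show ?thesis by (simp only: mult.assoc)
  qed
  moreover have "e * f * (e * f) = e * f"
  proof -
    have "e * f * (e * f) = e * (f * e) * f" by (simp only: mult.assoc)
    also have "f * e = e * f" by (rule central_idempotentD(1)[OF f])
    also have "e * (e * f) * f = (e * e) * (f * f)" by (simp only: mult.assoc)
    finally show ?thesis by (simp only: central_idempotentD(2)[OF e] central_idempotentD(2)[OF f])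
  qed
  ultimately show ?thesis by (rule central_idempotentI)
qed

lemma central_idempotent_complement:
  assumes e: "central_idempotent e" shows "central_idempotent (1 - e)"
proof (rule central_idempotentI)
  show "(1 - e) * x = x * (1 - e)" for x
    by (simp add: left_diff_distrib right_diff_distrib central_idempotentD(1)[OF e, of x])
  show "(1 - e) * (1 - e) = 1 - e"
    by (simp add: left_diff_distrib right_diff_distrib central_idempotentD(2)[OF e])
qed

abbreviation "pci \<equiv> primitive_central_idempotents"

lemma pciD: "E \<in> pci \<Longrightarrow> central_idempotent E" "E \<in> pci \<Longrightarrow> E \<noteq> 0"
  by (auto simp: primitive_central_idempotents_def)

lemma pci_mult:
  assumes E: "E \<in> pci" and f: "central_idempotent f"
  shows "E * f = 0 \<or> E * f = E"
proof -
  have "central_idempotent (E * f)" "central_idempotent (E * (1 - f))"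
    using E f by (auto intro: central_idempotent_mult central_idempotent_complement pciD)
  moreover have "E * f * (E * (1 - f)) = 0"
  proof -
    have "E * f * (E * (1 - f)) = E * (f * E) * (1 - f)" by (simp only: mult.assoc)
    also have "f * E = E * f" by (rule central_idempotentD(1)[OF f])
    also have "E * (E * f) * (1 - f) = E * E * (f - f * f)"
      by (simp add: right_diff_distrib mult.assoc)
    finally show ?thesis by (simp add: central_idempotentD(2)[OF f])
  qed
  moreover have "E = E * f + E * (1 - f)" by (simp add: algebra_simps)
  ultimately have "E * f = 0 \<or> E * (1 - f) = 0"
    using E unfolding primitive_central_idempotents_def by blast
  then show ?thesis by (auto simp: algebra_simps)
qed

lemma pci_orthogonal:
  assumes "E \<in> pci" "F \<in> pci" "E \<noteq> F" shows "E * F = 0"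
  using pci_mult[OF assms(1) pciD(1)[OF assms(2)]] pci_mult[OF assms(2) pciD(1)[OF assms(1)]]
    central_idempotentD(1)[OF pciD(1)[OF assms(1)], of F] assms(3) by auto

context hopf_integral
begin

text \<open>
  Descent on the dimension of the ideal generated by the idempotent: a proper decomposition makes it smaller.
\<close>

lemma exists_pci_below:
  fixes f :: 'h
  assumes "central_idempotent f" "f \<noteq> 0"
  obtains E where "E \<in> pci" "E * f = E"
proof -
  have "\<exists>E\<in>pci. E * f = E"
    using assms
  proof (induction "dim (range (\<lambda>x. f * x))" arbitrary: f rule: less_induct)
    case less
    show ?case
    proof (cases "f \<in> pci")
      case True
      then show ?thesis using central_idempotentD(2)[OF less.prems(1)] by blast
    next
      case False
      then obtain g h where gh: "central_idempotent g" "central_idempotent h" "g * h = 0" "f = g + h"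
        "g \<noteq> 0" "h \<noteq> 0"
        using less.prems unfolding primitive_central_idempotents_def by blast
      have sub: "subspace (range (\<lambda>x. c * x))" for c :: 'h
      proof (rule subspaceI)
        show "0 \<in> range (\<lambda>x. c * x)" by (metis mult_zero_right rangeI)
      qed (auto simp flip: distrib_left scale_mult_right)
      have fg: "f * g = g" and fh: "f * h = h"
        using gh(3,4) central_idempotentD(2)[OF gh(1)] central_idempotentD(2)[OF gh(2)]
          central_idempotentD(1)[OF gh(1), of h] by (simp_all add: distrib_right)
      have le: "range (\<lambda>x. g * x) \<subseteq> range (\<lambda>x. f * x)"
      proof
        fix y assume "y \<in> range (\<lambda>x. g * x)"
        then obtain x where "y = g * x" by blast
        then have "y = f * (g * x)" using fg by (simp flip: mult.assoc)
        then show "y \<in> range (\<lambda>x. f * x)" by blast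
      qed
      have "dim (range (\<lambda>x. g * x)) < dim (range (\<lambda>x. f * x))"
      proof (rule ccontr)
        assume "\<not> ?thesis"
        then have "range (\<lambda>x. g * x) = range (\<lambda>x. f * x)"
          using fd.subspace_dim_equal[OF sub sub le] by simp
        then obtain x where x: "h = g * x" using fh by (metis rangeE rangeI)
        have "h * h = h * g * x" using x by (simp add: mult.assoc)
        also have "h * g = 0" using gh(3) central_idempotentD(1)[OF gh(1), of h] by simp
        finally show False using gh(6) central_idempotentD(2)[OF gh(2)] by simp
      qed
      from less.hyps[OF this gh(1,5)] obtain E where E: "E \<in> pci" "E * g = E" by blast
      have "E * f = E * g * f" using E(2) by simp
      also have "\<dots> = E * (f * g)" by (simp only: mult.assoc central_idempotentD(1)[OF gh(1), of f])
      also have "\<dots> = E" by (simp add: fg E(2))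
      finally show ?thesis using E(1) by blast
    qed
  qed
  then show ?thesis using that by blast
qed

lemma finite_pci: "finite (pci :: 'h set)"
proof (rule fd.finiteI_independent)
  show "independent (pci :: 'h set)"
    unfolding independent_explicit_module
  proof (intro allI impI)
    fix t :: "'h set" and u E
    assume t: "finite t" "t \<subseteq> pci" "(\<Sum>v\<in>t. scale (u v) v) = 0" "E \<in> t"
    have "0 = E * (\<Sum>v\<in>t. scale (u v) v)" using t(3) by simp
    also have "\<dots> = (\<Sum>v\<in>t. if v = E then scale (u E) E else 0)"
      unfolding sum_distrib_left
    proof (intro sum.cong refl)
      fix v assume v: "v \<in> t"
      have "E * v = (if v = E then E else 0)"
        using pci_orthogonal[of E v] central_idempotentD(2)[OF pciD(1)] t v by auto
      then show "E * scale (u v) v = (if v = E then scale (u E) E else 0)"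
        by (simp add: scale_mult_right)
    qed
    also have "\<dots> = scale (u E) E" using t by simp
    finally show "u E = 0" using pciD(2)[of E] t by auto
  qed
qed

lemma pci_mult_sum:
  assumes E: "E \<in> pci" shows "E * (\<Sum>F\<in>pci. scale (c F) F) = scale (c E) E"
proof -
  have "E * (\<Sum>F\<in>pci. scale (c F) F) = (\<Sum>F\<in>pci. if F = E then scale (c E) E else 0)"
    unfolding sum_distrib_left
    by (intro sum.cong refl)
      (use pci_orthogonal[OF E] central_idempotentD(2)[OF pciD(1)[OF E]] in \<open>auto simp: scale_mult_right\<close>)
  then show ?thesis using E finite_pci by simp
qed

lemma center_sum: "(\<Sum>F\<in>pci. scale (c F) F) \<in> center"
proof -
  have "(\<Sum>F\<in>pci. scale (c F) F) * x = x * (\<Sum>F\<in>pci. scale (c F) F)" for x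
    unfolding sum_distrib_left sum_distrib_right scale_mult_left scale_mult_right
  proof (intro sum.cong refl)
    fix F :: 'h assume "F \<in> pci"
    from central_idempotentD(1)[OF pciD(1)[OF this], of x]
    show "scale (c F) (F * x) = scale (c F) (x * F)" by (rule arg_cong)
  qed
  then show ?thesis unfolding center_def by blast
qed

text \<open>
  A primitive idempotent below the complement of the sum would be orthogonal to itself.
\<close>

lemma sum_pci: "(\<Sum>E\<in>pci. E :: 'h) = 1"
proof (rule ccontr)
  assume ne: "(\<Sum>E\<in>pci. E :: 'h) \<noteq> 1"
  define s where "s = (\<Sum>E\<in>pci. E :: 'h)"
  have Es: "E * s = E" if "E \<in> pci" for E
    using pci_mult_sum[OF that, of "\<lambda>_. 1"] by (simp add: s_def)
  have "s * s = (\<Sum>E\<in>pci. E * s)" unfolding s_def by (rule sum_distrib_right)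
  also have "\<dots> = s" unfolding s_def[symmetric] using Es by (subst (2) s_def) (rule sum.cong, simp_all)
  finally have ss: "s * s = s" .
  have "s \<in> center" using center_sum[of "\<lambda>_. 1"] by (simp add: s_def)
  with ss have "central_idempotent s" unfolding central_idempotent_def by blast
  then have "central_idempotent (1 - s)" by (rule central_idempotent_complement)
  moreover have "1 - s \<noteq> 0" using ne by (simp add: s_def)
  ultimately obtain E where E: "E \<in> pci" "E * (1 - s) = E" using exists_pci_below by blast
  then show False using Es[OF E(1)] pciD(2)[OF E(1)] by (simp add: right_diff_distrib)
qed

lemma integral_primitive: "L \<in> pci"
proof -
  have "L * L = L" by (simp add: L_left counit_L)
  moreover have "L \<noteq> 0" using counit_L counit_scale[of 0 0] by auto
  moreover have "f = 0 \<or> g = 0" if "central_idempotent f" "central_idempotent g" "f * g = 0" "L = f + g" for f g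
  proof -
    have "f * L = f" "g * L = g"
      unfolding that(4) distrib_left
      using that(3) central_idempotentD(2)[OF that(1)] central_idempotentD(2)[OF that(2)]
        central_idempotentD(1)[OF that(1), of g] by simp_all
    then have fg: "f = scale (counit f) L" "g = scale (counit g) L"
      using L_left[of f] L_left[of g] by simp_all
    have "scale a L * scale b L = scale (a * b) L" for a b
      by (simp add: scale_mult_left scale_mult_right L_left counit_L counit_scale mult.commute)
    from this[of "counit f" "counit g"] have "f * g = scale (counit f * counit g) L"
      by (simp only: fg[symmetric])
    then have "counit f = 0 \<or> counit g = 0" using that(3) \<open>L \<noteq> 0\<close> by simp
    then show ?thesis using fg(1)[symmetric] fg(2)[symmetric] by auto
  qed
  moreover have "central_idempotent L"
    by (rule central_idempotentI) (simp_all add: L_left L_right counit_L)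
  ultimately show ?thesis unfolding primitive_central_idempotents_def by blast
qed

text \<open>
  An irreducible module is generated by any nonzero vector, hence is a quotient of \<open>H\<close>.
\<close>

lemma irreducible_finite_basis:
  assumes "algebra_module scale scaleV act V" "algebra_module.irreducible_module scaleV act V"
  obtains BV where "finite BV" "\<not> module.dependent scaleV BV" "module.span scaleV BV = V"
    "card BV = vector_space.dim scaleV V"
proof -
  interpret M: algebra_module scale scaleV act V by fact
  obtain BV where BV: "BV \<subseteq> V" "M.vs.independent BV" "V \<subseteq> M.vs.span BV" "card BV = M.vs.dim V"
    using M.vs.basis_exists by blast
  have "V \<noteq> {0}" and irr: "\<And>U. M.submodule U \<Longrightarrow> U = {0} \<or> U = V"
    using assms(2) unfolding M.irreducible_module_def by blast+
  moreover have "0 \<in> V" using M.vs.subspace_0[OF M.subspace_carrier] .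
  ultimately obtain v where v: "v \<in> V" "v \<noteq> 0" by auto
  have l: "lin scale scaleV (\<lambda>h. act h v)"
    using M.vs.vector_space_axioms by (simp add: Vector_Spaces.linear_iff vs M.act_add_left M.act_scale_left v)
  define U where "U = range (\<lambda>h. act h v)"
  have "M.submodule U"
    unfolding M.submodule_def
  proof (intro conjI allI ballI)
    show "M.vs.subspace U"
    proof (rule M.vs.subspaceI)
      show "0 \<in> U" unfolding U_def using linear_scale_apply[OF l, of 0 0] by (metis M.vs.scale_zero_left rangeI)
    qed (auto simp: U_def simp flip: linear_add[OF l] linear_scale_apply[OF l])
    show "U \<subseteq> V" by (auto simp: U_def M.act_closed v)
    show "act h u \<in> U" if "u \<in> U" for h u
      using that by (auto simp: U_def v simp flip: M.act_mult)
  qed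
  moreover have "v \<in> U" unfolding U_def by (metis M.act_one rangeI v(1))
  ultimately have UV: "U = V" using irr v(2) by blast
  have "V \<subseteq> M.vs.span ((\<lambda>e. act e v) ` hbasis)"
  proof
    fix w assume "w \<in> V"
    then obtain h where "w = act h v" using UV unfolding U_def by blast
    then have "w = act (\<Sum>e\<in>hbasis. scale (H.coord h e) e) v" by (simp only: H_expand)
    also have "\<dots> = (\<Sum>e\<in>hbasis. scaleV (H.coord h e) (act e v))"
      by (simp add: linear_sum_apply[OF l] linear_scale_apply[OF l])
    also have "\<dots> \<in> M.vs.span ((\<lambda>e. act e v) ` hbasis)"
      by (intro M.vs.span_sum M.vs.span_scale M.vs.span_base) auto
    finally show "w \<in> M.vs.span ((\<lambda>e. act e v) ` hbasis)" .
  qed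
  then have "finite BV"
    using M.vs.independent_span_bound[OF _ BV(2)] BV(1) hbasis(1) by (meson finite_imageI order_trans)
  then show ?thesis using that BV M.vs.span_subspace[OF BV(1,3) M.subspace_carrier] by blast
qed

end

section \<open>The antipode of a semisimple Hopf algebra and the sum over blocks\<close>

locale semisimple_hopf_modules = hopf_integral scale comult counit antipode L
  for scale :: "'k::{alg_closed_field, field_char_0} \<Rightarrow> 'h::ring_1 \<Rightarrow> 'h"
    and comult :: "'h \<Rightarrow> ('h \<times> 'h) list" and counit :: "'h \<Rightarrow> 'k" and antipode :: "'h \<Rightarrow> 'h"
    and L :: 'h +
  fixes scaleV :: "'k \<Rightarrow> 'v::ab_group_add \<Rightarrow> 'v"
    and act :: "'h \<Rightarrow> 'h \<Rightarrow> 'v \<Rightarrow> 'v"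
    and V :: "'h \<Rightarrow> 'v set"
  assumes semisimple: "semisimple_algebra scale"
    and module: "\<And>E. E \<in> pci \<Longrightarrow> algebra_module scale scaleV (act E) (V E)"
    and irreducible: "\<And>E. E \<in> pci \<Longrightarrow> algebra_module.irreducible_module scaleV (act E) (V E)"
    and act_self: "\<And>E v. E \<in> pci \<Longrightarrow> v \<in> V E \<Longrightarrow> act E E v = v"
begin

lemma act_other:
  assumes "E \<in> pci" "F \<in> pci" "E \<noteq> F" "v \<in> V E" shows "act E F v = 0"
proof -
  interpret M: algebra_module scale scaleV "act E" "V E" using module assms by blast
  have "act E F v = act E F (act E E v)" using act_self assms by simp
  also have "\<dots> = act E (F * E) v" using assms by (simp add: M.act_mult)
  also have "\<dots> = act E (scale 0 0) v" using pci_orthogonal[of F E] assms by simp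
  finally show ?thesis using assms by (simp only: M.act_scale_left M.vs.scale_zero_left)
qed

text \<open>
  The common annihilator of the modules is a two-sided ideal. If it were nonzero, it would contain some
  primitive central idempotent \<open>E\<close>, which acts as the identity on its own module.
\<close>

lemma modules_faithful:
  assumes "\<And>E v. E \<in> pci \<Longrightarrow> v \<in> V E \<Longrightarrow> act E h v = 0"
  shows "h = 0"
proof -
  define I where "I = {x. \<forall>E\<in>pci. \<forall>v\<in>V E. act E x v = 0}"
  have "left_ideal I" and right: "\<And>x h. x \<in> I \<Longrightarrow> x * h \<in> I"
  proof -
    have 0: "act E 0 v = 0" "act E (x + y) v = act E x v + act E y v" "act E (x * y) v = act E x (act E y v)"
       "act E x 0 = 0" "act E x v \<in> V E"
      if "E \<in> pci" "v \<in> V E" for E x y v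
    proof -
      interpret M: algebra_module scale scaleV "act E" "V E" using module that by blast
      show "act E 0 v = 0" using M.act_scale_left[OF that(2), of 0 0] by simp
      show "act E x 0 = 0"
        using M.act_scale_right[of 0 x 0] M.vs.subspace_0[OF M.subspace_carrier] by simp
      show "act E (x + y) v = act E x v + act E y v" "act E (x * y) v = act E x (act E y v)" "act E x v \<in> V E"
        using that(2) by (simp_all add: M.act_add_left M.act_mult M.act_closed)
    qed
    show "left_ideal I" unfolding left_ideal_def I_def by (auto simp: 0)
    show "x * h \<in> I" if "x \<in> I" for x h using that unfolding I_def by (auto simp: 0)
  qed
  then obtain f where f: "central_idempotent f" "f \<in> I" "\<And>x. x \<in> I \<Longrightarrow> x * f = x"
    using ideal_central_idempotent[OF semisimple] by metis
  have "f = 0"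
  proof (rule ccontr)
    assume "f \<noteq> 0"
    then obtain E where E: "E \<in> pci" "E * f = E" using exists_pci_below[OF f(1)] by blast
    then have "E \<in> I" using f(2) \<open>left_ideal I\<close> by (metis left_ideal_def)
    then have "V E \<subseteq> {0}" using act_self[OF E(1)] E(1) unfolding I_def by force
    interpret M: algebra_module scale scaleV "act E" "V E" using module E by blast
    show False using \<open>V E \<subseteq> {0}\<close> irreducible[OF E(1)] M.vs.subspace_0[OF M.subspace_carrier]
      unfolding M.irreducible_module_def by blast
  qed
  moreover have "h \<in> I" using assms unfolding I_def by blast
  ultimately show ?thesis using f(3) by fastforce
qed

lemma irreducible_instance:
  assumes E: "E \<in> pci"
  obtains BV where "hopf_irreducible scale comult counit antipode L scaleV (act E) (V E) BV"
    "card BV = vector_space.dim scaleV (V E)"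
proof -
  interpret M: algebra_module scale scaleV "act E" "V E" using module E by blast
  obtain BV where BV: "finite BV" "\<not> module.dependent scaleV BV" "module.span scaleV BV = V E"
    "card BV = vector_space.dim scaleV (V E)"
    using irreducible_finite_basis[OF module[OF E] irreducible[OF E]] .
  have "hopf_irreducible scale comult counit antipode L scaleV (act E) (V E) BV"
    using BV irreducible[OF E] by unfold_locales auto
  then show ?thesis using that BV by blast
qed

text \<open>
  The functional \<open>\<mu>\<close> of \<open>trace_of_twist_inverse\<close> contracts the Casimir element to an element that acts as the
  identity on the module of \<open>E\<close> and as zero on the others, so to \<open>E\<close>. The functional \<open>frob(E \<cdot> _)\<close> has the same
  contraction, and the two agree at \<open>1\<close>.
\<close>

lemma frob_block:
  fixes z :: 'k
  assumes E: "E \<in> pci" and N: "N > 0" "modulus ^ N = 1"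
    and z: "z ^ (2 * N) = 1" "\<And>l. 0 < l \<Longrightarrow> l < 2 * N \<Longrightarrow> z ^ l \<noteq> 1"
  obtains m :: "nat \<Rightarrow> nat" where
    "frob E = (\<Sum>l<2*N. of_nat (m l) * z ^ l) * (\<Sum>l<2*N. of_nat (m l) * z ^ (l * (2 * N - 1)))"
proof -
  obtain BV where "hopf_irreducible scale comult counit antipode L scaleV (act E) (V E) BV"
    using irreducible_instance[OF E] .
  then interpret M: hopf_irreducible scale comult counit antipode L scaleV "act E" "V E" BV .
  obtain u \<mu> where u: "M.V.operator u" "\<And>v. v \<in> V E \<Longrightarrow> (u ^^ (2 * N)) v = v"
    and \<mu>: "lin scale (*) \<mu>" "\<mu> 1 = M.V.tr u * M.V.tr (u ^^ (2 * N - 1))"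
      "\<And>h. (\<And>v. v \<in> V E \<Longrightarrow> act E h v = 0) \<Longrightarrow> \<mu> h = 0"
      "\<And>w. w \<in> V E \<Longrightarrow> act E (sw (\<lambda>a b. scale (\<mu> a) (S b)) L) w = w"
    by (rule M.trace_of_twist_inverse[OF N]) blast
  obtain m :: "nat \<Rightarrow> nat" where m: "\<And>j. M.V.tr (u ^^ j) = (\<Sum>l<2*N. of_nat (m l) * z ^ (l * j))"
    using M.V.tr_funpow_torsion[of "2 * N" z u] N z u by (auto simp: M.span_BV)
  define y where "y = sw (\<lambda>a b. scale (\<mu> a) (S b)) L"
  have yF: "y * F = 0" if F: "F \<in> pci" "F \<noteq> E" for F
  proof -
    have l\<mu> [linear_intros]: "lin s (*) (\<lambda>a. \<mu> (f a))" if "lin s scale f" for s :: "'k \<Rightarrow> 'x::ab_group_add \<Rightarrow> 'x" and f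
      using linear_comp[OF \<mu>(1) that] .
    have "y * F = sw (\<lambda>a b. scale (\<mu> a) (S b * F)) L"
      by (simp add: y_def mult_sw_right scale_mult_left)
    also have "\<dots> = sw (\<lambda>a b. scale (\<mu> (F * a)) (S b)) L"
      by (rule casimir[where t=scale, symmetric]) (intro linear_intros)
    also have "\<dots> = sw (\<lambda>a b. 0) L"
    proof (rule sw_cong)
      fix a b
      have "\<mu> (F * a) = 0"
        by (rule \<mu>(3)) (use E F act_other in \<open>simp add: M.act_mult M.act_closed\<close>)
      then show "scale (\<mu> (F * a)) (S b) = 0" by simp
    qed
    finally show ?thesis by (simp add: sw_def case_prod_unfold)
  qed
  have "y - E = 0"
  proof (rule modules_faithful)
    fix F v assume F: "F \<in> pci" "v \<in> V F"
    interpret MF: algebra_module scale scaleV "act F" "V F" using module F by blast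
    have 0: "act F 0 v = 0" using MF.act_scale_left[OF F(2), of 0 0] by simp
    have "act F y v = act F E v"
    proof (cases "F = E")
      case True
      then show ?thesis using \<mu>(4) act_self F by (simp add: y_def)
    next
      case False
      have "act F y v = act F (y * F) v" using F act_self by (simp add: MF.act_mult)
      then show ?thesis using False F yF act_other E by (simp add: 0)
    qed
    moreover have "act F (y - E) v + act F E v = act F y v"
      using F by (simp flip: MF.act_add_left)
    ultimately show "act F (y - E) v = 0" by simp
  qed
  then have yE: "y = E" by simp
  have "\<mu> 1 = frob (E * 1)"
  proof (rule casimir_unique[OF \<mu>(1)])
    show "sw (\<lambda>a b. scale (\<mu> a) (S b)) L = sw (\<lambda>a b. scale (frob (E * a)) (S b)) L"
      using yE frob_dual[of E] by (simp add: y_def)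
  qed (intro linear_intros)
  then have "frob E = M.V.tr (u ^^ 1) * M.V.tr (u ^^ (2 * N - 1))" using \<mu>(2) by simp
  then show ?thesis using that[of m] by (simp only: m mult_1_right)
qed

text \<open>
  The block of \<open>\<Lambda>\<close> contributes \<open>1\<close>, and every other block a product \<open>tr(u) tr(u\<^sup>-\<^sup>1)\<close>, which is the square
  of an absolute value when the roots of unity are read as complex numbers.
\<close>

lemma frob_one_nonzero: "frob 1 \<noteq> 0"
proof -
  obtain N where N: "N > 0" "modulus ^ N = 1" using modulus_finite_order .
  then have M: "2 * N > 0" by simp
  obtain z :: 'k where z: "z ^ (2 * N) = 1" "\<And>l. 0 < l \<Longrightarrow> l < 2 * N \<Longrightarrow> z ^ l \<noteq> 1"
    and pos: "\<And>A (m :: 'h \<Rightarrow> nat \<Rightarrow> nat). 1 + (\<Sum>a\<in>A. (\<Sum>l<2*N. of_nat (m a l) * z ^ l) *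
       (\<Sum>l<2*N. of_nat (m a l) * z ^ (l * (2 * N - 1)))) \<noteq> 0"
    by (rule root_of_unity_positivity[OF M]) blast
  define absq where "absq m = (\<Sum>l<2*N. of_nat (m l) * z ^ l) *
      (\<Sum>l<2*N. of_nat (m l) * z ^ (l * (2 * N - 1)))" for m :: "nat \<Rightarrow> nat"
  have "\<exists>m. frob E = absq m" if E: "E \<in> pci" for E :: 'h
  proof -
    obtain m where "frob E = absq m" unfolding absq_def using frob_block[OF E N z] by blast
    then show ?thesis by blast
  qed
  then obtain m where m: "\<And>E. E \<in> pci \<Longrightarrow> frob E = absq (m E)" by metis
  have "frob 1 = (\<Sum>E\<in>pci. frob E)"
    using linear_sum_apply[OF lin_frob, of "\<lambda>E. E" pci] by (simp add: sum_pci)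
  also have "\<dots> = frob L + (\<Sum>E\<in>pci - {L}. frob E)"
    using finite_pci integral_primitive by (rule sum.remove)
  also have "\<dots> = 1 + (\<Sum>E\<in>pci - {L}. absq (m E))"
    unfolding frob_L by (intro arg_cong2[of _ _ _ _ "(+)"] sum.cong) (auto simp: m)
  finally show ?thesis using pos[of m "pci - {L}"] unfolding absq_def by simp
qed

sublocale char0: hopf_integral_char_0 scale comult counit antipode L
  by unfold_locales

lemma antipode_involutory: "S (S x) = x"
  using char0.involutory frob_one_nonzero by blast

theorem casimir_square:
  "sw (\<lambda>a1 a2. sw (\<lambda>b1 b2. a1 * b1 * S a2 * S b2) L) L =
     (\<Sum>E\<in>pci. scale (1 / (of_nat (vector_space.dim scaleV (V E)))\<^sup>2) E)" (is "?z = ?s")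
proof -
  have "?z - ?s = 0"
  proof (rule modules_faithful)
    fix E w assume E: "E \<in> pci" and w: "w \<in> V E"
    obtain BV where "hopf_irreducible scale comult counit antipode L scaleV (act E) (V E) BV"
      and card: "card BV = vector_space.dim scaleV (V E)"
      using irreducible_instance[OF E] .
    then interpret M: hopf_irreducible scale comult counit antipode L scaleV "act E" "V E" BV by simp
    let ?d = "of_nat (card BV) :: 'k"
    have "act E ?z w = M.twist (M.twist w)" by (rule M.act_casimir_square[OF w])
    also have "\<dots> = scaleV (1 / ?d ^ 2) w"
      by (simp add: M.twist_involutory[OF antipode_involutory] w M.V_closed power2_eq_square)
    also have "\<dots> = act E (E * ?s) w"
      by (simp add: pci_mult_sum[OF E] M.act_scale_left w act_self[OF E w] flip: card)
    also have "\<dots> = act E (?s * E) w"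
      by (simp only: central_idempotentD(1)[OF pciD(1)[OF E]])
    also have "\<dots> = act E ?s w" by (simp add: M.act_mult w act_self[OF E w])
    finally have "act E ?z w = act E ?s w" .
    moreover have "act E (?z - ?s) w + act E ?s w = act E ?z w"
      using w by (simp flip: M.act_add_left)
    ultimately show "act E (?z - ?s) w = 0" by simp
  qed
  then show ?thesis by simp
qed

end

theorem theorem2p8:
  fixes scale :: "'k::{alg_closed_field, field_char_0} \<Rightarrow> 'h::ring_1 \<Rightarrow> 'h"
    and comult :: "'h \<Rightarrow> ('h \<times> 'h) list"
    and counit :: "'h \<Rightarrow> 'k"
    and S :: "'h \<Rightarrow> 'h"
    and L :: 'h
    and scaleV :: "'k \<Rightarrow> 'v::ab_group_add \<Rightarrow> 'v"
    and act :: "'h \<Rightarrow> 'h \<Rightarrow> 'v \<Rightarrow> 'v"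
    and V :: "'h \<Rightarrow> 'v set"
    and d :: "'h \<Rightarrow> nat"
  assumes hopf: "finite_dim_hopf_algebra scale comult counit S"
    and semisimple: "semisimple_algebra scale"
    and integral: "idempotent_integral scale counit L"
    and modules: "\<And>E. E \<in> primitive_central_idempotents \<Longrightarrow>
           algebra_module scale scaleV (act E) (V E) \<and>
           algebra_module.irreducible_module scaleV (act E) (V E) \<and>
           (\<forall>v\<in>V E. act E E v = v) \<and>
           d E = vector_space.dim scaleV (V E)"
  shows "let z2 = (\<Sum>(a1, a2)\<leftarrow>comult L. \<Sum>(b1, b2)\<leftarrow>comult L. a1 * b1 * S a2 * S b2)
         in z2 = (\<Sum>E\<in>primitive_central_idempotents. scale (1 / (of_nat (d E))\<^sup>2) E) \<and>
            z2 \<in> center"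
proof -
  interpret finite_dim_hopf_algebra scale comult counit S by (rule hopf)
  interpret semisimple_hopf_modules scale comult counit S L scaleV act V
  proof (intro semisimple_hopf_modules.intro hopf_integral.intro hopf_integral_axioms.intro
      semisimple_hopf_modules_axioms.intro)
    show "finite_dim_hopf_algebra scale comult counit S" by (rule hopf)
    show "idempotent_integral scale counit L" by (rule integral)
    show "semisimple_algebra scale" by (rule semisimple)
    fix E :: 'h assume "E \<in> pci"
    note E = modules[OF this]
    show "algebra_module scale scaleV (act E) (V E)" using E by (rule conjunct1)
    show "algebra_module.irreducible_module scaleV (act E) (V E)" using E by (elim conjE)
    fix v assume "v \<in> V E"
    with E show "act E E v = v" by (elim conjE) (rule bspec)
  qed
  define z2 where "z2 = (\<Sum>(a1, a2)\<leftarrow>comult L. \<Sum>(b1, b2)\<leftarrow>comult L. a1 * b1 * S a2 * S b2)"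
  have "z2 = (\<Sum>E\<in>pci. scale (1 / (of_nat (vector_space.dim scaleV (V E)))\<^sup>2) E)"
    using casimir_square unfolding z2_def sw_def .
  also have "\<dots> = (\<Sum>E\<in>pci. scale (1 / (of_nat (d E))\<^sup>2) E)"
    using modules by (intro sum.cong refl) simp
  finally have "z2 = (\<Sum>E\<in>pci. scale (1 / (of_nat (d E))\<^sup>2) E)" .
  moreover from this have "z2 \<in> center" by (simp only: center_sum)
  ultimately show ?thesis by (simp add: z2_def Let_def)
qed

end
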